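(* Let $\mu$ be a probability distribution supported on a bounded, connected, $C^1$ domain $\Omega\subset\mathbb{R}^d$ with Lebesgue density $\rho$ bounded above and below by positive constants on $\Omega$, and let $\kappa>0$. Then there exists $T^*\in H^1(\Omega,\rho)$ (with values in $\mathbb{R}^m$) for which $$\mathcal{KL}(T^* )=\inf_{T:\Omega\to\mathbb{R}^m}\mathcal{KL}(T).$$
   Context: For $T=(T_1,\dots,T_m):\Omega\to\mathbb{R}^m$ define $$\mathcal{KL}(T)=\frac{\kappa^{2/d}}{2\pi e}\int_\Omega\sum_{i=1}^m|\nabla T_i(x)|^2\rho^{1-2/d}(x)\,dx+\log\left(\int_\Omega\int_\Omega\frac{1}{1+|T(x)-T(x')|^2}\rho(x)\rho(x')\,dx\,dx'\right),$$ where the gradients are weak gradients; the infimum is over measurable maps $T$, with $\mathcal{KL}(T)=+\infty$ if $T$ has no weak gradient in $L^2(\Omega)$. The space $H^1(\Omega,\rho)$ consists of maps $T:\Omega\to\mathbb{R}^m$ with weak gradient such that $\int_\Omega\left(|T|^2+\sum_{\ell=1}^m|\nabla T_\ell|^2\right)\rho\,dx<\infty$; since $\rho$ is bounded above and below it coincides with $H^1(\Omega;\mathbb{R}^m)$. *)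

theory Defs
  imports "HOL-Probability.Probability"
begin

section \<open>Functions of class $C^k$, test functions and weak gradients\<close>

primrec Ck :: "nat \<Rightarrow> ('a::euclidean_space \<Rightarrow> real) \<Rightarrow> bool" where
  "Ck 0 f \<longleftrightarrow> continuous_on UNIV f"
| "Ck (Suc k) f \<longleftrightarrow>
     (\<exists>G. (\<forall>x. GDERIV f x :> G x) \<and> (\<forall>b\<in>Basis. Ck k (\<lambda>x. G x \<bullet> b)))"

text \<open>The set of test functions $C_c^\infty(\Omega)$, each extended by zero to the whole space.\<close>

definition test_functions :: "'a::euclidean_space set \<Rightarrow> ('a \<Rightarrow> real) set" where
  "test_functions \<Omega> =
     {\<phi>. (\<forall>k. Ck k \<phi>) \<and> (\<exists>K. compact K \<and> K \<subseteq> \<Omega> \<and> (\<forall>x. x \<notin> K \<longrightarrow> \<phi> x = 0))}"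

definition locally_integrable ::
    "'a::euclidean_space set \<Rightarrow> ('a \<Rightarrow> 'b::euclidean_space) \<Rightarrow> bool" where
  "locally_integrable \<Omega> f \<longleftrightarrow> (\<forall>K. compact K \<and> K \<subseteq> \<Omega> \<longrightarrow> integrable (lebesgue_on K) f)"

definition has_weak_gradient ::
    "'a::euclidean_space set \<Rightarrow> ('a \<Rightarrow> real) \<Rightarrow> ('a \<Rightarrow> 'a) \<Rightarrow> bool" where
  "has_weak_gradient \<Omega> u G \<longleftrightarrow>
     locally_integrable \<Omega> u \<and> locally_integrable \<Omega> G \<and>
     (\<forall>\<phi>\<in>test_functions \<Omega>. \<forall>g. (\<forall>x. GDERIV \<phi> x :> g x) \<longrightarrow>
        (\<integral>x. u x *\<^sub>R g x \<partial>lebesgue_on \<Omega>) = - (\<integral>x. \<phi> x *\<^sub>R G x \<partial>lebesgue_on \<Omega>))"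

text \<open>Weak gradients on an open set are unique up to null sets; this picks a representative.
  It is meaningful only if a weak gradient exists.\<close>

definition weak_gradient :: "'a::euclidean_space set \<Rightarrow> ('a \<Rightarrow> real) \<Rightarrow> 'a \<Rightarrow> 'a" where
  "weak_gradient \<Omega> u = (SOME G. has_weak_gradient \<Omega> u G)"

section \<open>Open sets with $C^1$ boundary\<close>

text \<open>Near each boundary point, in suitable orthonormal coordinates, \<open>\<Omega>\<close> is the region strictly
  above the graph of a $C^1$ function. The unit vector \<open>\<nu>\<close> is the last coordinate axis,
  and \<open>x - (x \<bullet> \<nu>) *\<^sub>R \<nu>\<close> is the projection of \<open>x\<close> to the hyperplane orthogonal to \<open>\<nu>\<close>;
  only the values of \<open>\<gamma>\<close> on that hyperplane matter.\<close>

definition C1_domain :: "'a::euclidean_space set \<Rightarrow> bool" where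
  "C1_domain \<Omega> \<longleftrightarrow> open \<Omega> \<and>
     (\<forall>p\<in>frontier \<Omega>. \<exists>r>0. \<exists>\<nu> \<gamma>. norm \<nu> = 1 \<and> Ck 1 \<gamma> \<and>
        \<Omega> \<inter> ball p r = {x \<in> ball p r. x \<bullet> \<nu> > \<gamma> (x - (x \<bullet> \<nu>) *\<^sub>R \<nu>)})"

section \<open>Distributions with a density, the weighted Sobolev space and the functional\<close>

text \<open>\<open>\<mu>\<close> is a Borel measure on the whole space, concentrated on \<open>\<Omega>\<close>, where it has density \<open>\<rho>\<close>
  with respect to Lebesgue measure. The values of \<open>\<rho>\<close> outside \<open>\<Omega>\<close> are irrelevant.\<close>

definition has_density_on ::
    "'a::euclidean_space measure \<Rightarrow> 'a set \<Rightarrow> ('a \<Rightarrow> real) \<Rightarrow> bool" where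
  "has_density_on \<mu> \<Omega> \<rho> \<longleftrightarrow>
     sets \<mu> = sets borel \<and> \<rho> \<in> borel_measurable (lebesgue_on \<Omega>) \<and>
     (\<forall>A\<in>sets borel. emeasure \<mu> A = (\<integral>\<^sup>+x. ennreal (\<rho> x) * indicator A x \<partial>lebesgue_on \<Omega>))"

definition H1_weighted ::
    "(real^'d) set \<Rightarrow> (real^'d \<Rightarrow> real) \<Rightarrow> (real^'d \<Rightarrow> real^'m) set" where
  "H1_weighted \<Omega> \<rho> =
     {T \<in> borel_measurable (lebesgue_on \<Omega>).
        (\<forall>i. \<exists>G. has_weak_gradient \<Omega> (\<lambda>x. T x $ i) G) \<and>
        integrable (lebesgue_on \<Omega>)
          (\<lambda>x. ((norm (T x))\<^sup>2 + (\<Sum>i\<in>UNIV. (norm (weak_gradient \<Omega> (\<lambda>x. T x $ i) x))\<^sup>2)) * \<rho> x)}"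

text \<open>If \<open>\<rho>\<close> is a probability density bounded above and below by positive constants on \<open>\<Omega>\<close>, all
  integrals in the first branch are finite and the argument of the logarithm is positive.\<close>

definition KL ::
    "(real^'d) set \<Rightarrow> (real^'d \<Rightarrow> real) \<Rightarrow> real \<Rightarrow> (real^'d \<Rightarrow> real^'m) \<Rightarrow> ereal" where
  "KL \<Omega> \<rho> \<kappa> T =
     (if \<forall>i. \<exists>G. has_weak_gradient \<Omega> (\<lambda>x. T x $ i) G \<and>
                integrable (lebesgue_on \<Omega>) (\<lambda>x. (norm (G x))\<^sup>2)
      then ereal
        (\<kappa> powr (2 / real CARD('d)) / (2 * pi * exp 1) *
           (\<integral>x. (\<Sum>i\<in>UNIV. (norm (weak_gradient \<Omega> (\<lambda>x. T x $ i) x))\<^sup>2)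
                 * \<rho> x powr (1 - 2 / real CARD('d)) \<partial>lebesgue_on \<Omega>) +
         ln (\<integral>x. (\<integral>x'. 1 / (1 + (norm (T x - T x'))\<^sup>2) * \<rho> x * \<rho> x' \<partial>lebesgue_on \<Omega>)
               \<partial>lebesgue_on \<Omega>))
      else \<infinity>)"

end

theory Submission
  imports Defs "HOL-Complex_Analysis.Great_Picard"
begin

text \<open>
  The proof is the direct method. Write \<open>D\<close> for the sum of the squared $L^2$ norms of the weak
  gradients of the components of a map. Adding a constant vector to the map changes neither term of
  the functional, so it suffices to compare maps whose components have mean zero. For these the
  Poincare inequality bounds the $L^2$ norm by \<open>D\<close>, and since \<open>t \<mapsto> 1 / (1 + t)\<close> lies above its
  tangent lines, the argument of the logarithm is at least \<open>1 / (1 + C D)\<close>. The logarithm therefore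
  costs at most \<open>ln (1 + C D)\<close>, which the quadratic term outweighs (\<open>coercivity\<close>). Along a minimizing
  sequence of centred maps \<open>D\<close> stays bounded.

  Rellich's theorem gives a subsequence that converges in $L^1$ and almost everywhere
  (\<open>L1_compactness\<close>). The logarithmic term is not convex, but its integrand is bounded, so it
  converges by dominated convergence (\<open>similarity_tendsto\<close>). The quadratic term then converges along
  the sequence as well, and it remains to see that its value at the limit map is no larger
  (\<open>energy_lower_semicontinuous\<close>). Weak compactness of $L^2$ is replaced by a minimal norm argument
  (\<open>mazur_minimal_norm\<close>): choose convex combinations of the tails of the sequence of gradients with
  almost minimal norm. By the parallelogram law they form a Cauchy sequence, and the same convex
  combinations of the maps still converge to the limit map, so that the limit of the combined
  gradients is its weak gradient.

  The Poincare inequality and Rellich's theorem both come from one estimate (\<open>segment_poincare\<close>): if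
  all segments from points of \<open>A\<close> to points of \<open>B\<close> lie in \<open>W\<close>, then the integral of
  $(u(y) - u(x))^2$ over \<open>A \<times> B\<close> is bounded by a multiple of the integral of $|\nabla u|^2$ over \<open>W\<close>.
  This follows from $u(x + h) - u(x) = \int_0^1 \nabla u(x + t h) \cdot h \, dt$, which holds for weak
  gradients because the same identity holds for test functions (\<open>weak_gradient_translate\<close>).

  For the Poincare inequality, the pairs \<open>(A, B)\<close> that admit such a bound are chained through the
  domain (\<open>poincare_pair_trans\<close>). Inside, connectedness links any two small balls. At a boundary
  point, the domain is the region above a Lipschitz graph, so every point of a small piece of it sees
  a whole ball further up (\<open>boundary_patch\<close>). Compactness of the closure leaves finitely many
  pieces. For Rellich's theorem, the estimate is applied with \<open>A = B\<close> a cell of a fine grid: up to a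
  small error, a function with bounded gradient is known in $L^1$ from finitely many averages.
\<close>

section \<open>Smooth functions with compact support\<close>

text \<open>For \<open>p = 1\<close> this is the classical smooth function that is flat at \<open>0\<close>. The polynomial factor makes
  the family closed under differentiation.\<close>

definition flat_poly :: "real poly \<Rightarrow> real \<Rightarrow> real" where
  "flat_poly p t = (if t > 0 then poly p (1 / t) * exp (- (1 / t)) else 0)"

lemma tendsto_poly_times_exp_minus: "((\<lambda>s. poly p s * exp (- s)) \<longlongrightarrow> (0::real)) at_top"
proof -
  have "((\<lambda>s. \<Sum>i\<le>degree p. coeff p i * (s ^ i / exp s)) \<longlongrightarrow> (\<Sum>i\<le>degree p. coeff p i * 0)) at_top"
    by (intro tendsto_intros tendsto_power_div_exp_0)
  then show ?thesis
    by (simp add: poly_altdef exp_minus sum_distrib_right divide_inverse mult.assoc)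
qed

text \<open>To the right of \<open>0\<close> the difference quotient is again of the form \<open>q (1 / t) exp (- 1 / t)\<close>, which
  tends to \<open>0\<close> because the exponential beats every polynomial.\<close>

lemma flat_poly_has_derivative:
  "(flat_poly p has_real_derivative flat_poly (monom 1 2 * (p - pderiv p)) t) (at t)"
proof -
  consider "t > 0" | "t < 0" | "t = 0" by linarith
  then show ?thesis
  proof cases
    case 1
    have "((\<lambda>t. poly p (1 / t) * exp (- (1 / t))) has_real_derivative
        poly (pderiv p) (1 / t) * (- (1 / t^2)) * exp (- (1 / t)) + poly p (1 / t)
            * (exp (- (1 / t)) * (1 / t^2))) (at t)"
      using 1 by (auto intro!: derivative_eq_intros DERIV_chain2[OF poly_DERIV] simp: power2_eq_square)
    also have "poly (pderiv p) (1 / t) * (- (1 / t^2)) * exp (- (1 / t)) + poly p (1 / t)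
        * (exp (- (1 / t)) * (1 / t^2))
        = flat_poly (monom 1 2 * (p - pderiv p)) t"
      using 1 by (simp add: flat_poly_def poly_monom power_divide algebra_simps diff_divide_distrib)
    finally show ?thesis
      by (rule has_field_derivative_transform_within_open[where S = "{0<..}"])
        (use 1 in \<open>auto simp: flat_poly_def\<close>)
  next
    case 2
    have "((\<lambda>t. 0) has_real_derivative 0) (at t)" by simp
    then have "(flat_poly p has_real_derivative 0) (at t)"
      by (rule has_field_derivative_transform_within_open[where S = "{..<0}"])
        (use 2 in \<open>auto simp: flat_poly_def\<close>)
    then show ?thesis using 2 by (simp add: flat_poly_def)
  next
    case 3
    have "((\<lambda>h. flat_poly p h / h) \<longlongrightarrow> 0) (at_left 0)"
      by (rule Lim_transform_eventually[of "\<lambda>_. 0"])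
        (auto simp: flat_poly_def eventually_at_left_field intro!: exI[of _ "-1"])
    moreover have "((\<lambda>h. flat_poly p h / h) \<longlongrightarrow> 0) (at_right 0)"
    proof -
      have "((\<lambda>h. poly (pCons 0 p) (inverse h) * exp (- inverse h)) \<longlongrightarrow> 0) (at_right 0)"
        by (rule filterlim_compose[OF tendsto_poly_times_exp_minus filterlim_inverse_at_top_right])
      then show ?thesis
        by (rule Lim_transform_eventually)
          (auto simp: flat_poly_def eventually_at_right_field field_simps intro!: exI[of _ 1])
    qed
    ultimately have "((\<lambda>h. flat_poly p h / h) \<longlongrightarrow> 0) (at 0)"
      by (simp add: filterlim_split_at)
    then show ?thesis using 3
      by (simp add: DERIV_def flat_poly_def)
  qed
qed

text \<open>A ring of functions whose partial derivatives stay in the ring; membership therefore gives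
  membership in every class \<open>Ck k\<close> at once.\<close>

inductive_set smooth_ring :: "('a::euclidean_space \<Rightarrow> real) set" where
  const: "(\<lambda>x. c) \<in> smooth_ring"
| flat: "(\<lambda>x. flat_poly p (a + x \<bullet> v)) \<in> smooth_ring"
| add: "f \<in> smooth_ring \<Longrightarrow> g \<in> smooth_ring \<Longrightarrow> (\<lambda>x. f x + g x) \<in> smooth_ring"
| mult: "f \<in> smooth_ring \<Longrightarrow> g \<in> smooth_ring \<Longrightarrow> (\<lambda>x. f x * g x) \<in> smooth_ring"

lemma smooth_ring_gderiv:
  fixes f :: "'a::euclidean_space \<Rightarrow> real"
  assumes "f \<in> smooth_ring"
  shows "\<exists>G. (\<forall>x. GDERIV f x :> G x) \<and> (\<forall>b. (\<lambda>x. G x \<bullet> b) \<in> smooth_ring)"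
  using assms
proof induction
  case (const c)
  show ?case
    by (rule exI[of _ "\<lambda>_. 0"]) (auto simp: GDERIV_const intro: smooth_ring.const)
next
  case (flat p a v)
  let ?q = "monom 1 2 * (p - pderiv p)"
  have "GDERIV (\<lambda>x. a + x \<bullet> v) x :> v" for x :: 'a
    unfolding gderiv_def by (auto intro!: derivative_eq_intros)
  then have "GDERIV (\<lambda>x. flat_poly p (a + x \<bullet> v)) x :> flat_poly ?q (a + x \<bullet> v) *\<^sub>R v" for x
    by (rule GDERIV_DERIV_compose) (rule flat_poly_has_derivative)
  then show ?case
    by (intro exI[of _ "\<lambda>x. flat_poly ?q (a + x \<bullet> v) *\<^sub>R v"])
      (auto intro!: smooth_ring.mult smooth_ring.const smooth_ring.flat)
next
  case (add f g)
  then obtain F G where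
    "\<And>x. GDERIV f x :> F x" "\<And>b. (\<lambda>x. F x \<bullet> b) \<in> smooth_ring"
    "\<And>x. GDERIV g x :> G x" "\<And>b. (\<lambda>x. G x \<bullet> b) \<in> smooth_ring" by blast
  then show ?case
    by (intro exI[of _ "\<lambda>x. F x + G x"])
      (auto intro!: GDERIV_add smooth_ring.add simp: inner_add_left)
next
  case (mult f g)
  then obtain F G where
    "\<And>x. GDERIV f x :> F x" "\<And>b. (\<lambda>x. F x \<bullet> b) \<in> smooth_ring"
    "\<And>x. GDERIV g x :> G x" "\<And>b. (\<lambda>x. G x \<bullet> b) \<in> smooth_ring" by blast
  then show ?case using mult.hyps
    by (intro exI[of _ "\<lambda>x. f x *\<^sub>R G x + g x *\<^sub>R F x"])
      (auto intro!: GDERIV_mult smooth_ring.add smooth_ring.mult simp: inner_add_left)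
qed

lemma GDERIV_imp_continuous:
  assumes "\<And>x. GDERIV f x :> G x" shows "continuous_on UNIV f"
  using assms unfolding gderiv_def
  by (auto intro!: continuous_at_imp_continuous_on dest: has_derivative_continuous)

lemma smooth_ring_Ck: "f \<in> smooth_ring \<Longrightarrow> Ck k f"
proof (induction k arbitrary: f)
  case 0
  then show ?case using smooth_ring_gderiv[OF 0] GDERIV_imp_continuous by auto
next
  case (Suc k)
  then show ?case using smooth_ring_gderiv[OF Suc.prems] by auto
qed

text \<open>The scaling by \<open>n\<close> lets the bumps increase to the indicator of the open box: each factor tends
  to \<open>1\<close> where its argument is positive and vanishes elsewhere.\<close>

definition box_bump :: "'a::euclidean_space \<Rightarrow> 'a \<Rightarrow> nat \<Rightarrow> 'a \<Rightarrow> real" where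
  "box_bump l r n x = (\<Prod>b\<in>Basis. flat_poly 1 (real n * (x \<bullet> b - l \<bullet> b))
      * flat_poly 1 (real n * (r \<bullet> b - x \<bullet> b)))"

lemma smooth_ring_prod:
  "finite I \<Longrightarrow> (\<And>i. i \<in> I \<Longrightarrow> f i \<in> smooth_ring) \<Longrightarrow> (\<lambda>x. \<Prod>i\<in>I. f i x) \<in> smooth_ring"
  by (induction rule: finite_induct) (auto intro!: smooth_ring.const smooth_ring.mult)

lemma box_bump_smooth: "box_bump l r n \<in> smooth_ring"
proof -
  have 1: "(\<lambda>x::'a. flat_poly 1 (real n * (x \<bullet> b - l \<bullet> b))) \<in> smooth_ring" for b
    using smooth_ring.flat[of 1 "- real n * (l \<bullet> b)" "real n *\<^sub>R b"] by (simp add: algebra_simps)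
  have 2: "(\<lambda>x::'a. flat_poly 1 (real n * (r \<bullet> b - x \<bullet> b))) \<in> smooth_ring" for b
    using smooth_ring.flat[of 1 "real n * (r \<bullet> b)" "- real n *\<^sub>R b"] by (simp add: algebra_simps)
  show ?thesis unfolding box_bump_def[abs_def]
    by (intro smooth_ring_prod smooth_ring.mult 1 2) simp
qed

lemma flat_poly_1_bounds: "0 \<le> flat_poly 1 t" "flat_poly 1 t \<le> 1"
  by (auto simp: flat_poly_def)

lemma box_bump_bounds: "0 \<le> box_bump l r n x" "box_bump l r n x \<le> 1"
  unfolding box_bump_def
  by (auto intro!: prod_nonneg prod_le_1 mult_nonneg_nonneg mult_le_one flat_poly_1_bounds)

lemma box_bump_eq_0: "x \<notin> box l r \<Longrightarrow> box_bump l r n x = 0"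
  by (force simp: box_bump_def mem_box flat_poly_def not_less zero_less_mult_iff)

lemma box_bump_tendsto: "(\<lambda>n. box_bump l r n x) \<longlonglongrightarrow> indicator (box l r) x"
proof (cases "x \<in> box l r")
  case True
  have *: "(\<lambda>n. flat_poly 1 (real n * s)) \<longlonglongrightarrow> 1" if "s > 0" for s
  proof -
    have "(\<lambda>n. exp (- ((1 / s) * inverse (real n)))) \<longlonglongrightarrow> exp (- ((1 / s) * 0))"
      by (intro tendsto_intros LIMSEQ_inverse_real_of_nat lim_inverse_n)
    moreover have "\<forall>\<^sub>F n in sequentially. exp (- ((1 / s) * inverse (real n))) = flat_poly 1 (real n * s)"
      using eventually_gt_at_top[of 0] by eventually_elim (use that in \<open>simp add: flat_poly_def field_simps\<close>)
    ultimately show ?thesis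
      using Lim_transform_eventually by fastforce
  qed
  have "(\<lambda>n. box_bump l r n x) \<longlonglongrightarrow> (\<Prod>b\<in>(Basis::'a set). 1 * 1)"
    unfolding box_bump_def using True
    by (intro tendsto_prod tendsto_mult *) (auto simp: mem_box)
  then show ?thesis using True by simp
qed (simp add: box_bump_eq_0)

lemma box_bump_test_function: "cbox l r \<subseteq> \<Omega> \<Longrightarrow> box_bump l r n \<in> test_functions \<Omega>"
  unfolding test_functions_def using box_bump_eq_0[of _ l r n] box_subset_cbox[of l r]
  by (auto intro!: smooth_ring_Ck box_bump_smooth exI[of _ "cbox l r"] compact_cbox)

lemma Ck_translate: "Ck k f \<Longrightarrow> Ck k (\<lambda>x. f (x - h))"
proof (induction k arbitrary: f)
  case 0
  then show ?case by (auto intro!: continuous_on_compose2[of UNIV f] continuous_intros)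
next
  case (Suc k)
  then obtain G where G: "\<And>x. GDERIV f x :> G x" "\<And>b. b \<in> Basis \<Longrightarrow> Ck k (\<lambda>x. G x \<bullet> b)" by auto
  have "GDERIV (\<lambda>x. f (x - h)) x :> G (x - h)" for x
  proof -
    have "((\<lambda>x. x - h) has_derivative (\<lambda>y. y)) (at x)" by (auto intro!: derivative_eq_intros)
    from has_derivative_compose[OF this, of f "\<lambda>y. y \<bullet> G (x - h)"] G(1)[of "x - h"]
    show ?thesis by (simp add: gderiv_def)
  qed
  then show ?case using G(2) Suc.IH[of "\<lambda>x. G x \<bullet> _"] by (auto intro!: exI[of _ "\<lambda>x. G (x - h)"])
qed

lemma GDERIV_unique: "GDERIV f x :> a \<Longrightarrow> GDERIV f x :> b \<Longrightarrow> a = b"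
proof -
  assume "GDERIV f x :> a" "GDERIV f x :> b"
  then have "(\<lambda>h. h \<bullet> a) = (\<lambda>h. h \<bullet> b)"
    unfolding gderiv_def by (rule has_derivative_unique)
  then have "(a - b) \<bullet> a = (a - b) \<bullet> b" by (rule fun_cong)
  then have "(a - b) \<bullet> (a - b) = 0" by (simp add: inner_diff_right)
  then show ?thesis by simp
qed

lemma Ck_gradient_continuous:
  assumes "Ck 1 f" "\<And>x. GDERIV f x :> g x"
  shows "continuous_on UNIV g"
proof -
  obtain G where G: "\<And>x. GDERIV f x :> G x" "\<And>b. b \<in> Basis \<Longrightarrow> continuous_on UNIV (\<lambda>x. G x \<bullet> b)"
    using assms(1) by auto
  have "G = g" using GDERIV_unique G(1) assms(2) by blast
  then show ?thesis using G(2) by (subst continuous_on_componentwise) simp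
qed

text \<open>The gradient of a test function is unique, hence continuous because of the class \<open>Ck 1\<close>, and it
  vanishes off the support because the complement of a compact set is open.\<close>

lemma test_function_gradient:
  assumes "\<phi> \<in> test_functions \<Omega>"
  obtains g K B where "\<And>x. GDERIV \<phi> x :> g x" "continuous_on UNIV \<phi>" "continuous_on UNIV g"
    "compact K" "K \<subseteq> \<Omega>" "\<And>x. x \<notin> K \<Longrightarrow> \<phi> x = 0" "\<And>x. x \<notin> K \<Longrightarrow> g x = 0"
    "\<And>x. \<bar>\<phi> x\<bar> \<le> B" "\<And>x. norm (g x) \<le> B"
proof -
  obtain K where K: "compact K" "K \<subseteq> \<Omega>" "\<And>x. x \<notin> K \<Longrightarrow> \<phi> x = 0" and C: "\<And>k. Ck k \<phi>"
    using assms by (auto simp: test_functions_def)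
  obtain g where g: "\<And>x. GDERIV \<phi> x :> g x" using C[of "Suc 0"] by auto
  have cg: "continuous_on UNIV g" using Ck_gradient_continuous[of \<phi> g] C[of 1] g by simp
  have cp: "continuous_on UNIV \<phi>" using C[of 0] by simp
  have g0: "g x = 0" if "x \<notin> K" for x
  proof -
    have "open (- K)" using K(1) by (simp add: compact_imp_closed open_Compl)
    moreover have "GDERIV (\<lambda>_. 0) x :> 0" by (rule GDERIV_const)
    ultimately have "GDERIV \<phi> x :> 0"
      unfolding gderiv_def
      by (rule_tac has_derivative_transform_within_open[of "\<lambda>_. 0" _ x UNIV "- K"]) (use that K(3) in auto)
    then show ?thesis using g GDERIV_unique by blast
  qed
  have "bounded (\<phi> ` K)" "bounded (g ` K)"
    using K(1) cp cg by (auto intro!: compact_imp_bounded compact_continuous_image continuous_on_subset[of UNIV])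
  then obtain B1 B2 where B: "\<And>x. x \<in> K \<Longrightarrow> \<bar>\<phi> x\<bar> \<le> B1" "\<And>x. x \<in> K \<Longrightarrow> norm (g x) \<le> B2"
    by (auto simp: bounded_iff)
  have "\<bar>\<phi> x\<bar> \<le> max 0 (max B1 B2) \<and> norm (g x) \<le> max 0 (max B1 B2)" for x
    by (cases "x \<in> K") (use K(3) g0 B in \<open>force simp: max_def\<close>)+
  then show ?thesis using that[OF g cp cg K g0] by blast
qed

lemma test_function_translate:
  assumes "\<phi> \<in> test_functions \<Omega>" and "compact K" "\<And>x. x \<notin> K \<Longrightarrow> \<phi> x = 0" "\<And>x. x \<in> K \<Longrightarrow> x + h \<in> \<Omega>'"
  shows "(\<lambda>x. \<phi> (x - h)) \<in> test_functions \<Omega>'"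
proof -
  have "compact ((\<lambda>x. x + h) ` K)"
    using assms(2) by (auto intro!: compact_continuous_image continuous_intros)
  moreover have "\<phi> (x - h) = 0" if "x \<notin> (\<lambda>x. x + h) ` K" for x
    by (rule assms(3)) (use that in \<open>force simp: image_iff\<close>)
  ultimately show ?thesis
    using assms by (auto simp: test_functions_def intro!: Ck_translate exI[of _ "(\<lambda>x. x + h) ` K"])
qed

section \<open>Test functions separate locally integrable functions\<close>

text \<open>Boxes are stable under intersection and generate the Borel sets, so on a fixed box all integrals
  of \<open>f\<close> over Borel subsets vanish. Countably many such boxes cover the open set.\<close>

lemma AE_zero_if_box_integrals_zero:
  fixes f :: "'a::euclidean_space \<Rightarrow> 'b::{banach, second_countable_topology}"
  assumes "open S"
    and int: "\<And>l r. cbox l r \<subseteq> S \<Longrightarrow> integrable lborel (\<lambda>x. indicator (cbox l r) x *\<^sub>R f x)"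
    and zero: "\<And>l r. cbox l r \<subseteq> S \<Longrightarrow> (\<integral>x. indicator (box l r) x *\<^sub>R f x \<partial>lborel) = 0"
  shows "AE x in lborel. x \<in> S \<longrightarrow> f x = 0"
proof -
  have on_box: "AE x in lborel. x \<in> box c d \<longrightarrow> f x = 0" if cd: "cbox c d \<subseteq> S" for c d
  proof -
    define F where "F = (\<lambda>x. indicator (box c d) x *\<^sub>R f x)"
    have "(\<lambda>x. indicator (box c d) x *\<^sub>R indicator (cbox c d) x *\<^sub>R f x) = F"
      using box_subset_cbox[of c d] by (auto simp: F_def fun_eq_iff indicator_def of_bool_def subset_iff)
    with integrable_mult_indicator[OF _ int[OF cd], of "box c d"]
    have intF: "integrable lborel F" by simp
    have sub: "(\<integral>x. indicator A x *\<^sub>R F x \<partial>lborel) = 0" if "A \<in> sets lborel" for A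
    proof -
      let ?G = "range (\<lambda>(a, b). box a b::'a set)"
      have st: "Int_stable ?G" by (auto simp: Int_stable_def box_Int_box)
      have A: "A \<in> sigma_sets UNIV ?G"
        using that by (simp add: borel_eq_box)
      show ?thesis
      proof (rule sigma_sets_induct_disjoint[OF st _ A])
        show "?G \<subseteq> Pow UNIV" by simp
      next
        fix B assume "B \<in> ?G"
        then obtain a b where B: "B = box a b" by auto
        obtain a' b' where ab: "box a b \<inter> box c d = box a' b'" by (auto simp: box_Int_box)
        have eq: "indicator B x *\<^sub>R F x = indicator (box a' b') x *\<^sub>R f x" for x
          by (auto simp: F_def B indicator_def ab[symmetric])
        show "(\<integral>x. indicator B x *\<^sub>R F x \<partial>lborel) = 0"
        proof (cases "box a' b' = {}")
          case False
          then have "cbox a' b' = closure (box a' b')" by simp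
          also have "\<dots> \<subseteq> closure (cbox c d)"
            using ab box_subset_cbox[of c d] by (intro closure_mono) auto
          finally have "cbox a' b' \<subseteq> S" using cd by (simp add: closure_closed)
          then show ?thesis unfolding eq by (rule zero)
        qed (simp add: eq)
      next
        show "(\<integral>x. indicator {} x *\<^sub>R F x \<partial>lborel) = 0" by simp
      next
        fix B assume B: "B \<in> sigma_sets UNIV ?G" "(\<integral>x. indicator B x *\<^sub>R F x \<partial>lborel) = 0"
        have Bm: "B \<in> sets lborel" using B by (simp add: borel_eq_box)
        have "(\<integral>x. indicator (UNIV - B) x *\<^sub>R F x \<partial>lborel) = (\<integral>x. F x - indicator B x *\<^sub>R F x \<partial>lborel)"
          by (intro Bochner_Integration.integral_cong) (auto simp: indicator_def)
        also have "\<dots> = 0"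
          using B(2) zero[OF cd] integrable_mult_indicator[OF Bm intF] intF
          by (subst Bochner_Integration.integral_diff) (auto simp: F_def)
        finally show "(\<integral>x. indicator (UNIV - B) x *\<^sub>R F x \<partial>lborel) = 0" .
      next
        fix B :: "nat \<Rightarrow> 'a set"
        assume B: "disjoint_family B" "range B \<subseteq> sigma_sets UNIV ?G"
          "\<And>i. (\<integral>x. indicator (B i) x *\<^sub>R F x \<partial>lborel) = 0"
        have Bm: "B i \<in> sets lborel" for i using B(2) by (auto simp: borel_eq_box)
        have "(LINT x:(\<Union>i. B i)|lborel. F x) = (\<Sum>i. (LINT x:(B i)|lborel. F x))"
          using B(1) Bm intF
          by (intro lebesgue_integral_countable_add)
            (auto simp: disjoint_family_on_def set_integrable_def intro!: integrable_mult_indicator)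
        then show "(\<integral>x. indicator (\<Union>i. B i) x *\<^sub>R F x \<partial>lborel) = 0"
          using B(3) by (simp add: set_lebesgue_integral_def)
      qed
    qed
    have "AE x in lborel. F x = 0"
      by (rule sigma_finite_measure.density_unique_banach[OF sigma_finite_lborel, where f' = "\<lambda>_. 0"])
        (auto intro!: intF simp: set_lebesgue_integral_def sub)
    then show ?thesis by eventually_elim (auto simp: F_def)
  qed
  define D where "D = {(c, d). cbox c d \<subseteq> S}"
  have cover: "S = (\<Union>(c, d)\<in>D. box c d)"
  proof (intro equalityI subsetI)
    fix x assume "x \<in> S"
    then obtain a b where "cbox a b \<subseteq> S" "x \<in> box a b"
      using open_contains_cbox[OF \<open>open S\<close> \<open>x \<in> S\<close>] by metis
    then show "x \<in> (\<Union>(c, d)\<in>D. box c d)" by (auto simp: D_def)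
  next
    fix x assume "x \<in> (\<Union>(c, d)\<in>D. box c d)"
    then obtain c d where "x \<in> box c d" "cbox c d \<subseteq> S" by (auto simp: D_def)
    then show "x \<in> S" using box_subset_cbox[of c d] by (meson subsetD)
  qed
  obtain D' where D': "D' \<subseteq> (\<lambda>(c, d). box c d) ` D" "countable D'" "\<Union>D' = \<Union>((\<lambda>(c, d). box c d) ` D)"
  proof (rule Lindelof[of "(\<lambda>(c, d). box c d) ` D"])
    show "open B" if "B \<in> (\<lambda>(c, d). box c d) ` D" for B using that by (auto simp: open_box)
  qed
  have "AE x in lborel. \<forall>B\<in>D'. x \<in> B \<longrightarrow> f x = 0"
    using D'(1,2) on_box by (subst AE_ball_countable) (auto simp: D_def)
  then show ?thesis
    by eventually_elim (use D'(3) cover in blast)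
qed

lemma box_bump_borel [measurable]: "box_bump l r n \<in> borel_measurable borel"
  using smooth_ring_Ck[OF box_bump_smooth, of 0 l r n] by (simp add: borel_measurable_continuous_onI)

lemma box_bump_integral_tendsto:
  fixes f :: "'a::euclidean_space \<Rightarrow> 'b::{banach, second_countable_topology}"
  assumes int: "integrable lborel (\<lambda>x. indicator (cbox l r) x *\<^sub>R f x)"
  shows "(\<lambda>n. \<integral>x. box_bump l r n x *\<^sub>R f x \<partial>lborel) \<longlonglongrightarrow> (\<integral>x. indicator (box l r) x *\<^sub>R f x \<partial>lborel)"
proof -
  define F where "F = (\<lambda>x. indicator (cbox l r) x *\<^sub>R f x)"
  have int: "integrable lborel F" using int unfolding F_def .
  then have [measurable]: "F \<in> borel_measurable lborel" by (rule borel_measurable_integrable)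
  have 1: "box_bump l r n x *\<^sub>R f x = box_bump l r n x *\<^sub>R F x" for n x
    using box_bump_eq_0[of x l r n] box_subset_cbox[of l r] by (auto simp: F_def indicator_def)
  have 2: "indicator (box l r) x *\<^sub>R f x = indicator (box l r) x *\<^sub>R F x" for x
    using box_subset_cbox[of l r] by (auto simp: F_def indicator_def)
  show ?thesis unfolding 1 2
  proof (rule integral_dominated_convergence[where w = "\<lambda>x. norm (F x)"])
    show "AE x in lborel. (\<lambda>n. box_bump l r n x *\<^sub>R F x) \<longlonglongrightarrow> indicator (box l r) x *\<^sub>R F x"
      by (intro AE_I2 tendsto_intros box_bump_tendsto)
    show "AE x in lborel. norm (box_bump l r n x *\<^sub>R F x) \<le> norm (F x)" for n
      using box_bump_bounds[of l r n] by (intro AE_I2) (auto simp: mult.assoc intro!: mult_left_le_one_le)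
    show "integrable lborel (\<lambda>x. norm (F x))" using int by (rule integrable_norm)
    show "(\<lambda>x. box_bump l r n x *\<^sub>R F x) \<in> borel_measurable lborel" for n
      by (intro borel_measurable_scaleR) measurable
    show "(\<lambda>x. indicator (box l r) x *\<^sub>R F x) \<in> borel_measurable lborel"
      by (intro borel_measurable_scaleR) measurable
  qed
qed

lemma fundamental_lemma_calculus_of_variations:
  fixes f :: "'a::euclidean_space \<Rightarrow> 'b::{banach, second_countable_topology}"
  assumes "open S"
    and int: "\<And>K. compact K \<Longrightarrow> K \<subseteq> S \<Longrightarrow> integrable lborel (\<lambda>x. indicator K x *\<^sub>R f x)"
    and zero: "\<And>\<phi>. \<phi> \<in> test_functions S \<Longrightarrow> (\<integral>x. \<phi> x *\<^sub>R f x \<partial>lborel) = 0"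
  shows "AE x in lborel. x \<in> S \<longrightarrow> f x = 0"
proof (rule AE_zero_if_box_integrals_zero[OF assms(1)])
  fix l r :: 'a assume lr: "cbox l r \<subseteq> S"
  show i: "integrable lborel (\<lambda>x. indicator (cbox l r) x *\<^sub>R f x)" by (rule int[OF compact_cbox lr])
  from box_bump_integral_tendsto[OF i] zero[OF box_bump_test_function[OF lr]]
  show "(\<integral>x. indicator (box l r) x *\<^sub>R f x \<partial>lborel) = 0"
    by (simp add: LIMSEQ_const_iff)
qed

text \<open>A weak gradient whose function and gradient are Borel on the whole space and zero outside the
  domain. In this form everything is an integral over \<open>lborel\<close>, where translations are measurable and
  Fubini's theorem applies directly; Lebesgue measurable functions do not compose well with the map
  \<open>(x, t) \<mapsto> x + t h\<close>.\<close>

definition borel_weak_gradient :: "'a::euclidean_space set \<Rightarrow> ('a \<Rightarrow> real) \<Rightarrow> ('a \<Rightarrow> 'a) \<Rightarrow> bool" where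
  "borel_weak_gradient \<Omega> u G \<longleftrightarrow>
     u \<in> borel_measurable borel \<and> G \<in> borel_measurable borel \<and>
     (\<forall>x. x \<notin> \<Omega> \<longrightarrow> u x = 0 \<and> G x = 0) \<and>
     (\<forall>K. compact K \<and> K \<subseteq> \<Omega> \<longrightarrow>
        integrable lborel (\<lambda>x. indicator K x *\<^sub>R u x) \<and> integrable lborel (\<lambda>x. indicator K x *\<^sub>R G x)) \<and>
     (\<forall>\<phi>\<in>test_functions \<Omega>. \<forall>g. (\<forall>x. GDERIV \<phi> x :> g x) \<longrightarrow>
        (\<integral>x. u x *\<^sub>R g x \<partial>lborel) = - (\<integral>x. \<phi> x *\<^sub>R G x \<partial>lborel))"

text \<open>An open set is a countable union of compact sets, and measurability can be checked on those.\<close>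

lemma locally_integrable_measurable:
  assumes "open \<Omega>" "locally_integrable \<Omega> f"
  shows "f \<in> borel_measurable (lebesgue_on \<Omega>)"
proof -
  obtain C :: "nat \<Rightarrow> 'a set" where C: "\<And>n. compact (C n)" "\<And>n. C n \<subseteq> \<Omega>" "(\<Union>n. C n) = \<Omega>"
    using open_Union_compact_subsets[OF assms(1)] by metis
  have Cm: "C n \<in> sets lebesgue" for n
    using C(1) by (simp add: borel_compact)
  have \<Omega>m: "\<Omega> \<in> sets lebesgue" using assms(1) by simp
  show ?thesis
  proof (rule measurable_piecewise_restrict[where C = "range C"])
    fix K assume "K \<in> range C"
    then obtain n where K: "K = C n" by auto
    show "K \<inter> space (lebesgue_on \<Omega>) \<in> sets (lebesgue_on \<Omega>)"
      using Cm[of n] \<Omega>m by (auto simp: sets_restrict_space K)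
    have "restrict_space (lebesgue_on \<Omega>) K = lebesgue_on K"
      using C(2)[of n] Cm[of n] \<Omega>m by (subst restrict_restrict_space) (auto simp: K Int_absorb1)
    then show "f \<in> borel_measurable (restrict_space (lebesgue_on \<Omega>) K)"
      using assms(2) C(1,2)[of n] by (auto simp: locally_integrable_def K intro: borel_measurable_integrable)
  qed (use C(3) in auto)
qed

lemma lebesgue_borel_version:
  fixes f :: "'a::euclidean_space \<Rightarrow> 'b::euclidean_space"
  assumes "f \<in> borel_measurable lebesgue"
  shows "\<exists>g\<in>borel_measurable borel. AE x in lborel. f x = g x"
proof -
  have "\<exists>g\<in>borel_measurable borel. AE x in lborel. f x \<bullet> b = g x" for b
    using completion_ex_borel_measurable_real[of "\<lambda>x. f x \<bullet> b" lborel] assms by simp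
  then obtain g where g: "\<And>b. g b \<in> borel_measurable borel" "\<And>b. AE x in lborel. f x \<bullet> b = g b x"
    by metis
  have "AE x in lborel. \<forall>b\<in>Basis. f x \<bullet> b = g b x"
    by (intro AE_finite_allI g) simp
  then have "AE x in lborel. f x = (\<Sum>b\<in>Basis. g b x *\<^sub>R b)"
  proof eventually_elim
    case (elim x)
    have "f x = (\<Sum>b\<in>Basis. (f x \<bullet> b) *\<^sub>R b)" by (rule euclidean_representation[symmetric])
    also have "\<dots> = (\<Sum>b\<in>Basis. g b x *\<^sub>R b)" using elim by (intro sum.cong) auto
    finally show ?case .
  qed
  moreover have "(\<lambda>x. \<Sum>b\<in>Basis. g b x *\<^sub>R b) \<in> borel_measurable borel"
    using g(1) by measurable
  ultimately show ?thesis by (intro bexI[of _ "\<lambda>x. \<Sum>b\<in>Basis. g b x *\<^sub>R b"])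
qed

lemma lebesgue_on_borel_version:
  fixes f :: "'a::euclidean_space \<Rightarrow> 'b::euclidean_space"
  assumes "open \<Omega>" "f \<in> borel_measurable (lebesgue_on \<Omega>)"
  obtains g where "g \<in> borel_measurable borel" "\<And>x. x \<notin> \<Omega> \<Longrightarrow> g x = 0" "AE x in lebesgue_on \<Omega>. f x = g x"
proof -
  have \<Omega>m: "\<Omega> \<in> sets lebesgue" using assms(1) by simp
  have "(\<lambda>x. if x \<in> \<Omega> then f x else 0) \<in> borel_measurable lebesgue"
    by (rule borel_measurable_if_I[OF assms(2) \<Omega>m])
  then obtain g where g: "g \<in> borel_measurable borel" "AE x in lborel. (if x \<in> \<Omega> then f x else 0) = g x"
    using lebesgue_borel_version by blast
  have [measurable]: "\<Omega> \<in> sets borel" using assms(1) by simp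
  have "AE x in lebesgue. (if x \<in> \<Omega> then f x else 0) = g x"
    using g(2) by (rule AE_completion)
  then have "AE x in lebesgue. x \<in> \<Omega> \<longrightarrow> f x = (if x \<in> \<Omega> then g x else 0)"
    by eventually_elim (auto split: if_splits)
  then have "AE x in lebesgue_on \<Omega>. f x = (if x \<in> \<Omega> then g x else 0)"
    using \<Omega>m by (subst AE_restrict_space_iff) simp_all
  moreover have "(\<lambda>x. if x \<in> \<Omega> then g x else 0) \<in> borel_measurable borel"
    using g(1) by measurable
  ultimately show ?thesis by (intro that[of "\<lambda>x. if x \<in> \<Omega> then g x else 0"]) auto
qed

lemma integral_lebesgue_on_eq_lborel:
  fixes f :: "'a::euclidean_space \<Rightarrow> 'b::{banach, second_countable_topology}"
  assumes "open \<Omega>" "f \<in> borel_measurable borel" "\<And>x. x \<notin> \<Omega> \<Longrightarrow> f x = 0"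
  shows "(\<integral>x. f x \<partial>lebesgue_on \<Omega>) = (\<integral>x. f x \<partial>lborel)"
proof -
  have "(\<integral>x. f x \<partial>lebesgue_on \<Omega>) = (\<integral>x. indicator \<Omega> x *\<^sub>R f x \<partial>lebesgue)"
    using assms(1) by (subst integral_restrict_space) auto
  also have "(\<lambda>x. indicator \<Omega> x *\<^sub>R f x) = f" using assms(3) by (auto simp: indicator_def)
  finally show ?thesis using assms(2) by (simp add: integral_completion)
qed

lemma nn_integral_lebesgue_on_eq_lborel:
  assumes "\<Omega> \<in> sets lebesgue"
  shows "(\<integral>\<^sup>+x. f x \<partial>lebesgue_on \<Omega>) = (\<integral>\<^sup>+x. f x * indicator \<Omega> x \<partial>lborel)"
  using assms by (subst nn_integral_restrict_space) (auto simp: nn_integral_completion)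

lemma AE_lebesgue_on_eq_lborel:
  assumes "\<Omega> \<in> sets lebesgue"
  shows "(AE x in lebesgue_on \<Omega>. P x) \<longleftrightarrow> (AE x in lborel. x \<in> \<Omega> \<longrightarrow> P x)"
  using assms by (subst AE_restrict_space_iff) (auto simp: AE_completion_iff)

lemma borel_weak_gradientI:
  assumes \<Omega>: "open \<Omega>" and wg: "has_weak_gradient \<Omega> u G"
    and U: "U \<in> borel_measurable borel" "\<And>x. x \<notin> \<Omega> \<Longrightarrow> U x = 0" "AE x in lebesgue_on \<Omega>. u x = U x"
    and H: "H \<in> borel_measurable borel" "\<And>x. x \<notin> \<Omega> \<Longrightarrow> H x = 0" "AE x in lebesgue_on \<Omega>. G x = H x"
  shows "borel_weak_gradient \<Omega> U H"
proof -
  have lu: "locally_integrable \<Omega> u" and lG: "locally_integrable \<Omega> G"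
    using wg by (auto simp: has_weak_gradient_def)
  have \<Omega>m: "\<Omega> \<in> sets lebesgue" using \<Omega> by simp
  note mu = locally_integrable_measurable[OF \<Omega> lu] and mG = locally_integrable_measurable[OF \<Omega> lG]
  note [measurable] = U(1) H(1) mu mG
  have Hm [measurable]: "H \<in> borel_measurable (lebesgue_on \<Omega>)" "U \<in> borel_measurable (lebesgue_on \<Omega>)"
    using U(1) H(1) by (auto simp: measurable_restrict_space1 measurable_completion)
  have loc: "integrable lborel (\<lambda>x. indicator K x *\<^sub>R f' x)"
    if K: "compact K" "K \<subseteq> \<Omega>" and f: "locally_integrable \<Omega> f" "f' \<in> borel_measurable borel"
        "AE x in lebesgue_on \<Omega>. f x = f' x"
    for K and f f' :: "'a \<Rightarrow> 'c::euclidean_space"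
  proof -
    have Ks: "K \<in> sets borel" using K(1) by (rule borel_compact)
    then have Kl: "K \<in> sets lebesgue" by simp
    have fm [measurable]: "f' \<in> borel_measurable lebesgue" using f(2) by (simp add: measurable_completion)
    have "AE x in lebesgue_on K. f x = f' x"
      using f(3) unfolding AE_lebesgue_on_eq_lborel[OF \<Omega>m] AE_lebesgue_on_eq_lborel[OF Kl]
      by eventually_elim (use K(2) in blast)
    moreover have "integrable (lebesgue_on K) f" using f(1) K by (auto simp: locally_integrable_def)
    moreover have "f' \<in> borel_measurable (lebesgue_on K)" by (simp add: measurable_restrict_space1)
    ultimately have "integrable (lebesgue_on K) f'"
      by (subst integrable_cong_AE[of f' _ f]) (auto elim: eventually_mono intro: borel_measurable_integrable)
    then have "integrable lebesgue (\<lambda>x. indicator K x *\<^sub>R f' x)"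
      using Ks by (subst (asm) integrable_restrict_space) auto
    then show ?thesis using f(2) Ks by (simp add: integrable_completion)
  qed
  have id: "(\<integral>x. U x *\<^sub>R g x \<partial>lborel) = - (\<integral>x. \<phi> x *\<^sub>R H x \<partial>lborel)"
    if \<phi>: "\<phi> \<in> test_functions \<Omega>" and g: "\<And>x. GDERIV \<phi> x :> g x" for \<phi> g
  proof -
    obtain g' where g': "\<And>x. GDERIV \<phi> x :> g' x" "continuous_on UNIV \<phi>" "continuous_on UNIV g'"
      using test_function_gradient[OF \<phi>] by metis
    have "g' = g" using g g' GDERIV_unique by blast
    then have [measurable]: "g \<in> borel_measurable borel" "\<phi> \<in> borel_measurable borel"
      using g' by (auto intro: borel_measurable_continuous_onI)
    have [measurable]: "g \<in> borel_measurable (lebesgue_on \<Omega>)" "\<phi> \<in> borel_measurable (lebesgue_on \<Omega>)"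
      by (auto simp: measurable_restrict_space1 measurable_completion)
    have "(\<integral>x. U x *\<^sub>R g x \<partial>lborel) = (\<integral>x. U x *\<^sub>R g x \<partial>lebesgue_on \<Omega>)"
      using U(2) \<Omega> by (intro integral_lebesgue_on_eq_lborel[symmetric]) auto
    also have "\<dots> = (\<integral>x. u x *\<^sub>R g x \<partial>lebesgue_on \<Omega>)"
      using U(3) by (intro integral_cong_AE) (auto elim: eventually_mono)
    also have "\<dots> = - (\<integral>x. \<phi> x *\<^sub>R G x \<partial>lebesgue_on \<Omega>)"
      using wg \<phi> g by (auto simp: has_weak_gradient_def)
    also have "(\<integral>x. \<phi> x *\<^sub>R G x \<partial>lebesgue_on \<Omega>) = (\<integral>x. \<phi> x *\<^sub>R H x \<partial>lebesgue_on \<Omega>)"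
      using H(3) by (intro integral_cong_AE) (auto elim: eventually_mono)
    also have "\<dots> = (\<integral>x. \<phi> x *\<^sub>R H x \<partial>lborel)"
      using H(2) \<Omega> by (intro integral_lebesgue_on_eq_lborel) auto
    finally show ?thesis .
  qed
  show ?thesis
    using U H loc[OF _ _ lu U(1,3)] loc[OF _ _ lG H(1,3)] id by (auto simp: borel_weak_gradient_def)
qed

lemma has_weak_gradient_borel_version:
  assumes \<Omega>: "open \<Omega>" and wg: "has_weak_gradient \<Omega> u G"
  obtains U H where "borel_weak_gradient \<Omega> U H" "AE x in lebesgue_on \<Omega>. u x = U x" "AE x in lebesgue_on \<Omega>. G x
      = H x"
proof -
  have lu: "locally_integrable \<Omega> u" and lG: "locally_integrable \<Omega> G"
    using wg by (auto simp: has_weak_gradient_def)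
  have \<Omega>m: "\<Omega> \<in> sets lebesgue" using \<Omega> by simp
  note mu = locally_integrable_measurable[OF \<Omega> lu] and mG = locally_integrable_measurable[OF \<Omega> lG]
  obtain U where U: "U \<in> borel_measurable borel" "\<And>x. x \<notin> \<Omega> \<Longrightarrow> U x = 0" "AE x in lebesgue_on \<Omega>. u x = U x"
    by (rule lebesgue_on_borel_version[OF \<Omega> mu]) (rule that)
  obtain H where H: "H \<in> borel_measurable borel" "\<And>x. x \<notin> \<Omega> \<Longrightarrow> H x = 0" "AE x in lebesgue_on \<Omega>. G x = H x"
    by (rule lebesgue_on_borel_version[OF \<Omega> mG]) (rule that)
  show ?thesis
    by (rule that[OF borel_weak_gradientI[OF \<Omega> wg U H] U(3) H(3)])
qed

text \<open>This makes the choice in \<open>weak_gradient\<close> harmless: every integral over the chosen representative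
  can be computed with any other weak gradient.\<close>

lemma weak_gradient_AE_unique:
  assumes \<Omega>: "open \<Omega>" and wg: "has_weak_gradient \<Omega> u G" "has_weak_gradient \<Omega> u G'"
  shows "AE x in lebesgue_on \<Omega>. G x = G' x"
proof -
  obtain U H where 1: "borel_weak_gradient \<Omega> U H" "AE x in lebesgue_on \<Omega>. u x = U x" "AE x in lebesgue_on \<Omega>. G x
      = H x"
    by (rule has_weak_gradient_borel_version[OF \<Omega> wg(1)]) (rule that)
  obtain U' H' where 2: "borel_weak_gradient \<Omega> U' H'" "AE x in lebesgue_on \<Omega>. u x = U' x"
      "AE x in lebesgue_on \<Omega>. G' x = H' x"
    by (rule has_weak_gradient_borel_version[OF \<Omega> wg(2)]) (rule that)
  have [measurable]: "U \<in> borel_measurable borel" "U' \<in> borel_measurable borel"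
      "H \<in> borel_measurable borel" "H' \<in> borel_measurable borel"
    using 1(1) 2(1) by (auto simp: borel_weak_gradient_def)
  have out: "x \<notin> \<Omega> \<Longrightarrow> U x = 0 \<and> U' x = 0" for x using 1(1) 2(1) by (auto simp: borel_weak_gradient_def)
  have \<Omega>m: "\<Omega> \<in> sets lebesgue" using \<Omega> by simp
  have "AE x in lebesgue_on \<Omega>. U x = U' x" using 1(2) 2(2) by eventually_elim simp
  then have UU: "AE x in lborel. U x = U' x"
    unfolding AE_lebesgue_on_eq_lborel[OF \<Omega>m] by eventually_elim (use out in force)
  have intH: "integrable lborel (\<lambda>x. indicator K x *\<^sub>R H x)" "integrable lborel (\<lambda>x. indicator K x *\<^sub>R H' x)"
    if "compact K" "K \<subseteq> \<Omega>" for K using that 1(1) 2(1) by (auto simp: borel_weak_gradient_def)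
  have "AE x in lborel. x \<in> \<Omega> \<longrightarrow> H x - H' x = 0"
  proof (rule fundamental_lemma_calculus_of_variations[OF \<Omega>])
    fix K assume K: "compact K" "K \<subseteq> \<Omega>"
    show "integrable lborel (\<lambda>x. indicator K x *\<^sub>R (H x - H' x))"
      using Bochner_Integration.integrable_diff[OF intH[OF K]] by (simp add: scaleR_diff_right)
  next
    fix \<phi> :: "'a \<Rightarrow> real" assume \<phi>: "\<phi> \<in> test_functions \<Omega>"
    obtain g K B where g: "\<And>x. GDERIV \<phi> x :> g x" "continuous_on UNIV \<phi>" "continuous_on UNIV g"
       "compact K" "K \<subseteq> \<Omega>" "\<And>x. x \<notin> K \<Longrightarrow> \<phi> x = 0" "\<And>x. \<bar>\<phi> x\<bar> \<le> B"
      using test_function_gradient[OF \<phi>] by metis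
    have [measurable]: "\<phi> \<in> borel_measurable borel" "g \<in> borel_measurable borel"
      using g by (auto intro: borel_measurable_continuous_onI)
    have i: "integrable lborel (\<lambda>x. \<phi> x *\<^sub>R h x)"
      if "integrable lborel (\<lambda>x. indicator K x *\<^sub>R h x)" "h \<in> borel_measurable borel" for h :: "'a \<Rightarrow> 'a"
      by (rule Bochner_Integration.integrable_bound[OF integrable_scaleR_right[OF that(1), of B]])
        (use that g in \<open>auto simp: indicator_def abs_mult intro!: mult_right_mono order.trans[OF g(7) abs_ge_self]\<close>)
    have "(\<integral>x. U x *\<^sub>R g x \<partial>lborel) = (\<integral>x. U' x *\<^sub>R g x \<partial>lborel)"
      using UU by (intro integral_cong_AE) (auto elim: eventually_mono)
    moreover have "(\<integral>x. U x *\<^sub>R g x \<partial>lborel) = - (\<integral>x. \<phi> x *\<^sub>R H x \<partial>lborel)"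
       "(\<integral>x. U' x *\<^sub>R g x \<partial>lborel) = - (\<integral>x. \<phi> x *\<^sub>R H' x \<partial>lborel)"
      using 1(1) 2(1) \<phi> g(1) by (auto simp: borel_weak_gradient_def)
    ultimately show "(\<integral>x. \<phi> x *\<^sub>R (H x - H' x) \<partial>lborel) = 0"
      using i[OF intH(1)[OF g(4,5)]] i[OF intH(2)[OF g(4,5)]]
      by (simp add: scaleR_diff_right Bochner_Integration.integral_diff)
  qed
  then have "AE x in lebesgue_on \<Omega>. H x = H' x"
    using \<Omega> by (simp add: AE_lebesgue_on_eq_lborel)
  then show ?thesis using 1(3) 2(3) by eventually_elim simp
qed

section \<open>Weak gradients along segments\<close>

lemma nn_integral_lborel_affine:
  fixes f :: "'a::euclidean_space \<Rightarrow> ennreal"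
  assumes [measurable]: "f \<in> borel_measurable borel" and "c \<noteq> 0"
  shows "(\<integral>\<^sup>+x. f x \<partial>lborel) = ennreal (\<bar>c\<bar> ^ DIM('a)) * (\<integral>\<^sup>+x. f (t + c *\<^sub>R x) \<partial>lborel)"
proof -
  have "(\<integral>\<^sup>+x. f x \<partial>lborel) = (\<integral>\<^sup>+x. f x \<partial>density (distr lborel borel (\<lambda>x. t + c *\<^sub>R x)) (\<lambda>_. \<bar>c\<bar> ^ DIM('a)))"
    using lborel_affine[OF assms(2), of t] by simp
  then show ?thesis
    by (simp add: nn_integral_density nn_integral_distr nn_integral_cmult)
qed

lemma nn_integral_lborel_translate:
  fixes f :: "'a::euclidean_space \<Rightarrow> ennreal"
  assumes "f \<in> borel_measurable borel"
  shows "(\<integral>\<^sup>+x. f (x + h) \<partial>lborel) = (\<integral>\<^sup>+x. f x \<partial>lborel)"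
  using nn_integral_lborel_affine[OF assms, of 1 h] by (simp add: add.commute)

lemma integral_lborel_translate:
  fixes f :: "'a::euclidean_space \<Rightarrow> 'b::{banach, second_countable_topology}"
  assumes [measurable]: "f \<in> borel_measurable borel"
  shows "(\<integral>x. f (x + h) \<partial>lborel) = (\<integral>x. f x \<partial>lborel)"
proof -
  have "(\<integral>x. f x \<partial>lborel) = (\<integral>x. f x \<partial>distr lborel borel ((+) h))" by (simp add: lborel_distr_plus)
  also have "\<dots> = (\<integral>x. f (h + x) \<partial>lborel)" by (subst integral_distr) auto
  finally show ?thesis by (simp add: add.commute)
qed

lemma integrable_lborel_translate:
  fixes f :: "'a::euclidean_space \<Rightarrow> 'b::{banach, second_countable_topology}"
  assumes "integrable lborel f"
  shows "integrable lborel (\<lambda>x. f (x + h))"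
proof -
  have [measurable]: "f \<in> borel_measurable borel" using assms by auto
  have "integrable (distr lborel borel ((+) h)) f" using assms by (simp add: lborel_distr_plus)
  then show ?thesis by (subst (asm) integrable_distr_eq) (auto simp: add.commute)
qed

lemma test_function_FTC:
  assumes g: "\<And>x. GDERIV \<phi> x :> g x" "continuous_on UNIV g"
  shows "(\<integral>t. (g (x + t *\<^sub>R h) \<bullet> h) * indicator {0..1} t \<partial>lborel) = \<phi> (x + h) - \<phi> x"
proof -
  have "(\<integral>t. (g (x + t *\<^sub>R h) \<bullet> h) * indicator {0..1} t \<partial>lborel) = \<phi> (x + 1 *\<^sub>R h) - \<phi> (x + 0 *\<^sub>R h)"
  proof (rule integral_FTC_Icc_real)
    fix t :: real
    have "((\<lambda>t. x + t *\<^sub>R h) has_derivative (\<lambda>s. s *\<^sub>R h)) (at t)"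
      by (auto intro!: derivative_eq_intros)
    from has_derivative_compose[OF this] g(1)[of "x + t *\<^sub>R h"]
    have "((\<lambda>t. \<phi> (x + t *\<^sub>R h)) has_derivative (\<lambda>s. (s *\<^sub>R h) \<bullet> g (x + t *\<^sub>R h))) (at t)"
      unfolding gderiv_def by blast
    then show "((\<lambda>t. \<phi> (x + t *\<^sub>R h)) has_real_derivative g (x + t *\<^sub>R h) \<bullet> h) (at t)"
      by (simp add: has_field_derivative_def inner_commute mult_commute_abs)
    have "continuous_on UNIV (\<lambda>t. g (x + t *\<^sub>R h) \<bullet> h)"
      by (intro continuous_intros continuous_on_compose2[OF g(2)]) auto
    then show "isCont (\<lambda>t. g (x + t *\<^sub>R h) \<bullet> h) t" by (simp add: continuous_on_eq_continuous_at)
  qed simp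
  then show ?thesis by simp
qed

definition segment_in :: "'a::euclidean_space set \<Rightarrow> 'a \<Rightarrow> 'a set" where
  "segment_in \<Omega> h = {x. \<forall>t\<in>{0..1}. x + t *\<^sub>R h \<in> \<Omega>}"

lemma open_segment_in:
  assumes "open \<Omega>" shows "open (segment_in \<Omega> h)"
  unfolding open_contains_ball
proof (intro ballI)
  fix x assume x: "x \<in> segment_in \<Omega> h"
  let ?K = "(\<lambda>t. x + t *\<^sub>R h) ` {0..1::real}"
  have "compact ?K" by (intro compact_continuous_image continuous_intros compact_Icc)
  moreover have "?K \<subseteq> \<Omega>" using x by (auto simp: segment_in_def)
  ultimately obtain e where e: "e > 0" "(\<Union>x\<in>?K. ball x e) \<subseteq> \<Omega>"
    using compact_subset_open_imp_ball_epsilon_subset assms by metis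
  have "ball x e \<subseteq> segment_in \<Omega> h"
  proof
    fix y assume y: "y \<in> ball x e"
    have "y + t *\<^sub>R h \<in> \<Omega>" if t: "t \<in> {0..1}" for t
    proof -
      have "y + t *\<^sub>R h \<in> ball (x + t *\<^sub>R h) e" using y by (simp add: dist_norm)
      then show ?thesis using e(2) t by blast
    qed
    then show "y \<in> segment_in \<Omega> h" by (simp add: segment_in_def)
  qed
  with e(1) show "\<exists>e>0. ball x e \<subseteq> segment_in \<Omega> h" by blast
qed

text \<open>By duality. For a test function \<open>\<phi>\<close> on the set of admissible base points, translating the variable
  moves the increment of \<open>u\<close> to \<open>\<phi>\<close>. There the fundamental theorem of calculus writes it as an
  integral over \<open>t\<close> of a gradient of the translated test function \<open>\<phi> (\<cdot> - t h)\<close>, which still has its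
  support in \<open>\<Omega>\<close>. The definition of the weak gradient and a translation back give the claim tested
  against \<open>\<phi>\<close>; the fundamental lemma removes \<open>\<phi>\<close>.\<close>

lemma weak_gradient_translate:
  assumes \<Omega>: "open \<Omega>" and wg: "borel_weak_gradient \<Omega> u G"
  shows "AE x in lborel. x \<in> segment_in \<Omega> h \<longrightarrow>
           u (x + h) - u x - (\<integral>t. indicator {0..1} t * (G (x + t *\<^sub>R h) \<bullet> h) \<partial>lborel) = 0"
proof (rule fundamental_lemma_calculus_of_variations[OF open_segment_in[OF \<Omega>]])
  have [measurable]: "u \<in> borel_measurable borel" "G \<in> borel_measurable borel"
    using wg by (auto simp: borel_weak_gradient_def)
  define b where "b = (\<lambda>x. \<integral>t. indicator {0..1} t * (G (x + t *\<^sub>R h) \<bullet> h) \<partial>lborel)"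
  define tube where "tube = (\<lambda>K. (\<lambda>(x, t). x + t *\<^sub>R h) ` (K \<times> {0..1::real}))"
  have tube: "compact (tube K)" "tube K \<subseteq> \<Omega>" "tube K \<in> sets borel" "K \<in> sets borel" "K \<subseteq> tube K"
    "\<And>x t. x \<in> K \<Longrightarrow> 0 \<le> t \<Longrightarrow> t \<le> 1 \<Longrightarrow> x + t *\<^sub>R h \<in> tube K"
    if K: "compact K" "K \<subseteq> segment_in \<Omega> h" for K
  proof -
    show c: "compact (tube K)"
      unfolding tube_def case_prod_beta
      by (intro compact_continuous_image compact_Times K continuous_intros) simp
    show "tube K \<in> sets borel" "K \<in> sets borel" using c K by (simp_all add: borel_compact)
    show "tube K \<subseteq> \<Omega>" using K(2) by (force simp: tube_def segment_in_def)
    show *: "x + t *\<^sub>R h \<in> tube K" if "x \<in> K" "0 \<le> t" "t \<le> 1" for x t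
      unfolding tube_def using that by (intro image_eqI[of _ _ "(x, t)"]) auto
    show "K \<subseteq> tube K" using *[of _ 0] by auto
  qed
  have int: "integrable lborel (\<lambda>x. indicator K x *\<^sub>R u x)" "integrable lborel (\<lambda>x. indicator K x *\<^sub>R G x)"
    if "compact K" "K \<subseteq> \<Omega>" for K using wg that by (auto simp: borel_weak_gradient_def)
  \<comment> \<open>The segments that start in a compact set sweep out a compact subset of \<open>\<Omega>\<close>.\<close>
  have J: "integrable (lborel \<Otimes>\<^sub>M lborel) (\<lambda>(t::real, x). indicator {0..1} t * indicator K x
      * (G (x + t *\<^sub>R h) \<bullet> h))"
    if K: "compact K" "K \<subseteq> segment_in \<Omega> h" for K
  proof (rule integrableI_bounded)
    note [measurable] = tube(3,4)[OF K]
    show "(\<lambda>(t::real, x). indicator {0..1} t * indicator K x * (G (x + t *\<^sub>R h) \<bullet> h))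
        \<in> borel_measurable (lborel \<Otimes>\<^sub>M lborel)"
      by measurable
    define I where "I = (\<integral>\<^sup>+x. ennreal (norm (indicator (tube K) x *\<^sub>R G x)) \<partial>lborel)"
    have I: "I < \<infinity>" using int(2)[OF tube(1,2)[OF K]] by (auto simp: integrable_iff_bounded I_def)
    have inner: "(\<integral>\<^sup>+x. ennreal (norm (indicator {0..1} t * indicator K x * (G (x + t *\<^sub>R h) \<bullet> h))) \<partial>lborel)
        \<le> indicator {0..1} t * (ennreal (norm h) * I)" for t :: real
    proof -
      have "(\<integral>\<^sup>+x. ennreal (norm (indicator {0..1} t * indicator K x * (G (x + t *\<^sub>R h) \<bullet> h))) \<partial>lborel)
        \<le> (\<integral>\<^sup>+x. indicator {0..1} t * (ennreal (norm h)
            * ennreal (norm (indicator (tube K) (x + t *\<^sub>R h) *\<^sub>R G (x + t *\<^sub>R h)))) \<partial>lborel)"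
        using tube(6)[OF K, of _ t] Cauchy_Schwarz_ineq2[of "G (_ + t *\<^sub>R h)" h]
        by (intro nn_integral_mono)
          (auto simp: indicator_def ennreal_mult[symmetric] mult.commute intro!: ennreal_leI)
      also have "\<dots> = indicator {0..1} t * (ennreal (norm h)
          * (\<integral>\<^sup>+x. ennreal (norm (indicator (tube K) (x + t *\<^sub>R h) *\<^sub>R G (x + t *\<^sub>R h))) \<partial>lborel))"
        by (simp add: nn_integral_cmult del: norm_scaleR)
      also have "(\<integral>\<^sup>+x. ennreal (norm (indicator (tube K) (x + t *\<^sub>R h) *\<^sub>R G (x + t *\<^sub>R h))) \<partial>lborel) = I"
        unfolding I_def by (rule nn_integral_lborel_translate[of
            "\<lambda>x. ennreal (norm (indicator (tube K) x *\<^sub>R G x))"]) measurable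
      finally show ?thesis .
    qed
    have "(\<integral>\<^sup>+z. ennreal (norm (case z of (t::real, x) \<Rightarrow> indicator {0..1} t * indicator K x
        * (G (x + t *\<^sub>R h) \<bullet> h))) \<partial>(lborel \<Otimes>\<^sub>M lborel))
       = (\<integral>\<^sup>+t. (\<integral>\<^sup>+x. ennreal (norm (indicator {0..1} (t::real) * indicator K x
           * (G (x + t *\<^sub>R h) \<bullet> h))) \<partial>lborel) \<partial>lborel)"
      by (subst lborel.nn_integral_fst[symmetric]) simp_all
    also have "\<dots> \<le> (\<integral>\<^sup>+t. indicator {0..1::real} t * (ennreal (norm h) * I) \<partial>lborel)"
      by (intro nn_integral_mono inner)
    also have "\<dots> = ennreal (norm h) * I" by (subst nn_integral_multc) auto
    also have "\<dots> < \<infinity>" using I by (simp add: ennreal_mult_less_top)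
    finally show "(\<integral>\<^sup>+z. ennreal (norm (case z of (t::real, x) \<Rightarrow> indicator {0..1} t * indicator K x
        * (G (x + t *\<^sub>R h) \<bullet> h))) \<partial>(lborel \<Otimes>\<^sub>M lborel)) < \<infinity>" .
  qed
  have ib: "integrable lborel (\<lambda>x. indicator K x * b x)" if K: "compact K" "K \<subseteq> segment_in \<Omega> h" for K
  proof -
    have "integrable lborel (\<lambda>x. \<integral>t. indicator {0..1::real} t * indicator K x * (G (x + t *\<^sub>R h) \<bullet> h) \<partial>lborel)"
      using lborel_pair.integrable_snd[OF J[OF K]] .
    also have "(\<lambda>x. \<integral>t. indicator {0..1::real} t * indicator K x * (G (x + t *\<^sub>R h) \<bullet> h) \<partial>lborel)
        = (\<lambda>x. indicator K x * b x)"
      unfolding b_def by (simp add: mult.commute mult.left_commute fun_eq_iff flip: integral_mult_right_zero)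
    finally show ?thesis .
  qed
  have iu: "integrable lborel (\<lambda>x. indicator K x * u x)" "integrable lborel (\<lambda>x. indicator K x * u (x + h))"
    if K: "compact K" "K \<subseteq> segment_in \<Omega> h" for K
  proof -
    have "K \<subseteq> \<Omega>" using tube(2,5)[OF K] by blast
    then show "integrable lborel (\<lambda>x. indicator K x * u x)" using int(1)[OF K(1)] by simp
    have c: "compact ((\<lambda>x. x + h) ` K)" using K(1) by (intro compact_continuous_image continuous_intros)
    have "(\<lambda>x. x + h) ` K \<subseteq> \<Omega>" using tube(2)[OF K] tube(6)[OF K, of _ 1] by auto
    from integrable_lborel_translate[OF int(1)[OF c this], of h]
    have "integrable lborel (\<lambda>x. indicator ((\<lambda>x. x + h) ` K) (x + h) * u (x + h))" by simp
    also have "(\<lambda>x. indicator ((\<lambda>x. x + h) ` K) (x + h) * u (x + h)) = (\<lambda>x. indicator K x * u (x + h))"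
      by (auto simp: indicator_def fun_eq_iff)
    finally show "integrable lborel (\<lambda>x. indicator K x * u (x + h))" .
  qed
  show "integrable lborel (\<lambda>x. indicator K x
      *\<^sub>R (u (x + h) - u x - (\<integral>t. indicator {0..1} t * (G (x + t *\<^sub>R h) \<bullet> h) \<partial>lborel)))"
    if K: "compact K" "K \<subseteq> segment_in \<Omega> h" for K
    using Bochner_Integration.integrable_diff[OF Bochner_Integration.integrable_diff[OF iu(2)[OF K] iu(1)[OF K]] ib[OF K]]
    by (simp add: b_def algebra_simps)
  fix \<phi> :: "'a \<Rightarrow> real" assume \<phi>: "\<phi> \<in> test_functions (segment_in \<Omega> h)"
  obtain g K B where g: "\<And>x. GDERIV \<phi> x :> g x" "continuous_on UNIV \<phi>" "continuous_on UNIV g"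
    "compact K" "K \<subseteq> segment_in \<Omega> h" "\<And>x. x \<notin> K \<Longrightarrow> \<phi> x = 0" "\<And>x. x \<notin> K \<Longrightarrow> g x = 0"
    "\<And>x. \<bar>\<phi> x\<bar> \<le> B" "\<And>x. norm (g x) \<le> B"
    using test_function_gradient[OF \<phi>] by metis
  have B0: "0 \<le> B" using g(8)[of 0] by simp
  have [measurable]: "\<phi> \<in> borel_measurable borel" "g \<in> borel_measurable borel"
    using g by (auto intro: borel_measurable_continuous_onI)
  note tK = tube[OF g(4,5)]
  note [measurable] = tK(3,4)
  have ip: "integrable lborel (\<lambda>x. \<phi> x * f x)"
    if "integrable lborel (\<lambda>x. indicator K x * f x)" for f
  proof -
    have "integrable lborel (\<lambda>x. \<phi> x * (indicator K x * f x))"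
      by (rule Bochner_Integration.integrable_bound[OF integrable_mult_right[OF that, of B]])
        (use that B0 g(8) in \<open>auto simp: abs_mult intro!: mult_right_mono borel_measurable_times\<close>)
    also have "(\<lambda>x. \<phi> x * (indicator K x * f x)) = (\<lambda>x. \<phi> x * f x)"
      using g(6) by (auto simp: indicator_def fun_eq_iff)
    finally show ?thesis .
  qed
  \<comment> \<open>The increment of \<open>u\<close> becomes an increment of the test function.\<close>
  have shift: "(\<integral>x. \<phi> x * u (x + h) \<partial>lborel) = (\<integral>x. \<phi> (x - h) * u x \<partial>lborel)"
    using integral_lborel_translate[of "\<lambda>x. \<phi> (x - h) * u x" h] by simp
  have int_shift: "integrable lborel (\<lambda>x. \<phi> (x - h) * u x)"
    using integrable_lborel_translate[OF ip[OF iu(2)[OF g(4,5)]], of "- h"] by simp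
  have FTC: "(\<integral>t. (g (x - t *\<^sub>R h) \<bullet> h) * indicator {0..1} t \<partial>lborel) = \<phi> x - \<phi> (x - h)" for x
  proof -
    have "- (\<integral>t. (g (x - t *\<^sub>R h) \<bullet> h) * indicator {0..1} t \<partial>lborel) = \<phi> (x - h) - \<phi> x"
      using test_function_FTC[OF g(1,3), of x "- h"] by simp
    then show ?thesis by linarith
  qed
  have J1: "integrable (lborel \<Otimes>\<^sub>M lborel) (\<lambda>(t::real, x). u x * ((g (x - t *\<^sub>R h) \<bullet> h) * indicator {0..1} t))"
  proof (rule integrableI_bounded)
    show "(\<lambda>(t::real, x). u x * ((g (x - t *\<^sub>R h) \<bullet> h) * indicator {0..1} t))
        \<in> borel_measurable (lborel \<Otimes>\<^sub>M lborel)"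
      by measurable
    define I where "I = (\<integral>\<^sup>+x. ennreal (norm (indicator (tube K) x *\<^sub>R u x)) \<partial>lborel)"
    have I: "I < \<infinity>" using int(1)[OF tK(1,2)] by (auto simp: integrable_iff_bounded I_def)
    have inner: "(\<integral>\<^sup>+x. ennreal (norm (u x * ((g (x - t *\<^sub>R h) \<bullet> h) * indicator {0..1} t))) \<partial>lborel)
        \<le> indicator {0..1} t * (ennreal (B * norm h) * I)" for t :: real
    proof -
      have *: "norm (u x * ((g (x - t *\<^sub>R h) \<bullet> h) * indicator {0..1} t)) \<le>
          indicator {0..1} t * ((B * norm h) * norm (indicator (tube K) x *\<^sub>R u x))" for x
      proof (cases "t \<in> {0..1} \<and> x \<in> tube K")
        case True
        have "\<bar>g (x - t *\<^sub>R h) \<bullet> h\<bar> \<le> B * norm h"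
          using Cauchy_Schwarz_ineq2[of "g (x - t *\<^sub>R h)" h] mult_right_mono[OF g(9)[of "x - t *\<^sub>R h"], of
              "norm h"] by simp
        then have "\<bar>u x\<bar> * \<bar>g (x - t *\<^sub>R h) \<bullet> h\<bar> \<le> \<bar>u x\<bar> * (B * norm h)" by (intro mult_left_mono) auto
        then show ?thesis using True by (simp add: abs_mult mult.commute)
      next
        case False
        then have "t \<notin> {0..1} \<or> g (x - t *\<^sub>R h) = 0"
          using tK(6)[of "x - t *\<^sub>R h" t] g(7)[of "x - t *\<^sub>R h"] by auto
        then show ?thesis using B0 by auto
      qed
      have "(\<integral>\<^sup>+x. ennreal (norm (u x * ((g (x - t *\<^sub>R h) \<bullet> h) * indicator {0..1} t))) \<partial>lborel)
        \<le> (\<integral>\<^sup>+x. indicator {0..1} t * (ennreal (B * norm h)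
            * ennreal (norm (indicator (tube K) x *\<^sub>R u x))) \<partial>lborel)"
      proof (rule nn_integral_mono)
        fix x
        have "ennreal (norm (u x * ((g (x - t *\<^sub>R h) \<bullet> h) * indicator {0..1} t)))
           \<le> ennreal (indicator {0..1} t * ((B * norm h) * norm (indicator (tube K) x *\<^sub>R u x)))"
          by (rule ennreal_leI[OF *])
        also have "\<dots> = indicator {0..1} t
            * (ennreal (B * norm h) * ennreal (norm (indicator (tube K) x *\<^sub>R u x)))"
          using B0 by (subst ennreal_mult ennreal_mult; simp add: ennreal_indicator)+
        finally show "ennreal (norm (u x * ((g (x - t *\<^sub>R h) \<bullet> h) * indicator {0..1} t)))
           \<le> indicator {0..1} t * (ennreal (B * norm h) * ennreal (norm (indicator (tube K) x *\<^sub>R u x)))" .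
      qed
      also have "\<dots> = indicator {0..1} t * (ennreal (B * norm h) * I)"
        unfolding I_def by (simp add: nn_integral_cmult)
      finally show ?thesis .
    qed
    have "(\<integral>\<^sup>+z. ennreal (norm (case z of (t::real, x) \<Rightarrow> u x
        * ((g (x - t *\<^sub>R h) \<bullet> h) * indicator {0..1} t))) \<partial>(lborel \<Otimes>\<^sub>M lborel))
       = (\<integral>\<^sup>+t. (\<integral>\<^sup>+x. ennreal (norm (u x
           * ((g (x - t *\<^sub>R h) \<bullet> h) * indicator {0..1} (t::real)))) \<partial>lborel) \<partial>lborel)"
      by (subst lborel.nn_integral_fst[symmetric]) simp_all
    also have "\<dots> \<le> (\<integral>\<^sup>+t. indicator {0..1::real} t * (ennreal (B * norm h) * I) \<partial>lborel)"
      by (intro nn_integral_mono inner)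
    also have "\<dots> = ennreal (B * norm h) * I" by (subst nn_integral_multc) auto
    also have "\<dots> < \<infinity>" using I by (simp add: ennreal_mult_less_top)
    finally show "(\<integral>\<^sup>+z. ennreal (norm (case z of (t::real, x) \<Rightarrow> u x
        * ((g (x - t *\<^sub>R h) \<bullet> h) * indicator {0..1} t))) \<partial>(lborel \<Otimes>\<^sub>M lborel)) < \<infinity>" .
  qed
  have J2: "integrable (lborel \<Otimes>\<^sub>M lborel) (\<lambda>(t::real, x). \<phi> x * (indicator {0..1} t * (G (x + t *\<^sub>R h) \<bullet> h)))"
  proof (rule Bochner_Integration.integrable_bound[OF integrable_mult_right[OF J[OF g(4,5)], of B]])
    show "AE z in lborel \<Otimes>\<^sub>M lborel. norm (case z of (t::real, x) \<Rightarrow> \<phi> x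
        * (indicator {0..1} t * (G (x + t *\<^sub>R h) \<bullet> h)))
       \<le> norm (B * (case z of (t, x) \<Rightarrow> indicator {0..1} t * indicator K x * (G (x + t *\<^sub>R h) \<bullet> h)))"
      using g(6) g(8) B0 by (intro AE_I2) (auto simp: indicator_def abs_mult intro!: mult_right_mono)
  qed measurable
  have wk: "(\<integral>x. u x * (g (x - t *\<^sub>R h) \<bullet> h) \<partial>lborel) = - (\<integral>x. \<phi> x * (G (x + t *\<^sub>R h) \<bullet> h) \<partial>lborel)"
    if t: "0 \<le> t" "t \<le> 1" for t
  proof -
    have sub: "(\<lambda>x. x + t *\<^sub>R h) ` K \<subseteq> \<Omega>" using tK(2,6) t by auto
    have tst: "(\<lambda>x. \<phi> (x - t *\<^sub>R h)) \<in> test_functions \<Omega>"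
      by (rule test_function_translate[OF \<phi> g(4,6)]) (use sub in auto)
    have gd: "GDERIV (\<lambda>x. \<phi> (x - t *\<^sub>R h)) x :> g (x - t *\<^sub>R h)" for x
    proof -
      have "((\<lambda>x. x - t *\<^sub>R h) has_derivative (\<lambda>y. y)) (at x)" by (auto intro!: derivative_eq_intros)
      from has_derivative_compose[OF this] g(1)[of "x - t *\<^sub>R h"]
      show ?thesis unfolding gderiv_def by blast
    qed
    have eq: "(\<integral>x. u x *\<^sub>R g (x - t *\<^sub>R h) \<partial>lborel) = - (\<integral>x. \<phi> (x - t *\<^sub>R h) *\<^sub>R G x \<partial>lborel)"
      using wg tst gd by (auto simp: borel_weak_gradient_def)
    have c: "compact ((\<lambda>x. x + t *\<^sub>R h) ` K)" using g(4) by (intro compact_continuous_image continuous_intros)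
    let ?K = "(\<lambda>x. x + t *\<^sub>R h) ` K"
    have out: "\<phi> (x - t *\<^sub>R h) = 0" "g (x - t *\<^sub>R h) = 0" if "x \<notin> ?K" for x
      using that by (auto intro!: g(6,7) simp: image_iff)
    have i1: "integrable lborel (\<lambda>x. u x *\<^sub>R g (x - t *\<^sub>R h))"
      by (rule Bochner_Integration.integrable_bound[OF integrable_mult_right[OF int(1)[OF c sub], of B]])
        (use out(2) g(9) B0 in \<open>auto simp: indicator_def abs_mult mult.commute[of B] intro!: mult_left_mono\<close>)
    have i2: "integrable lborel (\<lambda>x. \<phi> (x - t *\<^sub>R h) *\<^sub>R G x)"
      by (rule Bochner_Integration.integrable_bound[OF integrable_scaleR_right[OF int(2)[OF c sub], of B]])
        (use out(1) g(8) B0 in \<open>auto simp: indicator_def abs_mult intro!: mult_right_mono\<close>)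
    have "(\<integral>x. u x * (g (x - t *\<^sub>R h) \<bullet> h) \<partial>lborel) = (\<integral>x. u x *\<^sub>R g (x - t *\<^sub>R h) \<partial>lborel) \<bullet> h"
      using integral_inner_left[of h lborel "\<lambda>x. u x *\<^sub>R g (x - t *\<^sub>R h)"] i1 by simp
    also have "\<dots> = - (\<integral>x. \<phi> (x - t *\<^sub>R h) * (G x \<bullet> h) \<partial>lborel)"
      using integral_inner_left[of h lborel "\<lambda>x. \<phi> (x - t *\<^sub>R h) *\<^sub>R G x"] i2 by (simp add: eq)
    also have "(\<integral>x. \<phi> (x - t *\<^sub>R h) * (G x \<bullet> h) \<partial>lborel) = (\<integral>x. \<phi> x * (G (x + t *\<^sub>R h) \<bullet> h) \<partial>lborel)"
      using integral_lborel_translate[of "\<lambda>x. \<phi> (x - t *\<^sub>R h) * (G x \<bullet> h)" "t *\<^sub>R h"] by simp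
    finally show ?thesis .
  qed
  have "(\<integral>x. \<phi> x * u (x + h) \<partial>lborel) - (\<integral>x. \<phi> x * u x \<partial>lborel) = (\<integral>x. \<phi> (x - h) * u x - \<phi> x * u x \<partial>lborel)"
    unfolding shift by (rule Bochner_Integration.integral_diff[symmetric, OF int_shift ip[OF iu(1)[OF g(4,5)]]])
  also have "\<dots> = (\<integral>x. - (\<integral>t. u x * ((g (x - t *\<^sub>R h) \<bullet> h) * indicator {0..1} t) \<partial>lborel) \<partial>lborel)"
    unfolding integral_mult_right_zero FTC by (simp add: algebra_simps)
  also have "\<dots> = - (\<integral>x. \<integral>t. u x * ((g (x - t *\<^sub>R h) \<bullet> h) * indicator {0..1} t) \<partial>lborel \<partial>lborel)" by simp
  also have "\<dots> = - (\<integral>t. \<integral>x. u x * ((g (x - t *\<^sub>R h) \<bullet> h) * indicator {0..1} t) \<partial>lborel \<partial>lborel)"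
    using lborel_pair.Fubini_integral[OF J1] by simp
  also have "\<dots> = - (\<integral>t. indicator {0..1} t * (\<integral>x. u x * (g (x - t *\<^sub>R h) \<bullet> h) \<partial>lborel) \<partial>lborel)"
    by (simp add: mult.commute mult.left_commute flip: integral_mult_right_zero)
  also have "\<dots> = (\<integral>t. indicator {0..1} t * (\<integral>x. \<phi> x * (G (x + t *\<^sub>R h) \<bullet> h) \<partial>lborel) \<partial>lborel)"
    unfolding integral_minus[symmetric]
    by (intro Bochner_Integration.integral_cong) (auto simp: indicator_def wk)
  also have "\<dots> = (\<integral>t. \<integral>x. \<phi> x * (indicator {0..1} t * (G (x + t *\<^sub>R h) \<bullet> h)) \<partial>lborel \<partial>lborel)"
    by (simp add: mult.commute mult.left_commute flip: integral_mult_right_zero)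
  also have "\<dots> = (\<integral>x. \<integral>t. \<phi> x * (indicator {0..1} t * (G (x + t *\<^sub>R h) \<bullet> h)) \<partial>lborel \<partial>lborel)"
    using lborel_pair.Fubini_integral[OF J2] by simp
  also have "\<dots> = (\<integral>x. \<phi> x * b x \<partial>lborel)" by (simp add: b_def)
  finally have key: "(\<integral>x. \<phi> x * u (x + h) \<partial>lborel) - (\<integral>x. \<phi> x * u x \<partial>lborel) = (\<integral>x. \<phi> x * b x \<partial>lborel)" .
  have split: "(\<lambda>x. \<phi> x *\<^sub>R (u (x + h) - u x - (\<integral>t. indicator {0..1} t * (G (x + t *\<^sub>R h) \<bullet> h) \<partial>lborel)))
      = (\<lambda>x. \<phi> x * u (x + h) - \<phi> x * u x - \<phi> x * b x)"
    by (simp add: b_def right_diff_distrib)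
  show "(\<integral>x. \<phi> x *\<^sub>R (u (x + h) - u x - (\<integral>t. indicator {0..1} t * (G (x + t *\<^sub>R h) \<bullet> h) \<partial>lborel)) \<partial>lborel) = 0"
    using key ip[OF iu(2)[OF g(4,5)]] ip[OF iu(1)[OF g(4,5)]] ip[OF ib[OF g(4,5)]]
    unfolding split by simp
qed

text \<open>Cauchy-Schwarz on the unit interval. Nonnegative integrals avoid the question for which \<open>x\<close> the
  integral over \<open>t\<close> is finite.\<close>

lemma weak_gradient_translate_bound:
  assumes \<Omega>: "open \<Omega>" and wg: "borel_weak_gradient \<Omega> u G"
  shows "AE x in lborel. x \<in> segment_in \<Omega> h \<longrightarrow>
           ennreal ((u (x + h) - u x)\<^sup>2)
               \<le> (\<integral>\<^sup>+t. indicator {0..1} t * ennreal ((norm h)\<^sup>2 * (norm (G (x + t *\<^sub>R h)))\<^sup>2) \<partial>lborel)"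
  using weak_gradient_translate[OF assms, of h]
proof eventually_elim
  case (elim x)
  have [measurable]: "G \<in> borel_measurable borel" using wg by (auto simp: borel_weak_gradient_def)
  define f where "f = (\<lambda>t::real. indicator {0..1} t * (G (x + t *\<^sub>R h) \<bullet> h))"
  have [measurable]: "f \<in> borel_measurable borel" unfolding f_def by measurable
  have 1: "ennreal \<bar>\<integral>t. f t \<partial>lborel\<bar> \<le> (\<integral>\<^sup>+t. ennreal \<bar>f t\<bar> \<partial>lborel)"
    using integral_norm_bound_ennreal[of lborel f] by (cases "integrable lborel f")
        (auto simp: not_integrable_integral_eq)
  have "ennreal (\<bar>\<integral>t. f t \<partial>lborel\<bar>\<^sup>2) = (ennreal \<bar>\<integral>t. f t \<partial>lborel\<bar>)\<^sup>2" by (simp add: ennreal_power)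
  also have "\<dots> \<le> (\<integral>\<^sup>+t. ennreal \<bar>f t\<bar> \<partial>lborel)\<^sup>2" by (intro power_mono 1) simp
  also have "(\<integral>\<^sup>+t. ennreal \<bar>f t\<bar> \<partial>lborel) = (\<integral>\<^sup>+t. indicator {0..1} t * ennreal \<bar>f t\<bar> \<partial>lborel)"
    by (intro nn_integral_cong) (auto simp: f_def indicator_def)
  also have "\<dots>\<^sup>2 \<le> (\<integral>\<^sup>+t. (indicator {0..1::real} t)\<^sup>2 \<partial>lborel) * (\<integral>\<^sup>+t. (ennreal \<bar>f t\<bar>)\<^sup>2 \<partial>lborel)"
    by (rule Cauchy_Schwarz_nn_integral) measurable
  also have "(\<integral>\<^sup>+t. (indicator {0..1::real} t)\<^sup>2 \<partial>lborel) = (\<integral>\<^sup>+t. (indicator {0..1::real} t) \<partial>lborel)"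
    by (intro nn_integral_cong) (auto simp: indicator_def)
  also have "\<dots> * (\<integral>\<^sup>+t. (ennreal \<bar>f t\<bar>)\<^sup>2 \<partial>lborel) = (\<integral>\<^sup>+t. (ennreal \<bar>f t\<bar>)\<^sup>2 \<partial>lborel)" by simp
  also have "\<dots> \<le> (\<integral>\<^sup>+t. indicator {0..1} t * ennreal ((norm h)\<^sup>2 * (norm (G (x + t *\<^sub>R h)))\<^sup>2) \<partial>lborel)"
  proof (intro nn_integral_mono)
    fix t :: real
    have "\<bar>G (x + t *\<^sub>R h) \<bullet> h\<bar>\<^sup>2 \<le> (norm (G (x + t *\<^sub>R h)) * norm h)\<^sup>2"
      by (intro power_mono Cauchy_Schwarz_ineq2) simp
    then show "(ennreal \<bar>f t\<bar>)\<^sup>2 \<le> indicator {0..1} t * ennreal ((norm h)\<^sup>2 * (norm (G (x + t *\<^sub>R h)))\<^sup>2)"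
      by (auto simp: f_def indicator_def ennreal_power power_mult_distrib mult.commute intro!: ennreal_leI)
  qed
  finally show ?case using elim by (auto simp: f_def)
qed

section \<open>The Poincare inequality along segments\<close>

lemma nn_integral_lborel_swap:
  fixes f :: "'a::euclidean_space \<Rightarrow> 'b::euclidean_space \<Rightarrow> ennreal"
  assumes [measurable]: "case_prod f \<in> borel_measurable (borel \<Otimes>\<^sub>M borel)"
  shows "(\<integral>\<^sup>+x. \<integral>\<^sup>+y. f x y \<partial>lborel \<partial>lborel) = (\<integral>\<^sup>+y. \<integral>\<^sup>+x. f x y \<partial>lborel \<partial>lborel)"
  by (rule lborel_pair.Fubini'[symmetric]) simp

definition pair_variation :: "'a::euclidean_space set \<Rightarrow> 'a set \<Rightarrow> ('a \<Rightarrow> real) \<Rightarrow> ennreal" where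
  "pair_variation A B u = (\<integral>\<^sup>+x. \<integral>\<^sup>+y. indicator A x * indicator B y * ennreal ((u y - u x)\<^sup>2) \<partial>lborel \<partial>lborel)"

text \<open>Integrate the bound for increments over \<open>x\<close> and \<open>h = y - x\<close>. The point \<open>z = x + t (y - x)\<close> is
  substituted for \<open>y\<close> if \<open>t \<ge> 1/2\<close> and for \<open>x\<close> if \<open>t < 1/2\<close>, so that the Jacobian of the substitution
  never exceeds \<open>2 ^ DIM('a)\<close> and no singularity at \<open>t = 0\<close> or \<open>t = 1\<close> arises.\<close>

lemma segment_poincare:
  fixes \<Omega> :: "'a::euclidean_space set"
  assumes \<Omega>: "open \<Omega>" and wg: "borel_weak_gradient \<Omega> u G"
    and [measurable]: "A \<in> sets borel" "B \<in> sets borel" "W \<in> sets borel" and "W \<subseteq> \<Omega>"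
    and seg: "\<And>x y t. x \<in> A \<Longrightarrow> y \<in> B \<Longrightarrow> 0 \<le> t \<Longrightarrow> t \<le> 1 \<Longrightarrow> x + t *\<^sub>R (y - x) \<in> W"
    and diam: "\<And>x y. x \<in> A \<Longrightarrow> y \<in> B \<Longrightarrow> norm (y - x) \<le> D"
  shows "pair_variation A B u \<le>
    ennreal (2 ^ DIM('a) * D\<^sup>2) * (emeasure lborel A + emeasure lborel B) *
      (\<integral>\<^sup>+x. indicator W x * ennreal ((norm (G x))\<^sup>2) \<partial>lborel)"
proof -
  have [measurable]: "u \<in> borel_measurable borel" "G \<in> borel_measurable borel"
    using wg by (auto simp: borel_weak_gradient_def)
  define e where "e = (\<lambda>x. indicator W x * ennreal ((norm (G x))\<^sup>2))"
  define E where "E = (\<integral>\<^sup>+x. e x \<partial>lborel)"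
  have [measurable]: "e \<in> borel_measurable borel" unfolding e_def by measurable
  let ?d = "2 ^ DIM('a) :: real"
  \<comment> \<open>The Jacobian of \<open>h \<mapsto> x + t h\<close> is \<open>\<bar>t\<bar> ^ DIM('a)\<close>, which is at least \<open>(1/2) ^ DIM('a)\<close> here.\<close>
  have scale: "(\<integral>\<^sup>+h. e (x + t *\<^sub>R h) \<partial>lborel) \<le> ennreal ?d * E" if t: "\<bar>t\<bar> \<ge> 1 / 2" for x t
  proof -
    have t0: "t \<noteq> 0" using t by auto
    have "1 \<le> (2 * \<bar>t\<bar>) ^ DIM('a)" using t by (intro one_le_power) simp
    then have 1: "1 \<le> ?d * \<bar>t\<bar> ^ DIM('a)" by (simp add: power_mult_distrib)
    have "(\<integral>\<^sup>+h. e (x + t *\<^sub>R h) \<partial>lborel) = ennreal 1 * (\<integral>\<^sup>+h. e (x + t *\<^sub>R h) \<partial>lborel)" by simp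
    also have "\<dots> \<le> ennreal (?d * \<bar>t\<bar> ^ DIM('a)) * (\<integral>\<^sup>+h. e (x + t *\<^sub>R h) \<partial>lborel)"
      by (intro mult_right_mono ennreal_leI 1) simp
    also have "\<dots> = ennreal ?d * (ennreal (\<bar>t\<bar> ^ DIM('a)) * (\<integral>\<^sup>+h. e (x + t *\<^sub>R h) \<partial>lborel))"
      by (simp add: ennreal_mult mult.assoc)
    also have "\<dots> = ennreal ?d * E"
      using nn_integral_lborel_affine[OF _ t0, of e x] by (simp add: E_def)
    finally show ?thesis .
  qed
  have bound: "(\<integral>\<^sup>+x. \<integral>\<^sup>+h. indicator A x * indicator B (x + h) * e (x + t *\<^sub>R h) \<partial>lborel \<partial>lborel)
      \<le> ennreal ?d * (emeasure lborel A + emeasure lborel B) * E" if t: "0 \<le> t" "t \<le> 1" for t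
  proof (cases "t \<ge> 1 / 2")
    case True
    have "(\<integral>\<^sup>+x. \<integral>\<^sup>+h. indicator A x * indicator B (x + h) * e (x + t *\<^sub>R h) \<partial>lborel \<partial>lborel)
      \<le> (\<integral>\<^sup>+x. indicator A x * (\<integral>\<^sup>+h. e (x + t *\<^sub>R h) \<partial>lborel) \<partial>lborel)"
      by (subst nn_integral_cmult[symmetric]) (auto intro!: nn_integral_mono simp: indicator_def)
    also have "\<dots> \<le> (\<integral>\<^sup>+x. indicator A x * (ennreal ?d * E) \<partial>lborel)"
      using True by (intro nn_integral_mono mult_left_mono scale) auto
    also have "\<dots> = emeasure lborel A * (ennreal ?d * E)" by (subst nn_integral_multc) auto
    also have "\<dots> \<le> ennreal ?d * (emeasure lborel A + emeasure lborel B) * E"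
      by (simp add: distrib_left distrib_right mult.commute mult.left_commute)
    finally show ?thesis .
  next
    case False
    have "(\<integral>\<^sup>+x. \<integral>\<^sup>+h. indicator A x * indicator B (x + h) * e (x + t *\<^sub>R h) \<partial>lborel \<partial>lborel)
       = (\<integral>\<^sup>+h. \<integral>\<^sup>+x. indicator A x * indicator B (x + h) * e (x + t *\<^sub>R h) \<partial>lborel \<partial>lborel)"
      by (rule nn_integral_lborel_swap) measurable
    also have "\<dots> = (\<integral>\<^sup>+h. \<integral>\<^sup>+y. indicator A (y - h) * indicator B y * e (y - h + t *\<^sub>R h) \<partial>lborel \<partial>lborel)"
    proof (rule nn_integral_cong)
      fix h
      show "(\<integral>\<^sup>+x. indicator A x * indicator B (x + h) * e (x + t *\<^sub>R h) \<partial>lborel)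
        = (\<integral>\<^sup>+y. indicator A (y - h) * indicator B y * e (y - h + t *\<^sub>R h) \<partial>lborel)"
        using nn_integral_lborel_translate[of "\<lambda>y. indicator A (y - h) * indicator B y * e (y - h + t *\<^sub>R h)" h]
            by simp
    qed
    also have "\<dots> = (\<integral>\<^sup>+y. \<integral>\<^sup>+h. indicator A (y - h) * indicator B y * e (y - h + t *\<^sub>R h) \<partial>lborel \<partial>lborel)"
      by (rule nn_integral_lborel_swap) measurable
    also have "\<dots> \<le> (\<integral>\<^sup>+y. indicator B y * (\<integral>\<^sup>+h. e (y + (t - 1) *\<^sub>R h) \<partial>lborel) \<partial>lborel)"
      by (subst nn_integral_cmult[symmetric]) (auto intro!: nn_integral_mono simp: indicator_def algebra_simps)
    also have "\<dots> \<le> (\<integral>\<^sup>+y. indicator B y * (ennreal ?d * E) \<partial>lborel)"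
      using False by (intro nn_integral_mono mult_left_mono scale) auto
    also have "\<dots> = emeasure lborel B * (ennreal ?d * E)" by (subst nn_integral_multc) auto
    also have "\<dots> \<le> ennreal ?d * (emeasure lborel A + emeasure lborel B) * E"
      by (simp add: distrib_left distrib_right mult.commute mult.left_commute)
    finally show ?thesis .
  qed
  have "pair_variation A B u = (\<integral>\<^sup>+x. \<integral>\<^sup>+h. indicator A x * indicator B (x + h)
      * ennreal ((u (x + h) - u x)\<^sup>2) \<partial>lborel \<partial>lborel)"
    unfolding pair_variation_def
  proof (rule nn_integral_cong)
    fix x
    show "(\<integral>\<^sup>+y. indicator A x * indicator B y * ennreal ((u y - u x)\<^sup>2) \<partial>lborel)
      = (\<integral>\<^sup>+h. indicator A x * indicator B (x + h) * ennreal ((u (x + h) - u x)\<^sup>2) \<partial>lborel)"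
      using nn_integral_lborel_translate[of "\<lambda>y. indicator A x * indicator B y * ennreal ((u y - u x)\<^sup>2)" x]
      by (simp add: add.commute)
  qed
  also have "\<dots> = (\<integral>\<^sup>+h. \<integral>\<^sup>+x. indicator A x * indicator B (x + h)
      * ennreal ((u (x + h) - u x)\<^sup>2) \<partial>lborel \<partial>lborel)"
    by (rule nn_integral_lborel_swap) measurable
  also have "\<dots> \<le> (\<integral>\<^sup>+h. \<integral>\<^sup>+x. \<integral>\<^sup>+t. ennreal (D\<^sup>2) * (indicator {0..1::real} t *
       (indicator A x * indicator B (x + h) * e (x + t *\<^sub>R h))) \<partial>lborel \<partial>lborel \<partial>lborel)"
  proof (rule nn_integral_mono, rule nn_integral_mono_AE)
    fix h
    from weak_gradient_translate_bound[OF \<Omega> wg, of h]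
    show "AE x in lborel. indicator A x * indicator B (x + h) * ennreal ((u (x + h) - u x)\<^sup>2) \<le>
      (\<integral>\<^sup>+t. ennreal (D\<^sup>2) * (indicator {0..1::real} t
          * (indicator A x * indicator B (x + h) * e (x + t *\<^sub>R h))) \<partial>lborel)"
    proof eventually_elim
      case (elim x)
      show ?case
      proof (cases "x \<in> A \<and> x + h \<in> B")
        case True
        have W: "x + t *\<^sub>R h \<in> W" if "0 \<le> t" "t \<le> 1" for t
          using seg[of x "x + h" t] True that by simp
        then have "x \<in> segment_in \<Omega> h" using \<open>W \<subseteq> \<Omega>\<close> by (auto simp: segment_in_def)
        with elim have "ennreal ((u (x + h) - u x)\<^sup>2)
            \<le> (\<integral>\<^sup>+t. indicator {0..1} t * ennreal ((norm h)\<^sup>2 * (norm (G (x + t *\<^sub>R h)))\<^sup>2) \<partial>lborel)"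
          by simp
        also have "\<dots> \<le> (\<integral>\<^sup>+t. ennreal (D\<^sup>2)
            * (indicator {0..1::real} t * (indicator A x * indicator B (x + h) * e (x + t *\<^sub>R h))) \<partial>lborel)"
        proof (intro nn_integral_mono)
          fix t :: real
          have "(norm h)\<^sup>2 \<le> D\<^sup>2" using diam[of x "x + h"] True by (simp add: power_mono)
          then have "(norm h)\<^sup>2 * (norm (G (x + t *\<^sub>R h)))\<^sup>2 \<le> D\<^sup>2 * (norm (G (x + t *\<^sub>R h)))\<^sup>2"
            by (rule mult_right_mono) simp
          then show "indicator {0..1} t * ennreal ((norm h)\<^sup>2 * (norm (G (x + t *\<^sub>R h)))\<^sup>2)
            \<le> ennreal (D\<^sup>2) * (indicator {0..1} t * (indicator A x * indicator B (x + h) * e (x + t *\<^sub>R h)))"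
            using True W[of t] by (auto simp: e_def indicator_def ennreal_mult[symmetric] intro!: ennreal_leI)
        qed
        finally show ?thesis using True by simp
      qed (auto simp: indicator_def)
    qed
  qed
  also have "\<dots> = (\<integral>\<^sup>+h. \<integral>\<^sup>+t. \<integral>\<^sup>+x. ennreal (D\<^sup>2) * (indicator {0..1::real} t *
       (indicator A x * indicator B (x + h) * e (x + t *\<^sub>R h))) \<partial>lborel \<partial>lborel \<partial>lborel)"
    by (intro nn_integral_cong nn_integral_lborel_swap) measurable
  also have "\<dots> = (\<integral>\<^sup>+t. \<integral>\<^sup>+h. \<integral>\<^sup>+x. ennreal (D\<^sup>2) * (indicator {0..1::real} t *
       (indicator A x * indicator B (x + h) * e (x + t *\<^sub>R h))) \<partial>lborel \<partial>lborel \<partial>lborel)"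
    by (rule nn_integral_lborel_swap) measurable
  also have "\<dots> = (\<integral>\<^sup>+t. ennreal (D\<^sup>2) * (indicator {0..1::real} t *
       (\<integral>\<^sup>+h. \<integral>\<^sup>+x. indicator A x * indicator B (x + h) * e (x + t *\<^sub>R h) \<partial>lborel \<partial>lborel)) \<partial>lborel)"
    by (simp add: nn_integral_cmult)
  also have "\<dots> = (\<integral>\<^sup>+t. ennreal (D\<^sup>2) * (indicator {0..1::real} t *
       (\<integral>\<^sup>+x. \<integral>\<^sup>+h. indicator A x * indicator B (x + h) * e (x + t *\<^sub>R h) \<partial>lborel \<partial>lborel)) \<partial>lborel)"
    by (subst nn_integral_lborel_swap) auto
  also have "\<dots> \<le> (\<integral>\<^sup>+t. ennreal (D\<^sup>2) * (indicator {0..1::real} t *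
       (ennreal ?d * (emeasure lborel A + emeasure lborel B) * E)) \<partial>lborel)"
  proof (rule nn_integral_mono, rule mult_left_mono)
    fix t :: real
    show "indicator {0..1} t * (\<integral>\<^sup>+x. \<integral>\<^sup>+h. indicator A x * indicator B (x + h)
        * e (x + t *\<^sub>R h) \<partial>lborel \<partial>lborel)
      \<le> indicator {0..1} t * (ennreal ?d * (emeasure lborel A + emeasure lborel B) * E)"
      using bound[of t] by (cases "t \<in> {0..1}") auto
  qed simp
  also have "\<dots> = ennreal (D\<^sup>2) * (ennreal ?d * (emeasure lborel A + emeasure lborel B) * E)"
    by (simp add: nn_integral_cmult nn_integral_multc)
  also have "\<dots> = ennreal (?d * D\<^sup>2) * (emeasure lborel A + emeasure lborel B) * E"
    by (simp add: ennreal_mult mult.assoc mult.commute mult.left_commute)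
  finally show ?thesis by (simp add: E_def e_def)
qed

section \<open>Chaining the inequality\<close>

abbreviation gradient_energy :: "('a::euclidean_space \<Rightarrow> 'a) \<Rightarrow> ennreal" where
  "gradient_energy G \<equiv> \<integral>\<^sup>+x. ennreal ((norm (G x))\<^sup>2) \<partial>lborel"

text \<open>The constant depends on the sets only, not on \<open>u\<close>. Finite measure is included because
  transitivity multiplies by the measures of the outer sets.\<close>

definition poincare_pair :: "'a::euclidean_space set \<Rightarrow> 'a set \<Rightarrow> 'a set \<Rightarrow> bool" where
  "poincare_pair \<Omega> A B \<longleftrightarrow> A \<in> sets borel \<and> B \<in> sets borel \<and>
     emeasure lborel A < \<infinity> \<and> emeasure lborel B < \<infinity> \<and>
     (\<exists>C\<ge>0. \<forall>u G. borel_weak_gradient \<Omega> u G \<longrightarrow>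
        pair_variation A B u \<le> ennreal C * gradient_energy G)"

lemma poincare_pairE:
  assumes "poincare_pair \<Omega> A B"
  obtains C where "A \<in> sets borel" "B \<in> sets borel" "emeasure lborel A < \<infinity>" "emeasure lborel B < \<infinity>" "C \<ge> 0"
    "\<And>u G. borel_weak_gradient \<Omega> u G \<Longrightarrow> pair_variation A B u \<le> ennreal C * gradient_energy G"
  using assms unfolding poincare_pair_def by metis

lemma poincare_pair_segment:
  fixes \<Omega> :: "'a::euclidean_space set"
  assumes \<Omega>: "open \<Omega>" and AB: "A \<in> sets borel" "B \<in> sets borel" "bounded A" "bounded B"
    and seg: "\<And>x y t. x \<in> A \<Longrightarrow> y \<in> B \<Longrightarrow> 0 \<le> t \<Longrightarrow> t \<le> 1 \<Longrightarrow> x + t *\<^sub>R (y - x) \<in> \<Omega>"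
  shows "poincare_pair \<Omega> A B"
proof -
  obtain a b where ab: "\<And>x. x \<in> A \<Longrightarrow> norm x \<le> a" "\<And>x. x \<in> B \<Longrightarrow> norm x \<le> b"
    using AB(3,4) by (auto simp: bounded_iff)
  have diam: "norm (y - x) \<le> a + b" if "x \<in> A" "y \<in> B" for x y
    using ab that norm_triangle_ineq4[of y x] by fastforce
  have fin: "emeasure lborel A < \<infinity>" "emeasure lborel B < \<infinity>"
    by (rule emeasure_bounded_finite[OF AB(3)], rule emeasure_bounded_finite[OF AB(4)])
  have m: "emeasure lborel A + emeasure lborel B = ennreal (measure lborel A + measure lborel B)"
    using fin by (simp add: emeasure_eq_ennreal_measure less_top)
  have "pair_variation A B u \<le> ennreal (2 ^ DIM('a) * (a + b)\<^sup>2 * (measure lborel A + measure lborel B))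
      * gradient_energy G" if "borel_weak_gradient \<Omega> u G" for u G
  proof -
    have "pair_variation A B u \<le>
      ennreal (2 ^ DIM('a) * (a + b)\<^sup>2) * (emeasure lborel A + emeasure lborel B) *
        (\<integral>\<^sup>+x. indicator \<Omega> x * ennreal ((norm (G x))\<^sup>2) \<partial>lborel)"
      by (rule segment_poincare[OF \<Omega> that AB(1,2) _ order.refl seg diam]) (use \<Omega> in auto)
    also have "\<dots> \<le> ennreal (2 ^ DIM('a) * (a + b)\<^sup>2) * (emeasure lborel A + emeasure lborel B) *
        gradient_energy G"
      by (intro mult_left_mono nn_integral_mono) (auto simp: indicator_def)
    finally show ?thesis unfolding m by (simp add: ennreal_mult)
  qed
  then show ?thesis
    using AB fin by (auto simp: poincare_pair_def intro!: exI[of _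
        "2 ^ DIM('a) * (a + b)\<^sup>2 * (measure lborel A + measure lborel B)"])
qed

lemma poincare_pair_mono:
  assumes "poincare_pair \<Omega> A B" "A' \<subseteq> A" "B' \<subseteq> B" "A' \<in> sets borel" "B' \<in> sets borel"
  shows "poincare_pair \<Omega> A' B'"
proof -
  obtain C where C: "A \<in> sets borel" "B \<in> sets borel" "emeasure lborel A < \<infinity>" "emeasure lborel B < \<infinity>" "C \<ge> 0"
    "\<And>u G. borel_weak_gradient \<Omega> u G \<Longrightarrow> pair_variation A B u \<le> ennreal C * gradient_energy G"
    by (rule poincare_pairE[OF assms(1)]) (rule that)
  have "emeasure lborel A' \<le> emeasure lborel A" "emeasure lborel B' \<le> emeasure lborel B"
    using assms C by (auto intro!: emeasure_mono)
  then have fin: "emeasure lborel A' < \<infinity>" "emeasure lborel B' < \<infinity>" using C by auto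
  have "pair_variation A' B' u \<le> pair_variation A B u" for u
    unfolding pair_variation_def using assms(2,3)
    by (intro nn_integral_mono) (auto simp: indicator_def)
  then have "pair_variation A' B' u \<le> ennreal C * gradient_energy G"
    if "borel_weak_gradient \<Omega> u G" for u G
    using C(6)[OF that] by (rule order.trans)
  then show ?thesis unfolding poincare_pair_def using assms(4,5) fin C(5) by blast
qed

lemma pair_variation_commute:
  assumes [measurable]: "u \<in> borel_measurable borel" "A \<in> sets borel" "B \<in> sets borel"
  shows "pair_variation A B u = pair_variation B A u"
proof -
  have "pair_variation A B u = (\<integral>\<^sup>+y. \<integral>\<^sup>+x. indicator A x * indicator B y
      * ennreal ((u y - u x)\<^sup>2) \<partial>lborel \<partial>lborel)"
    unfolding pair_variation_def by (rule nn_integral_lborel_swap) measurable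
  then show ?thesis unfolding pair_variation_def by (simp add: mult.commute power2_commute)
qed

lemma poincare_pair_sym:
  assumes "poincare_pair \<Omega> A B" shows "poincare_pair \<Omega> B A"
proof -
  obtain C where C: "A \<in> sets borel" "B \<in> sets borel" "emeasure lborel A < \<infinity>" "emeasure lborel B < \<infinity>" "C \<ge> 0"
    "\<And>u G. borel_weak_gradient \<Omega> u G \<Longrightarrow> pair_variation A B u \<le> ennreal C * gradient_energy G"
    by (rule poincare_pairE[OF assms]) (rule that)
  have "pair_variation B A u \<le> ennreal C * gradient_energy G"
    if "borel_weak_gradient \<Omega> u G" for u G
  proof -
    have "u \<in> borel_measurable borel" using that by (simp add: borel_weak_gradient_def)
    from pair_variation_commute[OF this C(2,1)] C(6)[OF that] show ?thesis by simp
  qed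
  then show ?thesis unfolding poincare_pair_def using C(1-5) by blast
qed

text \<open>Average \<open>(u z - u x)\<^sup>2 \<le> 2 (u y - u x)\<^sup>2 + 2 (u z - u y)\<^sup>2\<close> over \<open>y \<in> B\<close>; this is where \<open>B\<close> must not
  be a null set.\<close>

lemma poincare_pair_trans:
  assumes 1: "poincare_pair \<Omega> A B" and 2: "poincare_pair \<Omega> B D" and pos: "emeasure lborel B > 0"
  shows "poincare_pair \<Omega> A D"
proof -
  obtain C1 where C1: "A \<in> sets borel" "B \<in> sets borel" "emeasure lborel A < \<infinity>" "emeasure lborel B < \<infinity>" "C1 \<ge> 0"
    "\<And>u G. borel_weak_gradient \<Omega> u G \<Longrightarrow> pair_variation A B u \<le> ennreal C1 * gradient_energy G"
    by (rule poincare_pairE[OF 1]) (rule that)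
  obtain C2 where C2: "B \<in> sets borel" "D \<in> sets borel" "emeasure lborel B < \<infinity>" "emeasure lborel D < \<infinity>" "C2 \<ge> 0"
    "\<And>u G. borel_weak_gradient \<Omega> u G \<Longrightarrow> pair_variation B D u \<le> ennreal C2 * gradient_energy G"
    by (rule poincare_pairE[OF 2]) (rule that)
  note [measurable] = C1(1,2) C2(2)
  define a b d where "a = measure lborel A" and "b = measure lborel B" and "d = measure lborel D"
  have em: "emeasure lborel A = ennreal a" "emeasure lborel B = ennreal b" "emeasure lborel D = ennreal d"
    using C1 C2 by (simp_all add: a_def b_def d_def emeasure_eq_ennreal_measure less_top)
  have b: "b > 0" using pos em(2) by simp
  have ad: "a \<ge> 0" "d \<ge> 0" by (simp_all add: a_def d_def)
  have "pair_variation A D u \<le> ennreal ((2 * d * C1 + 2 * a * C2) / b) * gradient_energy G"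
    if wg: "borel_weak_gradient \<Omega> u G" for u G
  proof -
    define E where "E = gradient_energy G"
    have [measurable]: "u \<in> borel_measurable borel" using wg by (auto simp: borel_weak_gradient_def)
    have pw: "indicator B y * (indicator A x * indicator D z * ennreal ((u z - u x)\<^sup>2))
       \<le> 2 * indicator D z * (indicator A x * indicator B y * ennreal ((u y - u x)\<^sup>2))
         + 2 * indicator A x * (indicator B y * indicator D z * ennreal ((u z - u y)\<^sup>2))" for x y z
    proof -
      have "(u z - u x)\<^sup>2 + (u z - 2 * u y + u x)\<^sup>2 = 2 * (u y - u x)\<^sup>2 + 2 * (u z - u y)\<^sup>2"
        by (simp add: power2_eq_square algebra_simps)
      then have "(u z - u x)\<^sup>2 \<le> 2 * (u y - u x)\<^sup>2 + 2 * (u z - u y)\<^sup>2"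
        using zero_le_power2[of "u z - 2 * u y + u x"] by linarith
      from ennreal_leI[OF this] show ?thesis
        by (auto simp: indicator_def ennreal_mult)
    qed
    have "ennreal b * pair_variation A D u
       = (\<integral>\<^sup>+y. \<integral>\<^sup>+x. \<integral>\<^sup>+z. indicator B y
           * (indicator A x * indicator D z * ennreal ((u z - u x)\<^sup>2)) \<partial>lborel \<partial>lborel \<partial>lborel)"
      unfolding pair_variation_def em(2)[symmetric]
      by (simp add: nn_integral_cmult nn_integral_multc)
    also have "\<dots> \<le> (\<integral>\<^sup>+y. \<integral>\<^sup>+x. \<integral>\<^sup>+z. 2 * indicator D z
        * (indicator A x * indicator B y * ennreal ((u y - u x)\<^sup>2))
         + 2 * indicator A x * (indicator B y * indicator D z
             * ennreal ((u z - u y)\<^sup>2)) \<partial>lborel \<partial>lborel \<partial>lborel)"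
      by (intro nn_integral_mono pw)
    also have "\<dots> = (\<integral>\<^sup>+y. \<integral>\<^sup>+x. 2 * ennreal d
        * (indicator A x * indicator B y * ennreal ((u y - u x)\<^sup>2)) \<partial>lborel \<partial>lborel)
       + (\<integral>\<^sup>+y. \<integral>\<^sup>+x. 2 * indicator A x * (\<integral>\<^sup>+z. indicator B y * indicator D z
           * ennreal ((u z - u y)\<^sup>2) \<partial>lborel) \<partial>lborel \<partial>lborel)"
      by (simp add: nn_integral_add nn_integral_cmult nn_integral_multc em)
    also have "(\<integral>\<^sup>+y. \<integral>\<^sup>+x. 2 * ennreal d
        * (indicator A x * indicator B y * ennreal ((u y - u x)\<^sup>2)) \<partial>lborel \<partial>lborel)
       = 2 * ennreal d * pair_variation B A u"
      unfolding pair_variation_def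
      by (simp add: nn_integral_cmult power2_commute[of "u _" "u _"] mult.commute[of "indicator A _"
          "indicator B _"])
    also have "pair_variation B A u = pair_variation A B u"
      by (rule pair_variation_commute) measurable
    also have "(\<integral>\<^sup>+y. \<integral>\<^sup>+x. 2 * indicator A x
        * (\<integral>\<^sup>+z. indicator B y * indicator D z * ennreal ((u z - u y)\<^sup>2) \<partial>lborel) \<partial>lborel \<partial>lborel)
       = 2 * ennreal a * pair_variation B D u"
      unfolding pair_variation_def
      by (simp add: nn_integral_cmult nn_integral_multc em mult.assoc)
    also have "2 * ennreal d * pair_variation A B u + 2 * ennreal a * pair_variation B D u
       \<le> 2 * ennreal d * (ennreal C1 * E) + 2 * ennreal a * (ennreal C2 * E)"
      unfolding E_def by (intro add_mono mult_left_mono C1(6)[OF wg] C2(6)[OF wg]) auto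
    also have "\<dots> = ennreal (2 * d * C1 + 2 * a * C2) * E"
      using ad C1(5) C2(5) by (simp add: ennreal_mult ennreal_plus distrib_right mult.assoc)
    finally have *: "ennreal b * pair_variation A D u \<le> ennreal (2 * d * C1 + 2 * a * C2) * E" .
    have "pair_variation A D u = ennreal (1 / b) * (ennreal b * pair_variation A D u)"
      using b by (simp add: ennreal_mult[symmetric] mult.assoc[symmetric])
    also have "\<dots> \<le> ennreal (1 / b) * (ennreal (2 * d * C1 + 2 * a * C2) * E)"
      by (intro mult_left_mono *) simp
    also have "\<dots> = ennreal ((2 * d * C1 + 2 * a * C2) / b) * E"
      using b ad C1(5) C2(5)
      by (simp add: ennreal_mult[symmetric] mult.assoc[symmetric] del: ennreal_plus)
    finally show ?thesis by (simp add: E_def)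
  qed
  moreover have "(2 * d * C1 + 2 * a * C2) / b \<ge> 0" using b ad C1(5) C2(5) by simp
  ultimately show ?thesis unfolding poincare_pair_def using C1(1,3) C2(2,4) by blast
qed

lemma poincare_pair_UN:
  assumes "finite I" "B \<in> sets borel" "emeasure lborel B < \<infinity>" "\<And>i. i \<in> I \<Longrightarrow> poincare_pair \<Omega> (A i) B"
  shows "poincare_pair \<Omega> (\<Union>i\<in>I. A i) B"
  using assms(1,4)
proof induction
  case empty
  show ?case using assms(2,3) by (auto simp: poincare_pair_def pair_variation_def)
next
  case (insert j I)
  define U where "U = (\<Union>i\<in>I. A i)"
  have U: "poincare_pair \<Omega> U B" using insert by (simp add: U_def)
  have Aj: "poincare_pair \<Omega> (A j) B" using insert(4) by simp
  obtain C1 where C1: "A j \<in> sets borel" "B \<in> sets borel" "emeasure lborel (A j) < \<infinity>" "emeasure lborel B < \<infinity>"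
      "C1 \<ge> 0"
    "\<And>u G. borel_weak_gradient \<Omega> u G \<Longrightarrow> pair_variation (A j) B u \<le> ennreal C1 * gradient_energy G"
    by (rule poincare_pairE[OF Aj]) (rule that)
  obtain C2 where C2: "U \<in> sets borel" "B \<in> sets borel" "emeasure lborel U < \<infinity>" "emeasure lborel B < \<infinity>" "C2 \<ge> 0"
    "\<And>u G. borel_weak_gradient \<Omega> u G \<Longrightarrow> pair_variation U B u \<le> ennreal C2 * gradient_energy G"
    by (rule poincare_pairE[OF U]) (rule that)
  note [measurable] = C1(1) C2(1) assms(2)
  note fin12 = C1(3) C2(3)
  have "emeasure lborel (A j \<union> U) \<le> emeasure lborel (A j) + emeasure lborel U"
    by (rule emeasure_subadditive) auto
  also have "\<dots> < \<infinity>" using fin12 by simp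
  finally have fin: "emeasure lborel (A j \<union> U) < \<infinity>" .
  have "pair_variation (A j \<union> U) B u \<le> ennreal (C1 + C2) * gradient_energy G"
    if wg: "borel_weak_gradient \<Omega> u G" for u G
  proof -
    have [measurable]: "u \<in> borel_measurable borel" using wg by (auto simp: borel_weak_gradient_def)
    have "pair_variation (A j \<union> U) B u \<le> (\<integral>\<^sup>+x. \<integral>\<^sup>+y. indicator (A j) x * indicator B y
        * ennreal ((u y - u x)\<^sup>2)
        + indicator U x * indicator B y * ennreal ((u y - u x)\<^sup>2) \<partial>lborel \<partial>lborel)"
      unfolding pair_variation_def by (intro nn_integral_mono) (auto simp: indicator_def)
    also have "\<dots> = pair_variation (A j) B u + pair_variation U B u"
      unfolding pair_variation_def by (simp add: nn_integral_add)
    also have "\<dots> \<le> ennreal C1 * gradient_energy G + ennreal C2 * gradient_energy G"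
      by (intro add_mono C1(6)[OF wg] C2(6)[OF wg])
    finally show ?thesis using C1(5) C2(5) by (simp add: ennreal_plus distrib_right)
  qed
  then have "poincare_pair \<Omega> (A j \<union> U) B"
    unfolding poincare_pair_def using fin C1(1) C2(1) assms(2,3) add_nonneg_nonneg[OF C1(5) C2(5)] by blast
  then show ?case by (simp add: U_def)
qed

lemma emeasure_ball_pos: "r > 0 \<Longrightarrow> emeasure lborel (ball (c::'a::euclidean_space) r) > 0"
  by (simp add: emeasure_ball)

section \<open>The Poincare inequality on a bounded domain\<close>

lemma C1_lipschitz_on_cball:
  fixes \<gamma> :: "'a::euclidean_space \<Rightarrow> real"
  assumes "Ck 1 \<gamma>"
  obtains L where "L \<ge> 0" "\<And>y z. y \<in> cball c R \<Longrightarrow> z \<in> cball c R \<Longrightarrow> \<bar>\<gamma> y - \<gamma> z\<bar> \<le> L * norm (y - z)"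
proof -
  obtain g where g: "\<And>x. GDERIV \<gamma> x :> g x" using assms by auto
  have "continuous_on UNIV g" using Ck_gradient_continuous[OF assms g] .
  then have "bounded (g ` cball c R)"
    by (auto intro!: compact_imp_bounded compact_continuous_image intro: continuous_on_subset)
  then obtain L where "L > 0" "\<forall>y\<in>g ` cball c R. norm y \<le> L"
    unfolding bounded_pos by blast
  then have L: "\<And>x. x \<in> cball c R \<Longrightarrow> norm (g x) \<le> L" "L > 0" by blast+
  have "norm (\<gamma> y - \<gamma> z) \<le> L * norm (y - z)" if "y \<in> cball c R" "z \<in> cball c R" for y z
  proof (rule differentiable_bound[of "cball c R" \<gamma> "\<lambda>x h. h \<bullet> g x"])
    fix x assume x: "x \<in> cball c R"
    show "(\<gamma> has_derivative (\<lambda>h. h \<bullet> g x)) (at x within cball c R)"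
      using g[of x] by (auto simp: gderiv_def intro: has_derivative_at_withinI)
    show "onorm (\<lambda>h. h \<bullet> g x) \<le> L"
    proof (rule onorm_le)
      fix h
      have "norm (h \<bullet> g x) \<le> norm h * norm (g x)" using Cauchy_Schwarz_ineq2 by simp
      also have "\<dots> \<le> norm h * L" by (intro mult_left_mono L x) simp
      finally show "norm (h \<bullet> g x) \<le> L * norm h" by (simp add: mult.commute)
    qed
  qed (use that in auto)
  then show ?thesis using L(2) by (intro that[of L]) auto
qed

text \<open>In the direction \<open>\<nu>\<close> of the last coordinate axis, \<open>\<Omega>\<close> is locally the region above the graph of a
  function with Lipschitz constant \<open>L\<close> on the relevant ball. If \<open>y - x\<close> rises by more than \<open>L\<close> times its
  horizontal length, the segment from \<open>x\<close> to \<open>y\<close> stays above the graph. Lifting the ball of radius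
  \<open>\<delta>\<close> around \<open>p\<close> by a large multiple of \<open>\<delta>\<close> achieves this for all pairs of points.\<close>

lemma boundary_patch:
  fixes \<Omega> :: "'a::euclidean_space set"
  assumes dom: "C1_domain \<Omega>" and p: "p \<in> frontier \<Omega>"
  obtains q \<delta> where "\<delta> > 0" "ball q \<delta> \<subseteq> \<Omega>" "poincare_pair \<Omega> (\<Omega> \<inter> ball p \<delta>) (ball q \<delta>)"
proof -
  have open_domain: "open \<Omega>" using dom by (simp add: C1_domain_def)
  obtain r \<nu> \<gamma> where r: "r > 0" and \<nu>: "norm \<nu> = 1" and \<gamma>: "Ck 1 \<gamma>" and
    graph: "\<Omega> \<inter> ball p r = {x \<in> ball p r. x \<bullet> \<nu> > \<gamma> (x - (x \<bullet> \<nu>) *\<^sub>R \<nu>)}"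
    using dom[unfolded C1_domain_def, THEN conjunct2, rule_format, OF p] by (elim exE conjE) (rule that)
  define P where "P = (\<lambda>x. x - (x \<bullet> \<nu>) *\<^sub>R \<nu>)"
  have inside: "x \<in> \<Omega> \<longleftrightarrow> x \<bullet> \<nu> > \<gamma> (P x)" if "x \<in> ball p r" for x
  proof -
    have "x \<in> \<Omega> \<inter> ball p r \<longleftrightarrow> x \<in> {x \<in> ball p r. x \<bullet> \<nu> > \<gamma> (x - (x \<bullet> \<nu>) *\<^sub>R \<nu>)}"
      by (simp only: graph)
    then show ?thesis using that by (simp add: P_def)
  qed
  have \<nu>1: "\<nu> \<bullet> \<nu> = 1" using \<nu> by (simp add: norm_eq_1)
  have P_lin: "P (x + y) = P x + P y" "P (c *\<^sub>R x) = c *\<^sub>R P x" "P (x - y) = P x - P y" for x y c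
    by (auto simp: P_def inner_add_left inner_diff_left algebra_simps)
  have P_norm: "norm (P x) \<le> norm x" for x
  proof -
    have "P x \<bullet> P x = x \<bullet> x - (x \<bullet> \<nu>)\<^sup>2"
      using \<nu>1 by (simp add: P_def inner_diff_left inner_diff_right power2_eq_square inner_commute algebra_simps)
    then show ?thesis by (simp add: norm_le)
  qed
  obtain L where L: "L \<ge> 0" "\<And>y z. y \<in> cball (P p) r \<Longrightarrow> z \<in> cball (P p) r \<Longrightarrow> \<bar>\<gamma> y - \<gamma> z\<bar> \<le> L * norm (y - z)"
    using C1_lipschitz_on_cball[OF \<gamma>] by blast
  have P_ball: "P x \<in> cball (P p) r" if "x \<in> ball p r" for x
    using P_norm[of "p - x"] that by (simp add: dist_norm P_lin)
  \<comment> \<open>The choice gives \<open>s = (3 + 2 L) \<delta>\<close>: the rise is at least \<open>s - 2 \<delta> = (1 + 2 L) \<delta>\<close> and the horizontal length at most \<open>2 \<delta>\<close>.\<close>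
  define \<delta> where "\<delta> = r / (5 + 2 * L)"
  define s where "s = (3 + 2 * L) * \<delta>"
  define q where "q = p + s *\<^sub>R \<nu>"
  have \<delta>: "\<delta> > 0" using r L(1) by (simp add: \<delta>_def)
  have "(5 + 2 * L) * \<delta> = r" using L(1) by (simp add: \<delta>_def)
  then have r_eq: "s + 2 * \<delta> = r" by (simp add: s_def algebra_simps)
  have s: "s \<ge> 0" using \<delta> L(1) by (simp add: s_def)
  have seg: "x + t *\<^sub>R (y - x) \<in> \<Omega>" if x: "x \<in> \<Omega> \<inter> ball p \<delta>" and y: "y \<in> ball q \<delta>" and t: "0 \<le> t" "t \<le> 1"
      for x y t
  proof -
    define a where "a = y - q"
    define b where "b = x - p"
    have ab: "norm a < \<delta>" "norm b < \<delta>" using x y by (auto simp: a_def b_def dist_norm norm_minus_commute)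
    have n_ab: "norm (a - b) \<le> 2 * \<delta>" using norm_triangle_ineq4[of a b] ab by linarith
    have yx: "y - x = s *\<^sub>R \<nu> + (a - b)" by (simp add: a_def b_def q_def algebra_simps)
    have "\<bar>(a - b) \<bullet> \<nu>\<bar> \<le> norm (a - b) * norm \<nu>" by (rule Cauchy_Schwarz_ineq2)
    then have "(a - b) \<bullet> \<nu> \<ge> - 2 * \<delta>" using n_ab \<nu> by simp
    then have up: "(y - x) \<bullet> \<nu> \<ge> (1 + 2 * L) * \<delta>"
      using \<nu>1 by (simp add: yx inner_add_left s_def algebra_simps)
    have "P \<nu> = 0" using \<nu>1 by (simp add: P_def)
    then have "P (y - x) = P (a - b)" by (simp add: yx P_lin)
    then have side: "norm (P (y - x)) \<le> 2 * \<delta>" using P_norm[of "a - b"] n_ab by simp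
    have xr: "x \<in> ball p r" using x r_eq s \<delta> by auto
    have "norm (y - p) \<le> norm (s *\<^sub>R \<nu>) + norm a"
      using norm_triangle_ineq[of "s *\<^sub>R \<nu>" a] by (simp add: a_def q_def algebra_simps)
    then have yr: "y \<in> ball p r" using ab(1) \<nu> s r_eq \<delta> by (simp add: dist_norm norm_minus_commute)
    define z where "z = x + t *\<^sub>R (y - x)"
    have "z = (1 - t) *\<^sub>R x + t *\<^sub>R y" by (simp add: z_def algebra_simps)
    then have zr: "z \<in> ball p r"
      using convexD_alt[OF convex_ball xr yr t] by simp
    have "\<gamma> (P z) - \<gamma> (P x) \<le> L * norm (P z - P x)"
      using L(2)[OF P_ball[OF zr] P_ball[OF xr]] by linarith
    also have "P z - P x = t *\<^sub>R P (y - x)" by (simp add: z_def P_lin)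
    also have "L * norm (t *\<^sub>R P (y - x)) \<le> L * (t * (2 * \<delta>))"
      using t side L(1) by (auto intro!: mult_left_mono)
    finally have 1: "\<gamma> (P z) \<le> \<gamma> (P x) + t * (2 * L * \<delta>)" by (simp add: algebra_simps)
    have "x \<bullet> \<nu> > \<gamma> (P x)" using x inside[OF xr] by blast
    moreover have "z \<bullet> \<nu> = x \<bullet> \<nu> + t * ((y - x) \<bullet> \<nu>)" by (simp add: z_def inner_add_left)
    moreover have "t * ((y - x) \<bullet> \<nu>) \<ge> t * ((1 + 2 * L) * \<delta>)" using up t by (intro mult_left_mono)
    moreover have "t * ((1 + 2 * L) * \<delta>) \<ge> t * (2 * L * \<delta>)" using t \<delta> by (intro mult_left_mono)
        (auto simp: algebra_simps)
    ultimately have "z \<bullet> \<nu> > \<gamma> (P z)" using 1 by linarith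
    then show ?thesis using inside[OF zr] by (simp add: z_def)
  qed
  have "p \<in> closure \<Omega>" using p by (simp add: frontier_def)
  then obtain x where x: "x \<in> \<Omega> \<inter> ball p \<delta>" using \<delta> by (auto simp: closure_approachable dist_commute)
  have sub: "ball q \<delta> \<subseteq> \<Omega>" using seg[OF x, of _ 1] by auto
  have "poincare_pair \<Omega> (\<Omega> \<inter> ball p \<delta>) (ball q \<delta>)"
    by (rule poincare_pair_segment[OF open_domain _ _ _ _ seg]) (use open_domain in auto)
  then show ?thesis using that \<delta> sub by blast
qed

lemma poincare_pair_ball:
  assumes "open \<Omega>" "ball x e \<subseteq> \<Omega>"
  shows "poincare_pair \<Omega> (ball x e) (ball x e)"
proof (rule poincare_pair_segment[OF assms(1)])
  fix y z and t :: real assume yz: "y \<in> ball x e" "z \<in> ball x e" "0 \<le> t" "t \<le> 1"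
  have "y + t *\<^sub>R (z - y) = (1 - t) *\<^sub>R y + t *\<^sub>R z" by (simp add: algebra_simps)
  then show "y + t *\<^sub>R (z - y) \<in> \<Omega>"
    using convexD_alt[OF convex_ball yz] assms(2) by (metis subsetD)
qed auto

text \<open>Radii are existentially quantified because a chain may shrink them at every step.\<close>

definition chained :: "'a::euclidean_space set \<Rightarrow> 'a \<Rightarrow> 'a \<Rightarrow> bool" where
  "chained \<Omega> x y \<longleftrightarrow> (\<exists>d>0. \<exists>e>0. poincare_pair \<Omega> (ball x d) (ball y e))"

lemma poincare_pair_chained:
  assumes "poincare_pair \<Omega> A (ball x d)" "d > 0" "chained \<Omega> x y"
  shows "\<exists>e>0. poincare_pair \<Omega> A (ball y e)"
proof -
  obtain d' e where de: "d' > 0" "e > 0" "poincare_pair \<Omega> (ball x d') (ball y e)"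
    using assms(3) by (auto simp: chained_def)
  let ?m = "min d d'"
  have A: "A \<in> sets borel" using assms(1) by (simp add: poincare_pair_def)
  have "poincare_pair \<Omega> A (ball x ?m)"
    by (rule poincare_pair_mono[OF assms(1)]) (auto simp: A)
  moreover have "poincare_pair \<Omega> (ball x ?m) (ball y e)"
    by (rule poincare_pair_mono[OF de(3)]) auto
  ultimately show ?thesis
    using poincare_pair_trans emeasure_ball_pos[of ?m x] assms(2) de(1,2) by fastforce
qed

text \<open>All points of a ball inside \<open>\<Omega>\<close> are chained to its centre, so the classes of this equivalence
  relation are open, and a connected set has only one of them.\<close>

lemma chained_connected:
  assumes "open \<Omega>" "connected \<Omega>" "x \<in> \<Omega>" "y \<in> \<Omega>"
  shows "chained \<Omega> x y"
proof (rule connected_equivalence_relation[OF assms(2-4)])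
  show "chained \<Omega> b a" if "chained \<Omega> a b" for a b
    using that poincare_pair_sym unfolding chained_def by blast
  show "chained \<Omega> a c" if "chained \<Omega> a b" "chained \<Omega> b c" for a b c
    using that poincare_pair_chained unfolding chained_def by metis
  fix a assume "a \<in> \<Omega>"
  then obtain e where e: "e > 0" "ball a e \<subseteq> \<Omega>" using assms(1) open_contains_ball by blast
  show "\<exists>T. openin (top_of_set \<Omega>) T \<and> a \<in> T \<and> (\<forall>x\<in>T. chained \<Omega> a x)"
  proof (intro exI conjI ballI)
    show "openin (top_of_set \<Omega>) (ball a e)" using e(2) assms(1) by (simp add: openin_open_eq)
    show "a \<in> ball a e" using e(1) by simp
    fix x assume "x \<in> ball a e"
    then obtain d where d: "d > 0" "ball x d \<subseteq> ball a e" using open_contains_ball open_ball by blast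
    have "poincare_pair \<Omega> (ball a e) (ball x d)"
      by (rule poincare_pair_mono[OF poincare_pair_ball[OF assms(1) e(2)]]) (use d in auto)
    then show "chained \<Omega> a x" using d(1) e(1) by (auto simp: chained_def)
  qed
qed

text \<open>Every point of the closure has a neighbourhood whose part in \<open>\<Omega>\<close> is linked to some ball around
  one fixed point. Finitely many neighbourhoods suffice, and the smallest of the balls then links
  \<open>\<Omega>\<close> with itself.\<close>

lemma poincare_pair_domain:
  fixes \<Omega> :: "'a::euclidean_space set"
  assumes dom: "C1_domain \<Omega>" and bdd: "bounded \<Omega>" and con: "connected \<Omega>" and ne: "\<Omega> \<noteq> {}"
  shows "poincare_pair \<Omega> \<Omega> \<Omega>"
proof -
  have open_domain: "open \<Omega>" using dom by (simp add: C1_domain_def)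
  obtain o' where o: "o' \<in> \<Omega>" using ne by blast
  have nb: "\<exists>d>0. \<exists>e>0. poincare_pair \<Omega> (\<Omega> \<inter> ball p d) (ball o' e)" if p: "p \<in> closure \<Omega>" for p
  proof -
    have "\<exists>d>0. \<exists>q\<in>\<Omega>. \<exists>e>0. poincare_pair \<Omega> (\<Omega> \<inter> ball p d) (ball q e)"
    proof (cases "p \<in> \<Omega>")
      case True
      then obtain e where e: "e > 0" "ball p e \<subseteq> \<Omega>" using open_domain open_contains_ball by blast
      with poincare_pair_ball[OF open_domain e(2)] True show ?thesis by (metis Int_absorb1)
    next
      case False
      then have "p \<in> frontier \<Omega>" using p open_domain by (simp add: frontier_def interior_open)
      then obtain q \<delta> where q: "\<delta> > 0" "ball q \<delta> \<subseteq> \<Omega>" "poincare_pair \<Omega> (\<Omega> \<inter> ball p \<delta>) (ball q \<delta>)"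
        using boundary_patch[OF dom] by metis
      then have "q \<in> \<Omega>" by auto
      with q show ?thesis by blast
    qed
    then obtain d q e where "d > 0" "q \<in> \<Omega>" "e > 0" "poincare_pair \<Omega> (\<Omega> \<inter> ball p d) (ball q e)" by blast
    with poincare_pair_chained[OF _ _ chained_connected[OF open_domain con _ o]] show ?thesis by blast
  qed
  then obtain d e where de: "\<And>p. p \<in> closure \<Omega> \<Longrightarrow> d p > 0 \<and> e p > 0
      \<and> poincare_pair \<Omega> (\<Omega> \<inter> ball p (d p)) (ball o' (e p))"
    by metis
  have "compact (closure \<Omega>)" using bdd by (simp add: compact_closure)
  moreover have "closure \<Omega> \<subseteq> (\<Union>p\<in>closure \<Omega>. ball p (d p))" using de by force
  ultimately obtain F where F: "F \<subseteq> closure \<Omega>" "finite F" "closure \<Omega> \<subseteq> (\<Union>p\<in>F. ball p (d p))"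
    using compactE_image[of "closure \<Omega>" "closure \<Omega>" "\<lambda>p. ball p (d p)"] by auto
  have "F \<noteq> {}" using F(3) ne closure_subset[of \<Omega>] by auto
  define m where "m = Min (e ` F)"
  have m: "m > 0" "\<And>p. p \<in> F \<Longrightarrow> m \<le> e p"
    using F de \<open>F \<noteq> {}\<close> by (auto simp: m_def)
  have "poincare_pair \<Omega> (\<Union>p\<in>F. \<Omega> \<inter> ball p (d p)) (ball o' m)"
  proof (rule poincare_pair_UN[OF F(2)])
    fix p assume p: "p \<in> F"
    then have *: "poincare_pair \<Omega> (\<Omega> \<inter> ball p (d p)) (ball o' (e p))" using de F(1) by blast
    show "poincare_pair \<Omega> (\<Omega> \<inter> ball p (d p)) (ball o' m)"
      by (rule poincare_pair_mono[OF *]) (use m(2)[OF p] open_domain in auto)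
  qed (use emeasure_bounded_finite[OF bounded_ball] in auto)
  also have "(\<Union>p\<in>F. \<Omega> \<inter> ball p (d p)) = \<Omega>" using F(3) closure_subset[of \<Omega>] by blast
  finally have "poincare_pair \<Omega> \<Omega> (ball o' m)" .
  with poincare_pair_trans[OF this poincare_pair_sym[OF this] emeasure_ball_pos[OF m(1)]] show ?thesis by simp
qed

section \<open>The variance form of the inequality\<close>

lemma (in finite_measure) integrable_if_norm_square_integrable:
  fixes f :: "'a \<Rightarrow> 'b::{banach, second_countable_topology}"
  assumes "f \<in> borel_measurable M" "integrable M (\<lambda>x. (norm (f x))\<^sup>2)"
  shows "integrable M f"
proof (rule Bochner_Integration.integrable_bound[where f = "\<lambda>x. 1 + (norm (f x))\<^sup>2"])
  show "AE x in M. norm (f x) \<le> norm (1 + (norm (f x))\<^sup>2)"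
  proof (rule AE_I2)
    fix x
    have "0 \<le> (norm (f x) - 1)\<^sup>2" by simp
    then have "2 * norm (f x) \<le> 1 + (norm (f x))\<^sup>2" by (simp add: power2_eq_square algebra_simps)
    then have "norm (f x) \<le> 1 + (norm (f x))\<^sup>2" using norm_ge_zero[of "f x"] by linarith
    then show "norm (f x) \<le> norm (1 + (norm (f x))\<^sup>2)" by simp
  qed
qed (use assms in auto)

lemma (in finite_measure) nn_integral_pair_square:
  fixes u :: "'a \<Rightarrow> real"
  assumes [measurable]: "u \<in> borel_measurable M" and int: "integrable M (\<lambda>x. (u x)\<^sup>2)"
  shows "(\<integral>\<^sup>+x. \<integral>\<^sup>+y. ennreal ((u y - u x)\<^sup>2) \<partial>M \<partial>M) =
    ennreal (2 * (measure M (space M) * (\<integral>x. (u x)\<^sup>2 \<partial>M) - (\<integral>x. u x \<partial>M)\<^sup>2))"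
proof -
  define m where "m = measure M (space M)"
  define I1 where "I1 = (\<integral>x. u x \<partial>M)"
  define I2 where "I2 = (\<integral>x. (u x)\<^sup>2 \<partial>M)"
  have iu: "integrable M u" by (rule integrable_if_norm_square_integrable) (use int in auto)
  have ex: "(u y - u x)\<^sup>2 = (u y)\<^sup>2 - 2 * u x * u y + (u x)\<^sup>2" for x y
    by (simp add: power2_eq_square algebra_simps)
  have inner: "(\<integral>\<^sup>+y. ennreal ((u y - u x)\<^sup>2) \<partial>M) = ennreal (I2 - 2 * u x * I1 + m * (u x)\<^sup>2)" for x
  proof -
    have i: "integrable M (\<lambda>y. (u y - u x)\<^sup>2)" unfolding ex using int iu by simp
    have "(\<integral>\<^sup>+y. ennreal ((u y - u x)\<^sup>2) \<partial>M) = ennreal (\<integral>y. (u y - u x)\<^sup>2 \<partial>M)"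
      by (rule nn_integral_eq_integral[OF i]) simp
    also have "(\<integral>y. (u y - u x)\<^sup>2 \<partial>M) = I2 - 2 * u x * I1 + m * (u x)\<^sup>2"
      unfolding ex using int iu by (simp add: I1_def I2_def m_def)
    finally show ?thesis .
  qed
  have nonneg: "0 \<le> I2 - 2 * u x * I1 + m * (u x)\<^sup>2" for x
  proof -
    have "0 \<le> (\<integral>y. (u y - u x)\<^sup>2 \<partial>M)" by simp
    also have "(\<integral>y. (u y - u x)\<^sup>2 \<partial>M) = I2 - 2 * u x * I1 + m * (u x)\<^sup>2"
      unfolding ex using int iu by (simp add: I1_def I2_def m_def)
    finally show ?thesis .
  qed
  have i: "integrable M (\<lambda>x. I2 - 2 * u x * I1 + m * (u x)\<^sup>2)" using int iu by simp
  have "(\<integral>\<^sup>+x. \<integral>\<^sup>+y. ennreal ((u y - u x)\<^sup>2) \<partial>M \<partial>M) = ennreal (\<integral>x. I2 - 2 * u x * I1 + m * (u x)\<^sup>2 \<partial>M)"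
    unfolding inner by (rule nn_integral_eq_integral[OF i]) (use nonneg in auto)
  also have "(\<integral>x. I2 - 2 * u x * I1 + m * (u x)\<^sup>2 \<partial>M) = m * I2 - 2 * I1 * I1 + m * I2"
    using int iu by (simp add: I1_def[symmetric] I2_def[symmetric] m_def[symmetric])
  also have "\<dots> = 2 * (m * I2 - I1\<^sup>2)" by (simp add: power2_eq_square)
  finally show ?thesis by (simp add: m_def I1_def I2_def)
qed

text \<open>If the double integral is finite, then so is the inner one for some \<open>x\<close>, and \<open>u\<close> differs from a
  square integrable function by the constant \<open>u x\<close>. This is how square integrability of \<open>u\<close> is
  obtained when only its gradient is known to be square integrable.\<close>

lemma (in finite_measure) square_integrable_if_pair_square_finite:
  fixes u :: "'a \<Rightarrow> real"
  assumes [measurable]: "u \<in> borel_measurable M"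
    and fin: "(\<integral>\<^sup>+x. \<integral>\<^sup>+y. ennreal ((u y - u x)\<^sup>2) \<partial>M \<partial>M) < \<infinity>" and pos: "emeasure M (space M) \<noteq> 0"
  shows "integrable M (\<lambda>x. (u x)\<^sup>2)"
proof -
  have "AE x in M. (\<integral>\<^sup>+y. ennreal ((u y - u x)\<^sup>2) \<partial>M) \<noteq> \<infinity>"
    by (rule nn_integral_PInf_AE) (use fin in auto)
  moreover have "\<exists>x. P x" if "AE x in M. P x" for P
  proof (rule ccontr)
    assume "\<nexists>x. P x"
    then have "AE x in M. False" using that by simp
    then have "emeasure M (space M) = 0"
      by (subst (asm) AE_iff_measurable[of "space M"]) auto
    then show False using pos by simp
  qed
  ultimately have "\<exists>x. (\<integral>\<^sup>+y. ennreal ((u y - u x)\<^sup>2) \<partial>M) \<noteq> \<infinity>" by blast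
  then have "\<exists>x. (\<integral>\<^sup>+y. ennreal ((u y - u x)\<^sup>2) \<partial>M) < \<infinity>" by (simp add: less_top)
  then obtain x where x: "(\<integral>\<^sup>+y. ennreal ((u y - u x)\<^sup>2) \<partial>M) < \<infinity>" ..
  have i: "integrable M (\<lambda>y. (u y - u x)\<^sup>2)"
    by (rule integrableI_nonneg) (use x in auto)
  show ?thesis
  proof (rule Bochner_Integration.integrable_bound[where f = "\<lambda>y. 2 * (u y - u x)\<^sup>2 + 2 * (u x)\<^sup>2"])
    show "AE y in M. norm ((u y)\<^sup>2) \<le> norm (2 * (u y - u x)\<^sup>2 + 2 * (u x)\<^sup>2)"
    proof (rule AE_I2)
      fix y
      have "0 \<le> (u y - 2 * u x)\<^sup>2" by simp
      then show "norm ((u y)\<^sup>2) \<le> norm (2 * (u y - u x)\<^sup>2 + 2 * (u x)\<^sup>2)"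
        by (simp add: power2_eq_square algebra_simps)
    qed
  qed (use i in auto)
qed

lemma finite_measure_lebesgue_on_bounded:
  assumes "bounded \<Omega>" "\<Omega> \<in> sets lebesgue"
  shows "finite_measure (lebesgue_on \<Omega>)"
proof (rule finite_measureI)
  have "emeasure lebesgue \<Omega> \<noteq> \<infinity>"
    using fmeasurableD2[OF bounded_set_imp_lmeasurable[OF assms]] by simp
  then show "emeasure (lebesgue_on \<Omega>) (space (lebesgue_on \<Omega>)) \<noteq> \<infinity>"
    using assms(2) by (subst emeasure_restrict_space) auto
qed

lemma pair_variation_lebesgue_on:
  assumes \<Omega>: "open \<Omega>" and wg: "borel_weak_gradient \<Omega> U H" and u: "u \<in> borel_measurable (lebesgue_on \<Omega>)"
      "AE x in lebesgue_on \<Omega>. u x = U x"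
  shows "pair_variation \<Omega> \<Omega> U = (\<integral>\<^sup>+x. \<integral>\<^sup>+y. ennreal ((u y - u x)\<^sup>2) \<partial>lebesgue_on \<Omega> \<partial>lebesgue_on \<Omega>)"
proof -
  have \<Omega>m: "\<Omega> \<in> sets lebesgue" using \<Omega> by simp
  have [measurable]: "U \<in> borel_measurable borel" "\<Omega> \<in> sets borel" using wg \<Omega> by
      (auto simp: borel_weak_gradient_def)
  have "(\<integral>\<^sup>+x. \<integral>\<^sup>+y. ennreal ((u y - u x)\<^sup>2) \<partial>lebesgue_on \<Omega> \<partial>lebesgue_on \<Omega>)
    = (\<integral>\<^sup>+x. \<integral>\<^sup>+y. ennreal ((U y - U x)\<^sup>2) \<partial>lebesgue_on \<Omega> \<partial>lebesgue_on \<Omega>)"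
    using u(2)
  proof (intro nn_integral_cong_AE, eventually_elim)
    fix x assume x: "u x = U x"
    show "(\<integral>\<^sup>+y. ennreal ((u y - u x)\<^sup>2) \<partial>lebesgue_on \<Omega>) = (\<integral>\<^sup>+y. ennreal ((U y - U x)\<^sup>2) \<partial>lebesgue_on \<Omega>)"
      using u(2) by (intro nn_integral_cong_AE, eventually_elim) (simp add: x)
  qed
  also have "\<dots> = (\<integral>\<^sup>+x. (\<integral>\<^sup>+y. ennreal ((U y - U x)\<^sup>2) * indicator \<Omega> y \<partial>lborel) * indicator \<Omega> x \<partial>lborel)"
    by (simp add: nn_integral_lebesgue_on_eq_lborel[OF \<Omega>m])
  also have "\<dots> = pair_variation \<Omega> \<Omega> U"
    unfolding pair_variation_def
    by (subst nn_integral_multc[symmetric]) (auto simp: ac_simps)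
  finally show ?thesis ..
qed

theorem poincare_inequality:
  fixes \<Omega> :: "'a::euclidean_space set"
  assumes dom: "C1_domain \<Omega>" and bdd: "bounded \<Omega>" and con: "connected \<Omega>" and ne: "\<Omega> \<noteq> {}"
  obtains C where "C \<ge> 0"
    "\<And>u G. has_weak_gradient \<Omega> u G \<Longrightarrow> integrable (lebesgue_on \<Omega>) (\<lambda>x. (norm (G x))\<^sup>2) \<Longrightarrow>
       integrable (lebesgue_on \<Omega>) (\<lambda>x. (u x)\<^sup>2)"
    "\<And>u G. has_weak_gradient \<Omega> u G \<Longrightarrow> integrable (lebesgue_on \<Omega>) (\<lambda>x. (norm (G x))\<^sup>2) \<Longrightarrow>
       measure (lebesgue_on \<Omega>) \<Omega> * (\<integral>x. (u x)\<^sup>2 \<partial>lebesgue_on \<Omega>) - (\<integral>x. u x \<partial>lebesgue_on \<Omega>)\<^sup>2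
         \<le> C * (\<integral>x. (norm (G x))\<^sup>2 \<partial>lebesgue_on \<Omega>)"
proof -
  have open_domain: "open \<Omega>" using dom by (simp add: C1_domain_def)
  then have \<Omega>m: "\<Omega> \<in> sets lebesgue" by simp
  interpret finite_measure "lebesgue_on \<Omega>" by (rule finite_measure_lebesgue_on_bounded[OF bdd \<Omega>m])
  have pos: "emeasure (lebesgue_on \<Omega>) (space (lebesgue_on \<Omega>)) \<noteq> 0"
  proof -
    obtain x e where "e > 0" "ball x e \<subseteq> \<Omega>" using ne open_domain open_contains_ball by (metis all_not_in_conv)
    then have "0 < emeasure lborel (ball x e)" "emeasure lborel (ball x e) \<le> emeasure lborel \<Omega>"
      using open_domain by (auto intro!: emeasure_mono emeasure_ball_pos)
    then show ?thesis using open_domain \<Omega>m by (auto simp: emeasure_restrict_space)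
  qed
  obtain C where C: "C \<ge> 0"
    "\<And>u G. borel_weak_gradient \<Omega> u G \<Longrightarrow> pair_variation \<Omega> \<Omega> u \<le> ennreal C * gradient_energy G"
    by (rule poincare_pairE[OF poincare_pair_domain[OF dom bdd con ne]]) (rule that)
  have main: "(\<integral>\<^sup>+x. \<integral>\<^sup>+y. ennreal ((u y - u x)\<^sup>2) \<partial>lebesgue_on \<Omega> \<partial>lebesgue_on \<Omega>)
      \<le> ennreal (C * (\<integral>x. (norm (G x))\<^sup>2 \<partial>lebesgue_on \<Omega>))"
    and mu: "u \<in> borel_measurable (lebesgue_on \<Omega>)"
    if wg: "has_weak_gradient \<Omega> u G" and int: "integrable (lebesgue_on \<Omega>) (\<lambda>x. (norm (G x))\<^sup>2)" for u G
  proof -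
    show mu: "u \<in> borel_measurable (lebesgue_on \<Omega>)"
      using wg by (intro locally_integrable_measurable[OF open_domain]) (simp add: has_weak_gradient_def)
    obtain U H where UH: "borel_weak_gradient \<Omega> U H" "AE x in lebesgue_on \<Omega>. u x = U x"
        "AE x in lebesgue_on \<Omega>. G x = H x"
      by (rule has_weak_gradient_borel_version[OF open_domain wg]) (rule that)
    have "(\<integral>\<^sup>+x. ennreal ((norm (H x))\<^sup>2) \<partial>lborel) = (\<integral>\<^sup>+x. ennreal ((norm (H x))\<^sup>2) * indicator \<Omega> x \<partial>lborel)"
      using UH(1) by (intro nn_integral_cong) (auto simp: borel_weak_gradient_def indicator_def)
    also have "\<dots> = (\<integral>\<^sup>+x. ennreal ((norm (H x))\<^sup>2) \<partial>lebesgue_on \<Omega>)"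
      by (rule nn_integral_lebesgue_on_eq_lborel[OF \<Omega>m, symmetric])
    also have "\<dots> = (\<integral>\<^sup>+x. ennreal ((norm (G x))\<^sup>2) \<partial>lebesgue_on \<Omega>)"
      using UH(3) by (intro nn_integral_cong_AE, eventually_elim) simp
    also have "\<dots> = ennreal (\<integral>x. (norm (G x))\<^sup>2 \<partial>lebesgue_on \<Omega>)"
      by (rule nn_integral_eq_integral[OF int]) simp
    finally show "(\<integral>\<^sup>+x. \<integral>\<^sup>+y. ennreal ((u y - u x)\<^sup>2) \<partial>lebesgue_on \<Omega> \<partial>lebesgue_on \<Omega>)
      \<le> ennreal (C * (\<integral>x. (norm (G x))\<^sup>2 \<partial>lebesgue_on \<Omega>))"
      using C(2)[OF UH(1)] pair_variation_lebesgue_on[OF open_domain UH(1) mu UH(2)] C(1) by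
          (simp add: ennreal_mult)
  qed
  have sq: "integrable (lebesgue_on \<Omega>) (\<lambda>x. (u x)\<^sup>2)"
    if "has_weak_gradient \<Omega> u G" "integrable (lebesgue_on \<Omega>) (\<lambda>x. (norm (G x))\<^sup>2)" for u G
    by (rule square_integrable_if_pair_square_finite[OF mu[OF that] le_less_trans[OF main[OF that]] pos]) simp
  show ?thesis
  proof (rule that[of "C / 2"])
    fix u G assume as: "has_weak_gradient \<Omega> u G" "integrable (lebesgue_on \<Omega>) (\<lambda>x. (norm (G x))\<^sup>2)"
    have "0 \<le> C * (\<integral>x. (norm (G x))\<^sup>2 \<partial>lebesgue_on \<Omega>)" using C(1) by simp
    with main[OF as, unfolded nn_integral_pair_square[OF mu[OF as] sq[OF as]]]
    show "measure (lebesgue_on \<Omega>) \<Omega> * (\<integral>x. (u x)\<^sup>2 \<partial>lebesgue_on \<Omega>) - (\<integral>x. u x \<partial>lebesgue_on \<Omega>)\<^sup>2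
         \<le> C / 2 * (\<integral>x. (norm (G x))\<^sup>2 \<partial>lebesgue_on \<Omega>)"
      by (simp add: ennreal_le_iff)
  qed (use C(1) sq in auto)
qed

section \<open>Limits of weak gradients and completeness\<close>

lemma integrable_indicator_locally_integrable:
  fixes f :: "'a::euclidean_space \<Rightarrow> 'b::euclidean_space"
  assumes "open \<Omega>" "locally_integrable \<Omega> f" "compact K" "K \<subseteq> \<Omega>"
  shows "integrable (lebesgue_on \<Omega>) (\<lambda>x. indicator K x *\<^sub>R f x)"
proof -
  have K: "K \<in> sets lebesgue" using assms(3) by (simp add: borel_compact)
  have "integrable (lebesgue_on K) f" using assms by (auto simp: locally_integrable_def)
  then have "integrable lebesgue (\<lambda>x. indicator K x *\<^sub>R f x)"
    using K by (subst (asm) integrable_restrict_space) auto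
  moreover have "(\<lambda>x. indicator \<Omega> x *\<^sub>R indicator K x *\<^sub>R f x) = (\<lambda>x. indicator K x *\<^sub>R f x)"
    using assms(4) by (auto simp: indicator_def fun_eq_iff)
  ultimately show ?thesis
    using assms(1) by (subst integrable_restrict_space) auto
qed

lemma measurable_lebesgue_on_continuous:
  fixes f :: "'a::euclidean_space \<Rightarrow> 'b::euclidean_space"
  assumes "continuous_on UNIV f" shows "f \<in> borel_measurable (lebesgue_on \<Omega>)"
  using assms by (auto intro!: measurable_restrict_space1 measurable_completion borel_measurable_continuous_onI)

lemma test_function_integrable:
  fixes u :: "'a::euclidean_space \<Rightarrow> real" and G :: "'a \<Rightarrow> 'a"
  assumes \<Omega>: "open \<Omega>" and \<phi>: "\<phi> \<in> test_functions \<Omega>" "\<And>x. GDERIV \<phi> x :> g x"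
  shows "locally_integrable \<Omega> u \<Longrightarrow> integrable (lebesgue_on \<Omega>) (\<lambda>x. u x *\<^sub>R g x)"
    and "locally_integrable \<Omega> G \<Longrightarrow> integrable (lebesgue_on \<Omega>) (\<lambda>x. \<phi> x *\<^sub>R G x)"
    and "\<exists>B. (\<forall>x. norm (g x) \<le> B) \<and> (\<forall>x. \<bar>\<phi> x\<bar> \<le> B)"
proof -
  obtain g' K B where g': "\<And>x. GDERIV \<phi> x :> g' x" "continuous_on UNIV \<phi>" "continuous_on UNIV g'"
    "compact K" "K \<subseteq> \<Omega>" "\<And>x. x \<notin> K \<Longrightarrow> \<phi> x = 0" "\<And>x. x \<notin> K \<Longrightarrow> g' x = 0"
    "\<And>x. \<bar>\<phi> x\<bar> \<le> B" "\<And>x. norm (g' x) \<le> B"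
    using test_function_gradient[OF \<phi>(1)] by metis
  have "g' = g" using GDERIV_unique g'(1) \<phi>(2) by blast
  note g = g'[unfolded this]
  have B0: "0 \<le> B" using g(8)[of 0] by simp
  have [measurable]: "\<phi> \<in> borel_measurable (lebesgue_on \<Omega>)" "g \<in> borel_measurable (lebesgue_on \<Omega>)"
    using g(2,3) by (auto intro: measurable_lebesgue_on_continuous)
  show "integrable (lebesgue_on \<Omega>) (\<lambda>x. u x *\<^sub>R g x)" if u: "locally_integrable \<Omega> u"
  proof (rule Bochner_Integration.integrable_bound[OF integrable_mult_right[OF integrable_indicator_locally_integrable[OF \<Omega> u g(4,5)], of B]])
    have [measurable]: "u \<in> borel_measurable (lebesgue_on \<Omega>)" by (rule locally_integrable_measurable[OF \<Omega> u])
    show "(\<lambda>x. u x *\<^sub>R g x) \<in> borel_measurable (lebesgue_on \<Omega>)" by measurable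
    show "AE x in lebesgue_on \<Omega>. norm (u x *\<^sub>R g x) \<le> norm (B * indicator K x *\<^sub>R u x)"
      using g(7,9) B0 by (intro AE_I2) (auto simp: indicator_def abs_mult mult.commute[of B] intro!: mult_left_mono)
  qed
  show "integrable (lebesgue_on \<Omega>) (\<lambda>x. \<phi> x *\<^sub>R G x)" if G: "locally_integrable \<Omega> G"
  proof (rule Bochner_Integration.integrable_bound[OF integrable_scaleR_right[OF integrable_indicator_locally_integrable[OF \<Omega> G g(4,5)], of B]])
    have [measurable]: "G \<in> borel_measurable (lebesgue_on \<Omega>)" by (rule locally_integrable_measurable[OF \<Omega> G])
    show "(\<lambda>x. \<phi> x *\<^sub>R G x) \<in> borel_measurable (lebesgue_on \<Omega>)" by measurable
    show "AE x in lebesgue_on \<Omega>. norm (\<phi> x *\<^sub>R G x) \<le> norm (B *\<^sub>R indicator K x *\<^sub>R G x)"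
      using g(6,8) B0 by (intro AE_I2) (auto simp: indicator_def intro!: mult_right_mono)
  qed
  show "\<exists>B. (\<forall>x. norm (g x) \<le> B) \<and> (\<forall>x. \<bar>\<phi> x\<bar> \<le> B)" using g(8,9) by blast
qed

lemma has_weak_gradient_linear_combination:
  assumes \<Omega>: "open \<Omega>" and I: "finite I" and wg: "\<And>i. i \<in> I \<Longrightarrow> has_weak_gradient \<Omega> (u i) (G i)"
  shows "has_weak_gradient \<Omega> (\<lambda>x. \<Sum>i\<in>I. c i * u i x) (\<lambda>x. \<Sum>i\<in>I. c i *\<^sub>R G i x)"
proof -
  have lu: "locally_integrable \<Omega> (u i)" and lG: "locally_integrable \<Omega> (G i)" if "i \<in> I" for i
    using wg[OF that] by (auto simp: has_weak_gradient_def)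
  have "locally_integrable \<Omega> (\<lambda>x. \<Sum>i\<in>I. c i * u i x)" "locally_integrable \<Omega> (\<lambda>x. \<Sum>i\<in>I. c i *\<^sub>R G i x)"
    using lu lG by (auto simp: locally_integrable_def)
  moreover have "(\<integral>x. (\<Sum>i\<in>I. c i * u i x) *\<^sub>R g x \<partial>lebesgue_on \<Omega>)
      = - (\<integral>x. \<phi> x *\<^sub>R (\<Sum>i\<in>I. c i *\<^sub>R G i x) \<partial>lebesgue_on \<Omega>)"
    if \<phi>: "\<phi> \<in> test_functions \<Omega>" "\<And>x. GDERIV \<phi> x :> g x" for \<phi> g
  proof -
    note int = test_function_integrable(1)[OF \<Omega> \<phi> lu] test_function_integrable(2)[OF \<Omega> \<phi> lG]
    have "(\<integral>x. (\<Sum>i\<in>I. c i * u i x) *\<^sub>R g x \<partial>lebesgue_on \<Omega>) = (\<integral>x. (\<Sum>i\<in>I. c i *\<^sub>R u i x *\<^sub>R g x) \<partial>lebesgue_on \<Omega>)"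
      by (simp add: scaleR_sum_left)
    also have "\<dots> = (\<Sum>i\<in>I. c i *\<^sub>R (\<integral>x. u i x *\<^sub>R g x \<partial>lebesgue_on \<Omega>))"
      using int(1) by (subst Bochner_Integration.integral_sum) (auto simp del: scaleR_scaleR)
    also have "\<dots> = (\<Sum>i\<in>I. c i *\<^sub>R - (\<integral>x. \<phi> x *\<^sub>R G i x \<partial>lebesgue_on \<Omega>))"
      using wg \<phi> by (intro sum.cong) (auto simp: has_weak_gradient_def)
    also have "\<dots> = - (\<Sum>i\<in>I. \<integral>x. c i *\<^sub>R \<phi> x *\<^sub>R G i x \<partial>lebesgue_on \<Omega>)"
      by (simp add: sum_negf del: scaleR_scaleR)
    also have "(\<Sum>i\<in>I. \<integral>x. c i *\<^sub>R \<phi> x *\<^sub>R G i x \<partial>lebesgue_on \<Omega>)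
        = (\<integral>x. (\<Sum>i\<in>I. c i *\<^sub>R \<phi> x *\<^sub>R G i x) \<partial>lebesgue_on \<Omega>)"
      using int(2) by (subst Bochner_Integration.integral_sum) (auto simp del: scaleR_scaleR)
    also have "(\<lambda>x. \<Sum>i\<in>I. c i *\<^sub>R \<phi> x *\<^sub>R G i x) = (\<lambda>x. \<phi> x *\<^sub>R (\<Sum>i\<in>I. c i *\<^sub>R G i x))"
      by (simp add: scaleR_sum_right mult.commute)
    finally show ?thesis .
  qed
  ultimately show ?thesis by (auto simp: has_weak_gradient_def)
qed

lemma integrable_imp_locally_integrable:
  fixes f :: "'a::euclidean_space \<Rightarrow> 'b::euclidean_space"
  assumes "open \<Omega>" "integrable (lebesgue_on \<Omega>) f" shows "locally_integrable \<Omega> f"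
  unfolding locally_integrable_def
proof (intro allI impI)
  fix K assume K: "compact K \<and> K \<subseteq> \<Omega>"
  then have Ks: "K \<in> sets lebesgue" by (simp add: borel_compact)
  have \<Omega>s: "\<Omega> \<in> sets lebesgue" using assms(1) by simp
  have "integrable lebesgue (\<lambda>x. indicator \<Omega> x *\<^sub>R f x)"
    using assms by (subst (asm) integrable_restrict_space) auto
  then have "integrable lebesgue (\<lambda>x. indicator K x *\<^sub>R indicator \<Omega> x *\<^sub>R f x)"
    by (rule integrable_mult_indicator[OF Ks])
  also have "(\<lambda>x. indicator K x *\<^sub>R indicator \<Omega> x *\<^sub>R f x) = (\<lambda>x. indicator K x *\<^sub>R f x)"
    using K by (auto simp: indicator_def fun_eq_iff)
  finally show "integrable (lebesgue_on K) f"
    using Ks by (subst integrable_restrict_space) auto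
qed

lemma integral_tendsto_if_norm_diff:
  fixes a :: "nat \<Rightarrow> 'a \<Rightarrow> 'b::{banach, second_countable_topology}"
  assumes "\<And>n. integrable M (a n)" "integrable M b" "\<And>n. integrable M (d n)"
    "\<And>n x. norm (a n x - b x) \<le> B * d n x" "(\<lambda>n. \<integral>x. d n x \<partial>M) \<longlonglongrightarrow> (0::real)"
  shows "(\<lambda>n. \<integral>x. a n x \<partial>M) \<longlonglongrightarrow> (\<integral>x. b x \<partial>M)"
proof (rule LIM_zero_cancel, rule tendsto_norm_zero_cancel, rule tendsto_sandwich[of "\<lambda>_. 0" _ _
    "\<lambda>n. B * (\<integral>x. d n x \<partial>M)"])
  show "\<forall>\<^sub>F n in sequentially. norm ((\<integral>x. a n x \<partial>M) - (\<integral>x. b x \<partial>M)) \<le> B * (\<integral>x. d n x \<partial>M)"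
  proof (rule always_eventually, rule allI)
    fix n
    have "norm ((\<integral>x. a n x \<partial>M) - (\<integral>x. b x \<partial>M)) = norm (\<integral>x. a n x - b x \<partial>M)"
      using assms by simp
    also have "\<dots> \<le> (\<integral>x. norm (a n x - b x) \<partial>M)" by (rule integral_norm_bound)
    also have "\<dots> \<le> (\<integral>x. B * d n x \<partial>M)"
      using assms by (intro integral_mono) auto
    finally show "norm ((\<integral>x. a n x \<partial>M) - (\<integral>x. b x \<partial>M)) \<le> B * (\<integral>x. d n x \<partial>M)" by simp
  qed
  show "(\<lambda>n. B * (\<integral>x. d n x \<partial>M)) \<longlonglongrightarrow> 0" using tendsto_mult_right_zero[OF assms(5)] .
qed auto

lemma has_weak_gradient_L1_limit:
  assumes \<Omega>: "open \<Omega>" and wg: "\<And>n. has_weak_gradient \<Omega> (v n) (H n)"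
    and v: "\<And>n. integrable (lebesgue_on \<Omega>) (v n)" "integrable (lebesgue_on \<Omega>) w"
      "(\<lambda>n. \<integral>x. norm (v n x - w x) \<partial>lebesgue_on \<Omega>) \<longlonglongrightarrow> 0"
    and H: "\<And>n. integrable (lebesgue_on \<Omega>) (H n)" "integrable (lebesgue_on \<Omega>) J"
      "(\<lambda>n. \<integral>x. norm (H n x - J x) \<partial>lebesgue_on \<Omega>) \<longlonglongrightarrow> 0"
  shows "has_weak_gradient \<Omega> w J"
  unfolding has_weak_gradient_def
proof (intro conjI ballI allI impI)
  note li = integrable_imp_locally_integrable[OF \<Omega>]
  show "locally_integrable \<Omega> w" "locally_integrable \<Omega> J" using li v(2) H(2) by auto
  fix \<phi> g assume \<phi>: "\<phi> \<in> test_functions \<Omega>" and g: "\<forall>x. GDERIV \<phi> x :> g x"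
  note \<phi>' = \<Omega> \<phi> g[rule_format]
  obtain B where B: "\<And>x. norm (g x) \<le> B" "\<And>x. \<bar>\<phi> x\<bar> \<le> B" using test_function_integrable(3)[OF \<phi>'] by blast
  have 1: "(\<lambda>n. \<integral>x. v n x *\<^sub>R g x \<partial>lebesgue_on \<Omega>) \<longlonglongrightarrow> (\<integral>x. w x *\<^sub>R g x \<partial>lebesgue_on \<Omega>)"
  proof (rule integral_tendsto_if_norm_diff[OF _ _ _ _ v(3), where B = B])
    show "norm (v n x *\<^sub>R g x - w x *\<^sub>R g x) \<le> B * norm (v n x - w x)" for n x
      using mult_right_mono[OF B(1)[of x], of "\<bar>v n x - w x\<bar>"]
      by (simp add: scaleR_diff_left[symmetric] mult.commute)
  qed (use v li in \<open>auto intro!: test_function_integrable(1)[OF \<phi>']\<close>)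
  have 2: "(\<lambda>n. \<integral>x. \<phi> x *\<^sub>R H n x \<partial>lebesgue_on \<Omega>) \<longlonglongrightarrow> (\<integral>x. \<phi> x *\<^sub>R J x \<partial>lebesgue_on \<Omega>)"
  proof (rule integral_tendsto_if_norm_diff[OF _ _ _ _ H(3), where B = B])
    show "norm (\<phi> x *\<^sub>R H n x - \<phi> x *\<^sub>R J x) \<le> B * norm (H n x - J x)" for n x
      using mult_right_mono[OF B(2)[of x], of "norm (H n x - J x)"]
      by (simp add: scaleR_diff_right[symmetric])
  qed (use H li in \<open>auto intro!: test_function_integrable(2)[OF \<phi>']\<close>)
  have "(\<lambda>n. \<integral>x. v n x *\<^sub>R g x \<partial>lebesgue_on \<Omega>) = (\<lambda>n. - (\<integral>x. \<phi> x *\<^sub>R H n x \<partial>lebesgue_on \<Omega>))"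
    using wg \<phi> g by (auto simp: has_weak_gradient_def)
  with 1 tendsto_minus[OF 2]
  show "(\<integral>x. w x *\<^sub>R g x \<partial>lebesgue_on \<Omega>) = - (\<integral>x. \<phi> x *\<^sub>R J x \<partial>lebesgue_on \<Omega>)"
    using LIMSEQ_unique by fastforce
qed

text \<open>Fatou's lemma in the form used for limits of Cauchy sequences.\<close>

lemma nn_integral_AE_limit_le:
  fixes f :: "nat \<Rightarrow> 'a \<Rightarrow> ennreal"
  assumes "\<And>i. f i \<in> borel_measurable M" "AE x in M. (\<lambda>i. f i x) \<longlonglongrightarrow> g x"
    and "\<forall>\<^sub>F i in sequentially. (\<integral>\<^sup>+x. f i x \<partial>M) \<le> c"
  shows "(\<integral>\<^sup>+x. g x \<partial>M) \<le> c"
proof -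
  have "(\<integral>\<^sup>+x. g x \<partial>M) = (\<integral>\<^sup>+x. liminf (\<lambda>i. f i x) \<partial>M)"
    using assms(2) by (intro nn_integral_cong_AE, eventually_elim) (metis lim_imp_Liminf trivial_limit_sequentially)
  also have "\<dots> \<le> liminf (\<lambda>i. \<integral>\<^sup>+x. f i x \<partial>M)" by (rule nn_integral_liminf[OF assms(1)])
  also have "\<dots> \<le> liminf (\<lambda>i. c)" using assms(3) by (rule Liminf_mono)
  also have "\<dots> = c" by (simp add: Liminf_const)
  finally show ?thesis .
qed

lemma L1_complete:
  fixes s :: "nat \<Rightarrow> 'a \<Rightarrow> 'b::euclidean_space"
  assumes int: "\<And>n. integrable M (s n)"
    and cau: "\<And>e. e > 0 \<Longrightarrow> \<exists>N. \<forall>i\<ge>N. \<forall>j\<ge>N. (\<integral>x. norm (s i x - s j x) \<partial>M) < e"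
  obtains r F where "strict_mono r" "AE x in M. (\<lambda>i. s (r i) x) \<longlonglongrightarrow> F x" "integrable M F"
    "(\<lambda>n. \<integral>x. norm (s n x - F x) \<partial>M) \<longlonglongrightarrow> 0"
proof -
  obtain r where r: "strict_mono r" "AE x in M. Cauchy (\<lambda>i. s (r i) x)"
    by (rule cauchy_L1_AE_cauchy_subseq[OF int cau]) (assumption, rule that)
  define F where "F = (\<lambda>x. lim (\<lambda>i. s (r i) x))"
  have [measurable]: "s n \<in> borel_measurable M" for n using int by auto
  have [measurable]: "F \<in> borel_measurable M" unfolding F_def by (rule borel_measurable_lim_metric) measurable
  have lim: "AE x in M. (\<lambda>i. s (r i) x) \<longlonglongrightarrow> F x"
    using r(2) by eventually_elim (simp add: F_def Cauchy_convergent_iff convergent_LIMSEQ_iff)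
  have bound: "(\<integral>\<^sup>+x. ennreal (norm (s n x - F x)) \<partial>M) \<le> ennreal e"
    if "\<And>j. j \<ge> N \<Longrightarrow> (\<integral>x. norm (s n x - s j x) \<partial>M) \<le> e" for n N e
  proof (rule nn_integral_AE_limit_le)
    show "AE x in M. (\<lambda>i. ennreal (norm (s n x - s (r i) x))) \<longlonglongrightarrow> ennreal (norm (s n x - F x))"
      using lim by eventually_elim (intro tendsto_intros)
    show "\<forall>\<^sub>F i in sequentially. (\<integral>\<^sup>+x. ennreal (norm (s n x - s (r i) x)) \<partial>M) \<le> ennreal e"
      using eventually_ge_at_top[of N]
    proof eventually_elim
      case (elim i)
      have "r i \<ge> N" using elim seq_suble[OF r(1), of i] by simp
      then have "(\<integral>x. norm (s n x - s (r i) x) \<partial>M) \<le> e" by (rule that)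
      moreover have "(\<integral>\<^sup>+x. ennreal (norm (s n x - s (r i) x)) \<partial>M) = ennreal (\<integral>x. norm (s n x - s (r i) x) \<partial>M)"
        using int by (intro nn_integral_eq_integral) auto
      ultimately show ?case by (simp add: ennreal_leI)
    qed
  qed measurable
  have intd: "integrable M (\<lambda>x. s n x - F x)" and le: "(\<integral>x. norm (s n x - F x) \<partial>M) \<le> e"
    if "\<And>j. j \<ge> N \<Longrightarrow> (\<integral>x. norm (s n x - s j x) \<partial>M) \<le> e" "e \<ge> 0" for n N e
  proof -
    have *: "(\<integral>\<^sup>+x. ennreal (norm (s n x - F x)) \<partial>M) \<le> ennreal e" by (rule bound[OF that(1)])
    show i: "integrable M (\<lambda>x. s n x - F x)"
      by (rule integrableI_bounded) (use * in \<open>auto simp: less_top[symmetric] top_unique intro: le_less_trans\<close>)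
    have "(\<integral>\<^sup>+x. ennreal (norm (s n x - F x)) \<partial>M) = ennreal (\<integral>x. norm (s n x - F x) \<partial>M)"
      using i by (intro nn_integral_eq_integral) auto
    with * that(2) show "(\<integral>x. norm (s n x - F x) \<partial>M) \<le> e" by (simp add: ennreal_le_iff)
  qed
  have iF: "integrable M F"
  proof -
    obtain N where "\<forall>i\<ge>N. \<forall>j\<ge>N. (\<integral>x. norm (s i x - s j x) \<partial>M) < 1" using cau[of 1] by auto
    then have "integrable M (\<lambda>x. s N x - F x)" by (intro intd[of N N 1]) (auto simp: less_imp_le)
    from Bochner_Integration.integrable_diff[OF int[of N] this] show ?thesis by simp
  qed
  have "(\<lambda>n. \<integral>x. norm (s n x - F x) \<partial>M) \<longlonglongrightarrow> 0"
  proof (rule LIMSEQ_I)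
    fix e :: real assume e: "e > 0"
    obtain N where N: "\<forall>i\<ge>N. \<forall>j\<ge>N. (\<integral>x. norm (s i x - s j x) \<partial>M) < e / 2" using cau[of "e / 2"] e by auto
    have "norm ((\<integral>x. norm (s n x - F x) \<partial>M) - 0) < e" if "n \<ge> N" for n
    proof -
      have "(\<integral>x. norm (s n x - F x) \<partial>M) \<le> e / 2"
        by (rule le[of N]) (use N that e in \<open>auto simp: less_imp_le\<close>)
      then show ?thesis using e by simp
    qed
    then show "\<exists>N. \<forall>n\<ge>N. norm ((\<integral>x. norm (s n x - F x) \<partial>M) - 0) < e" by blast
  qed
  then show ?thesis using that[OF r(1) lim iF] by blast
qed

text \<open>Trades an $L^2$ bound for an $L^1$ bound on a set of finite measure, with a free parameter.\<close>

lemma le_eta_plus_square_div: "(a::real) \<ge> 0 \<Longrightarrow> \<eta> > 0 \<Longrightarrow> a \<le> \<eta> + a\<^sup>2 / \<eta>"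
proof -
  assume a: "a \<ge> 0" "\<eta> > 0"
  have "2 * (a * \<eta>) \<le> \<eta>\<^sup>2 + a\<^sup>2" "0 \<le> a * \<eta>"
    using a zero_le_power2[of "a - \<eta>"] by (simp_all add: power2_eq_square algebra_simps)
  then have "a * \<eta> \<le> \<eta>\<^sup>2 + a\<^sup>2" by linarith
  then show ?thesis using a(2) by (simp add: field_simps power2_eq_square)
qed

lemma parallelogram_law:
  fixes a b :: "'a::real_inner"
  shows "(norm (a - b))\<^sup>2 + (norm (a + b))\<^sup>2 = 2 * (norm a)\<^sup>2 + 2 * (norm b)\<^sup>2"
  by (simp add: power2_norm_eq_inner inner_diff_left inner_diff_right inner_add_left inner_add_right inner_commute)

lemma norm_diff_square_le:
  fixes a b :: "'a::real_inner"
  shows "(norm (a - b))\<^sup>2 \<le> 2 * (norm a)\<^sup>2 + 2 * (norm b)\<^sup>2"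
  using parallelogram_law[of a b] zero_le_power2[of "norm (a + b)"] by linarith

lemma norm_diff_square_integral:
  fixes f g :: "'a \<Rightarrow> 'b::euclidean_space"
  assumes [measurable]: "f \<in> borel_measurable M" "g \<in> borel_measurable M"
    and int: "integrable M (\<lambda>x. (norm (f x))\<^sup>2)" "integrable M (\<lambda>x. (norm (g x))\<^sup>2)"
  shows "integrable M (\<lambda>x. (norm (f x - g x))\<^sup>2)"
    and "(\<integral>x. (norm (f x))\<^sup>2 \<partial>M) \<le> K \<Longrightarrow> (\<integral>x. (norm (g x))\<^sup>2 \<partial>M) \<le> K \<Longrightarrow>
      (\<integral>x. (norm (f x - g x))\<^sup>2 \<partial>M) \<le> 4 * K"
proof -
  have ii: "integrable M (\<lambda>x. 2 * (norm (f x))\<^sup>2 + 2 * (norm (g x))\<^sup>2)" using int by simp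
  show i: "integrable M (\<lambda>x. (norm (f x - g x))\<^sup>2)"
    by (rule Bochner_Integration.integrable_bound[OF ii]) (auto intro!: AE_I2 simp: norm_diff_square_le)
  assume "(\<integral>x. (norm (f x))\<^sup>2 \<partial>M) \<le> K" "(\<integral>x. (norm (g x))\<^sup>2 \<partial>M) \<le> K"
  moreover have "(\<integral>x. (norm (f x - g x))\<^sup>2 \<partial>M) \<le> (\<integral>x. 2 * (norm (f x))\<^sup>2 + 2 * (norm (g x))\<^sup>2 \<partial>M)"
    by (intro integral_mono i ii norm_diff_square_le)
  moreover have "\<dots> = 2 * (\<integral>x. (norm (f x))\<^sup>2 \<partial>M) + 2 * (\<integral>x. (norm (g x))\<^sup>2 \<partial>M)" using int by simp
  ultimately show "(\<integral>x. (norm (f x - g x))\<^sup>2 \<partial>M) \<le> 4 * K" by linarith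
qed

lemma (in finite_measure) L2_complete:
  fixes s :: "nat \<Rightarrow> 'a \<Rightarrow> 'b::euclidean_space"
  assumes meas [measurable]: "\<And>n. s n \<in> borel_measurable M" and int: "\<And>n. integrable M (\<lambda>x. (norm (s n x))\<^sup>2)"
    and cau: "\<And>e. e > 0 \<Longrightarrow> \<exists>N. \<forall>i\<ge>N. \<forall>j\<ge>N. (\<integral>x. (norm (s i x - s j x))\<^sup>2 \<partial>M) < e"
  obtains r F where "strict_mono r" "AE x in M. (\<lambda>i. s (r i) x) \<longlonglongrightarrow> F x" "integrable M F"
    "(\<lambda>n. \<integral>x. norm (s n x - F x) \<partial>M) \<longlonglongrightarrow> 0"
proof -
  have int1: "integrable M (s n)" for n by (rule integrable_if_norm_square_integrable[OF meas int])
  have intd: "integrable M (\<lambda>x. (norm (s i x - s j x))\<^sup>2)" for i j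
    by (rule norm_diff_square_integral(1)[OF meas meas int int])
  have cau1: "\<exists>N. \<forall>i\<ge>N. \<forall>j\<ge>N. (\<integral>x. norm (s i x - s j x) \<partial>M) < e" if e: "e > 0" for e
  proof -
    define m where "m = measure M (space M)"
    define \<eta> where "\<eta> = e / (2 * (m + 1))"
    have m0: "m \<ge> 0" by (simp add: m_def)
    have \<eta>: "\<eta> > 0" using e m0 by (simp add: \<eta>_def)
    have "m * \<eta> \<le> (m + 1) * \<eta>" using \<eta> by simp
    also have "\<dots> = e / 2" using m0 by (simp add: \<eta>_def field_simps)
    finally have \<eta>m: "m * \<eta> \<le> e / 2" .
    obtain N where N: "\<forall>i\<ge>N. \<forall>j\<ge>N. (\<integral>x. (norm (s i x - s j x))\<^sup>2 \<partial>M) < \<eta> * (e / 2)"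
      using cau[of "\<eta> * (e / 2)"] e \<eta> by auto
    have "(\<integral>x. norm (s i x - s j x) \<partial>M) < e" if ij: "i \<ge> N" "j \<ge> N" for i j
    proof -
      have "(\<integral>x. norm (s i x - s j x) \<partial>M) \<le> (\<integral>x. \<eta> + (norm (s i x - s j x))\<^sup>2 / \<eta> \<partial>M)"
        using int1 intd \<eta> by (intro integral_mono le_eta_plus_square_div) auto
      also have "\<dots> = m * \<eta> + (\<integral>x. (norm (s i x - s j x))\<^sup>2 \<partial>M) / \<eta>"
        using intd by (simp add: m_def)
      also have "(\<integral>x. (norm (s i x - s j x))\<^sup>2 \<partial>M) / \<eta> < \<eta> * (e / 2) / \<eta>"
        using N ij \<eta> by (intro divide_strict_right_mono) auto
      also have "\<eta> * (e / 2) / \<eta> = e / 2" using \<eta> by simp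
      finally show ?thesis using \<eta>m by simp
    qed
    then show ?thesis by blast
  qed
  show ?thesis by (rule L1_complete[OF int1 cau1]) (assumption, rule that)
qed

section \<open>Rellich compactness\<close>

text \<open>The half-open cubes of side \<open>1 / c\<close>, written as level sets so that disjointness is immediate.\<close>

definition grid_cell :: "real \<Rightarrow> ('a::euclidean_space \<Rightarrow> int) \<Rightarrow> 'a set" where
  "grid_cell c z = {y. \<forall>b\<in>Basis. \<lfloor>c * (y \<bullet> b)\<rfloor> = z b}"

text \<open>Extensional index functions make the index of a nonempty cell unique, hence distinct cells disjoint.\<close>

definition grid_cells :: "real \<Rightarrow> 'a::euclidean_space set \<Rightarrow> 'a set set" where
  "grid_cells c \<Omega> = {Q. \<exists>z\<in>Basis \<rightarrow>\<^sub>E UNIV. Q = grid_cell c z \<and> Q \<noteq> {} \<and> Q \<subseteq> \<Omega>}"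

lemma finite_grid_cells:
  fixes \<Omega> :: "'a::euclidean_space set"
  assumes "bounded \<Omega>" "c > 0" shows "finite (grid_cells c \<Omega>)"
proof -
  obtain R where R: "\<And>x. x \<in> \<Omega> \<Longrightarrow> norm x \<le> R" using assms(1) by (auto simp: bounded_iff)
  define N where "N = \<lceil>c * R\<rceil> + 1"
  have "grid_cells c \<Omega> \<subseteq> grid_cell c ` (Basis \<rightarrow>\<^sub>E {- N..N})"
  proof
    fix Q assume "Q \<in> grid_cells c \<Omega>"
    then obtain z y where z: "z \<in> Basis \<rightarrow>\<^sub>E UNIV" "Q = grid_cell c z" "y \<in> Q" "y \<in> \<Omega>"
      by (auto simp: grid_cells_def)
    have "z b \<in> {- N..N}" if b: "b \<in> Basis" for b
    proof -
      have "z b = \<lfloor>c * (y \<bullet> b)\<rfloor>" using z b by (simp add: grid_cell_def)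
      moreover have "\<bar>c * (y \<bullet> b)\<bar> \<le> c * R"
        using Basis_le_norm[OF b, of y] R[OF z(4)] assms(2) by (simp add: abs_mult)
      ultimately show ?thesis unfolding N_def atLeastAtMost_iff by linarith
    qed
    then have "z \<in> Basis \<rightarrow>\<^sub>E {- N..N}" using z(1) by (auto simp: PiE_iff)
    then show "Q \<in> grid_cell c ` (Basis \<rightarrow>\<^sub>E {- N..N})" using z(2) by blast
  qed
  moreover have "finite (Basis \<rightarrow>\<^sub>E {- N..N} :: ('a \<Rightarrow> int) set)" by (intro finite_PiE) auto
  ultimately show ?thesis by (meson finite_imageI finite_subset)
qed

lemma grid_cell_borel: "grid_cell c z \<in> sets borel"
proof -
  have "grid_cell c z = (\<Inter>b\<in>Basis. {y. of_int (z b) \<le> c * (y \<bullet> b)} \<inter> {y. c * (y \<bullet> b) < of_int (z b) + 1})"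
    by (auto simp: grid_cell_def floor_eq_iff)
  also have "\<dots> \<in> sets borel"
    by (intro sets.finite_INT sets.Int borel_closed borel_open closed_Collect_le open_Collect_less continuous_intros) auto
  finally show ?thesis .
qed

lemma grid_cell_segment:
  assumes "x \<in> grid_cell c z" "y \<in> grid_cell c z" "0 \<le> t" "t \<le> 1"
  shows "x + t *\<^sub>R (y - x) \<in> grid_cell c z"
  unfolding grid_cell_def mem_Collect_eq
proof
  fix b :: 'a assume b: "b \<in> Basis"
  let ?A = "c * (x \<bullet> b)" and ?B = "c * (y \<bullet> b)" and ?z = "of_int (z b) :: real"
  have AB: "?z \<le> ?A" "?A < ?z + 1" "?z \<le> ?B" "?B < ?z + 1"
    using assms(1,2) b by (auto simp: grid_cell_def floor_eq_iff)
  have eq: "c * ((x + t *\<^sub>R (y - x)) \<bullet> b) = (1 - t) * ?A + t * ?B"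
    by (simp add: inner_add_left inner_diff_left algebra_simps)
  have "(1 - t) * ?A + t * ?B < ?z + 1"
    by (rule convex_bound_lt) (use AB assms(3,4) in auto)
  moreover have "(1 - t) * (- ?A) + t * (- ?B) \<le> - ?z"
    by (rule convex_bound_le) (use AB assms(3,4) in auto)
  then have "?z \<le> (1 - t) * ?A + t * ?B" by (simp add: algebra_simps)
  ultimately show "\<lfloor>c * ((x + t *\<^sub>R (y - x)) \<bullet> b)\<rfloor> = z b"
    by (simp add: eq floor_eq_iff)
qed

lemma grid_cell_diameter:
  fixes x :: "'a::euclidean_space"
  assumes "x \<in> grid_cell c z" "y \<in> grid_cell c z" "c > 0"
  shows "norm (y - x) \<le> DIM('a) / c"
proof -
  have "norm (y - x) \<le> (\<Sum>b\<in>Basis. \<bar>(y - x) \<bullet> b\<bar>)" by (rule norm_le_l1)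
  also have "\<dots> \<le> (\<Sum>b\<in>(Basis::'a set). 1 / c)"
  proof (rule sum_mono)
    fix b :: 'a assume b: "b \<in> Basis"
    have "\<lfloor>c * (x \<bullet> b)\<rfloor> = \<lfloor>c * (y \<bullet> b)\<rfloor>" using assms(1,2) b by (simp add: grid_cell_def)
    then have "\<bar>c * (y \<bullet> b) - c * (x \<bullet> b)\<bar> \<le> 1" by linarith
    then have "c * \<bar>(y - x) \<bullet> b\<bar> \<le> 1"
      using assms(3) by (simp add: inner_diff_left right_diff_distrib[symmetric] abs_mult)
    then show "\<bar>(y - x) \<bullet> b\<bar> \<le> 1 / c" using assms(3) by (simp add: field_simps)
  qed
  finally show ?thesis by simp
qed

lemma grid_cells_disjoint:
  assumes "Q \<in> grid_cells c \<Omega>" "Q' \<in> grid_cells c \<Omega>" "y \<in> Q" "y \<in> Q'"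
  shows "Q = Q'"
proof -
  obtain z z' where z: "z \<in> Basis \<rightarrow>\<^sub>E UNIV" "Q = grid_cell c z" "z' \<in> Basis \<rightarrow>\<^sub>E UNIV" "Q' = grid_cell c z'"
    using assms(1,2) by (auto simp: grid_cells_def)
  have "z b = z' b" if "b \<in> Basis" for b using z assms(3,4) that by (auto simp: grid_cell_def)
  then have "z = z'" using z(1,3) by (intro PiE_ext) auto
  then show ?thesis using z by simp
qed

text \<open>A fixed point of an open set lies in an admissible cell as soon as the cells have become smaller
  than its distance to the complement. Nothing uniform in the point is claimed; dominated convergence
  later turns this into small measure of the uncovered part.\<close>

lemma grid_cells_cover_eventually:
  fixes \<Omega> :: "'a::euclidean_space set"
  assumes "open \<Omega>" "x \<in> \<Omega>"
  shows "\<forall>\<^sub>F n in sequentially. x \<in> \<Union>(grid_cells (real (Suc n)) \<Omega>)"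
proof -
  obtain e where e: "e > 0" "ball x e \<subseteq> \<Omega>" using assms open_contains_ball by blast
  have "(\<lambda>n. real DIM('a) * inverse (real (Suc n))) \<longlonglongrightarrow> real DIM('a) * 0"
    by (intro tendsto_intros LIMSEQ_inverse_real_of_nat)
  then have "\<forall>\<^sub>F n in sequentially. real DIM('a) * inverse (real (Suc n)) < e"
    using e(1) by (intro order_tendstoD(2)) auto
  then show ?thesis
  proof eventually_elim
    case (elim n)
    let ?c = "real (Suc n)"
    define z where "z = restrict (\<lambda>b. \<lfloor>?c * (x \<bullet> b)\<rfloor>) Basis"
    have x: "x \<in> grid_cell ?c z" by (simp add: grid_cell_def z_def)
    have "grid_cell ?c z \<subseteq> ball x e"
    proof
      fix y assume "y \<in> grid_cell ?c z"
      from grid_cell_diameter[OF x this] elim show "y \<in> ball x e"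
        by (simp add: dist_norm norm_minus_commute divide_inverse)
    qed
    then have "grid_cell ?c z \<in> grid_cells ?c \<Omega>"
      using e(2) x unfolding grid_cells_def by (auto simp: z_def intro!: bexI[of _ z])
    then show ?case using x by blast
  qed
qed

text \<open>The segment estimate with \<open>A = B = W = Q\<close>. On a cell of measure zero the left-hand side vanishes,
  and the quotient on the right is \<open>0\<close> by convention.\<close>

lemma grid_cell_poincare:
  fixes \<Omega> :: "'a::euclidean_space set"
  assumes \<Omega>: "open \<Omega>" "bounded \<Omega>" and wg: "borel_weak_gradient \<Omega> w J" and Q: "Q \<in> grid_cells c \<Omega>" and c: "c > 0"
    and iw: "integrable lborel (\<lambda>x. (w x)\<^sup>2)" and iJ: "integrable lborel (\<lambda>x. (norm (J x))\<^sup>2)"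
  shows "(\<integral>x. indicator Q x * (w x)\<^sup>2 \<partial>lborel) \<le> (\<integral>x. indicator Q x * w x \<partial>lborel)\<^sup>2 / measure lborel Q
     + 2 ^ DIM('a) * (DIM('a) / c)\<^sup>2 * (\<integral>x. indicator Q x * (norm (J x))\<^sup>2 \<partial>lborel)"
proof -
  obtain z where z: "Q = grid_cell c z" "Q \<subseteq> \<Omega>" using Q by (auto simp: grid_cells_def)
  have [measurable]: "Q \<in> sets borel" using z(1) grid_cell_borel by simp
  have [measurable]: "w \<in> borel_measurable borel" "J \<in> borel_measurable borel" using wg by
      (auto simp: borel_weak_gradient_def)
  have fin: "emeasure lborel Q < \<infinity>" using bounded_subset[OF \<Omega>(2) z(2)] by (rule emeasure_bounded_finite)
  define N where "N = restrict_space lborel Q"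
  have sp: "space N = Q" by (simp add: N_def space_restrict_space)
  have eN: "emeasure N Q = emeasure lborel Q" unfolding N_def by (subst emeasure_restrict_space) auto
  interpret N: finite_measure N by (rule finite_measureI) (use fin eN sp in auto)
  have mN: "measure N (space N) = measure lborel Q" using eN by (simp add: measure_def sp)
  have [measurable]: "w \<in> borel_measurable N" unfolding N_def by (rule measurable_restrict_space1) simp
  have ind: "integrable lborel (\<lambda>x. indicator Q x * (w x)\<^sup>2)"
      "integrable lborel (\<lambda>x. indicator Q x * (norm (J x))\<^sup>2)"
    using integrable_mult_indicator[OF _ iw, of Q] integrable_mult_indicator[OF _ iJ, of Q] by simp_all
  have iN: "integrable N (\<lambda>x. (w x)\<^sup>2)"
    unfolding N_def by (subst integrable_restrict_space) (use ind in auto)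
  have int_N: "(\<integral>x. f x \<partial>N) = (\<integral>x. indicator Q x * f x \<partial>lborel)" for f :: "'a \<Rightarrow> real"
    unfolding N_def by (subst integral_restrict_space) auto
  define I1 I2 m j where "I1 = (\<integral>x. indicator Q x * w x \<partial>lborel)" and "I2
      = (\<integral>x. indicator Q x * (w x)\<^sup>2 \<partial>lborel)"
    and "m = measure lborel Q" and "j = (\<integral>x. indicator Q x * (norm (J x))\<^sup>2 \<partial>lborel)"
  define D where "D = real DIM('a) / c"
  have nn: "m \<ge> 0" "j \<ge> 0" by (auto simp: m_def j_def)
  have "pair_variation Q Q w = (\<integral>\<^sup>+x. \<integral>\<^sup>+y. ennreal ((w y - w x)\<^sup>2) \<partial>N \<partial>N)"
    unfolding pair_variation_def N_def
    by (simp add: nn_integral_restrict_space, subst nn_integral_multc[symmetric]) (auto simp: ac_simps)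
  also have "\<dots> = ennreal (2 * (m * I2 - I1\<^sup>2))"
    using N.nn_integral_pair_square[OF _ iN] by (simp add: mN int_N m_def I1_def I2_def)
  finally have pv: "pair_variation Q Q w = ennreal (2 * (m * I2 - I1\<^sup>2))" .
  have "pair_variation Q Q w \<le> ennreal (2 ^ DIM('a) * D\<^sup>2) * (emeasure lborel Q + emeasure lborel Q) *
      (\<integral>\<^sup>+x. indicator Q x * ennreal ((norm (J x))\<^sup>2) \<partial>lborel)"
    by (rule segment_poincare[OF \<Omega>(1) wg _ _ _ z(2)])
      (auto simp: z(1) D_def c intro: grid_cell_segment grid_cell_diameter grid_cell_borel)
  also have "(\<integral>\<^sup>+x. indicator Q x * ennreal ((norm (J x))\<^sup>2) \<partial>lborel)
      = (\<integral>\<^sup>+x. ennreal (indicator Q x * (norm (J x))\<^sup>2) \<partial>lborel)"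
    by (intro nn_integral_cong) (auto simp: indicator_def)
  also have "\<dots> = ennreal j"
    unfolding j_def by (rule nn_integral_eq_integral[OF ind(2)]) auto
  also have "emeasure lborel Q = ennreal m" using fin by (simp add: m_def emeasure_eq_ennreal_measure less_top)
  also have "ennreal (2 ^ DIM('a) * D\<^sup>2) * (ennreal m + ennreal m) * ennreal j
      = ennreal (2 ^ DIM('a) * D\<^sup>2 * (m + m) * j)"
    unfolding ennreal_plus[OF nn(1) nn(1), symmetric] using nn by
        (simp only: ennreal_mult[symmetric] mult_nonneg_nonneg add_nonneg_nonneg zero_le_power2 zero_le_power zero_le_numeral)
  finally have "2 * (m * I2 - I1\<^sup>2) \<le> 2 ^ DIM('a) * D\<^sup>2 * (m + m) * j"
    unfolding pv using nn by (subst (asm) ennreal_le_iff) auto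
  then have key: "m * I2 \<le> I1\<^sup>2 + m * (2 ^ DIM('a) * D\<^sup>2 * j)" by (simp add: algebra_simps)
  have "I2 \<le> I1\<^sup>2 / m + 2 ^ DIM('a) * D\<^sup>2 * j"
  proof (cases "m = 0")
    case True
    then have "emeasure lborel Q = 0" using fin by (auto simp: m_def measure_def enn2real_eq_0_iff)
    then have "AE x in lborel. x \<notin> Q" by (intro AE_not_in) (simp add: null_sets_def)
    then have "I2 = (\<integral>x. 0 \<partial>(lborel :: 'a measure))" unfolding I2_def
      by (intro integral_cong_AE) (auto elim!: eventually_mono)
    then show ?thesis using nn by simp
  next
    case False
    then have "m > 0" using nn by simp
    then show ?thesis using key by (simp add: field_simps)
  qed
  then show ?thesis by (simp add: I1_def I2_def m_def j_def D_def)
qed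

text \<open>On the cells, \<open>\<bar>w\<bar> \<le> \<eta> + w\<^sup>2 / \<eta>\<close> and the cell inequality bounds the integral of \<open>w\<^sup>2\<close>; on the part of
  \<open>\<Omega>\<close> that no cell covers, \<open>\<bar>w\<bar> \<le> 1 / \<eta> + \<eta> w\<^sup>2\<close> makes its small measure count.\<close>

lemma L1_grid_estimate:
  fixes \<Omega> :: "'a::euclidean_space set"
  assumes \<Omega>: "open \<Omega>" "bounded \<Omega>" and wg: "borel_weak_gradient \<Omega> w J" and c: "c > 0" and \<eta>: "\<eta> > 0"
    and iw: "integrable lborel (\<lambda>x. (w x)\<^sup>2)" and iJ: "integrable lborel (\<lambda>x. (norm (J x))\<^sup>2)"
  shows "(\<integral>x. \<bar>w x\<bar> \<partial>lborel) \<le> \<eta> * (measure lborel \<Omega> + (\<integral>x. (w x)\<^sup>2 \<partial>lborel)) +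
    (measure lborel (\<Omega> - \<Union>(grid_cells c \<Omega>))
        + (\<Sum>Q\<in>grid_cells c \<Omega>. (\<integral>x. indicator Q x * w x \<partial>lborel)\<^sup>2 / measure lborel Q)
     + 2 ^ DIM('a) * (DIM('a) / c)\<^sup>2 * (\<integral>x. (norm (J x))\<^sup>2 \<partial>lborel)) / \<eta>"
proof -
  let ?C = "grid_cells c \<Omega>"
  define V where "V = \<Union>?C"
  have fC: "finite ?C" by (rule finite_grid_cells[OF \<Omega>(2) c])
  have bC: "Q \<in> sets borel" if "Q \<in> ?C" for Q using that grid_cell_borel by (auto simp: grid_cells_def)
  have [measurable]: "V \<in> sets borel" unfolding V_def using fC bC by (intro sets.finite_Union) auto
  have [measurable]: "\<Omega> \<in> sets borel" using \<Omega>(1) by simp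
  have [measurable]: "w \<in> borel_measurable borel" "J \<in> borel_measurable borel" using wg by
      (auto simp: borel_weak_gradient_def)
  have out: "w x = 0" if "x \<notin> \<Omega>" for x using wg that by (auto simp: borel_weak_gradient_def)
  have fin: "emeasure lborel \<Omega> < \<infinity>" using \<Omega>(2) by (rule emeasure_bounded_finite)
  have "emeasure lborel (\<Omega> - V) \<le> emeasure lborel \<Omega>" by (intro emeasure_mono) auto
  then have fin': "emeasure lborel (\<Omega> - V) < \<infinity>" using fin by (rule le_less_trans)
  have ii: "integrable lborel (indicator \<Omega> :: 'a \<Rightarrow> real)" "integrable lborel (indicator (\<Omega> - V) :: 'a \<Rightarrow> real)"
    using fin fin' by auto
  have iQ: "integrable lborel (\<lambda>x. indicator Q x * (w x)\<^sup>2)"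
      "integrable lborel (\<lambda>x. indicator Q x * (norm (J x))\<^sup>2)"
    if "Q \<in> ?C" for Q
    using integrable_mult_indicator[OF _ iw, of Q] integrable_mult_indicator[OF _ iJ, of Q] bC[OF that]
        by simp_all
  have pw: "\<bar>w x\<bar> \<le> \<eta> * indicator \<Omega> x + (\<Sum>Q\<in>?C. indicator Q x * (w x)\<^sup>2) / \<eta> + \<eta> * (w x)\<^sup>2
      + indicator (\<Omega> - V) x / \<eta>" for x
  proof -
    have s0: "0 \<le> (\<Sum>Q\<in>?C. indicator Q x * (w x)\<^sup>2)" by (intro sum_nonneg) auto
    consider "x \<notin> \<Omega>" | "x \<in> V" "x \<in> \<Omega>" | "x \<in> \<Omega> - V" by blast
    then show ?thesis
    proof cases
      case 1
      then show ?thesis using out s0 \<eta> by simp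
    next
      case 2
      then obtain Q where Q: "Q \<in> ?C" "x \<in> Q" by (auto simp: V_def)
      have "(w x)\<^sup>2 = indicator Q x * (w x)\<^sup>2" using Q by simp
      also have "\<dots> \<le> (\<Sum>Q\<in>?C. indicator Q x * (w x)\<^sup>2)"
        by (rule member_le_sum[OF Q(1) _ fC]) auto
      finally have "(w x)\<^sup>2 / \<eta> \<le> (\<Sum>Q\<in>?C. indicator Q x * (w x)\<^sup>2) / \<eta>" using \<eta> by (simp add: divide_right_mono)
      moreover have "\<bar>w x\<bar> \<le> \<eta> + (w x)\<^sup>2 / \<eta>" using le_eta_plus_square_div[of "\<bar>w x\<bar>" \<eta>] \<eta> by simp
      moreover have "0 \<le> \<eta> * (w x)\<^sup>2" using \<eta> by simp
      ultimately show ?thesis using 2 by simp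
    next
      case 3
      have "\<bar>w x\<bar> \<le> 1 / \<eta> + (w x)\<^sup>2 * \<eta>" using le_eta_plus_square_div[of "\<bar>w x\<bar>" "1 / \<eta>"] \<eta> by simp
      moreover have "0 \<le> (\<Sum>Q\<in>?C. indicator Q x * (w x)\<^sup>2) / \<eta>" using s0 \<eta> by simp
      ultimately show ?thesis using 3 \<eta> by (simp add: mult.commute)
    qed
  qed
  have iR: "integrable lborel (\<lambda>x. \<eta> * indicator \<Omega> x + (\<Sum>Q\<in>?C. indicator Q x * (w x)\<^sup>2) / \<eta> + \<eta> * (w x)\<^sup>2
      + indicator (\<Omega> - V) x / \<eta>)"
    using ii iQ(1) iw by auto
  have iabs: "integrable lborel (\<lambda>x. \<bar>w x\<bar>)"
    by (rule Bochner_Integration.integrable_bound[OF iR]) (use pw in \<open>auto intro!: AE_I2 order.trans[OF pw abs_ge_self]\<close>)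
  have "(\<integral>x. \<bar>w x\<bar> \<partial>lborel) \<le> (\<integral>x. \<eta> * indicator \<Omega> x + (\<Sum>Q\<in>?C. indicator Q x * (w x)\<^sup>2) / \<eta> + \<eta> * (w x)\<^sup>2
      + indicator (\<Omega> - V) x / \<eta> \<partial>lborel)"
    by (intro integral_mono iabs iR pw)
  also have "\<dots> = \<eta> * measure lborel \<Omega> + (\<Sum>Q\<in>?C. \<integral>x. indicator Q x * (w x)\<^sup>2 \<partial>lborel) / \<eta> + \<eta>
      * (\<integral>x. (w x)\<^sup>2 \<partial>lborel) + measure lborel (\<Omega> - V) / \<eta>"
    using ii iQ(1) iw by (simp add: Bochner_Integration.integral_sum)
  finally have 1: "(\<integral>x. \<bar>w x\<bar> \<partial>lborel) \<le> \<eta> * measure lborel \<Omega> + (\<Sum>Q\<in>?C. \<integral>x. indicator Q x * (w x)\<^sup>2 \<partial>lborel) / \<eta>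
      + \<eta> * (\<integral>x. (w x)\<^sup>2 \<partial>lborel) + measure lborel (\<Omega> - V) / \<eta>" .
  define \<kappa> where "\<kappa> = 2 ^ DIM('a) * (DIM('a) / c)\<^sup>2"
  have \<kappa>: "\<kappa> \<ge> 0" by (simp add: \<kappa>_def)
  have "(\<Sum>Q\<in>?C. \<integral>x. indicator Q x * (w x)\<^sup>2 \<partial>lborel)
      \<le> (\<Sum>Q\<in>?C. (\<integral>x. indicator Q x * w x \<partial>lborel)\<^sup>2 / measure lborel Q + \<kappa>
      * (\<integral>x. indicator Q x * (norm (J x))\<^sup>2 \<partial>lborel))"
    unfolding \<kappa>_def by (intro sum_mono grid_cell_poincare[OF \<Omega> wg _ c iw iJ])
  also have "\<dots> = (\<Sum>Q\<in>?C. (\<integral>x. indicator Q x * w x \<partial>lborel)\<^sup>2 / measure lborel Q) + \<kappa>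
      * (\<integral>x. (\<Sum>Q\<in>?C. indicator Q x * (norm (J x))\<^sup>2) \<partial>lborel)"
    using iQ(2) by (simp add: sum.distrib sum_distrib_left Bochner_Integration.integral_sum)
  finally have 3: "(\<Sum>Q\<in>?C. \<integral>x. indicator Q x * (w x)\<^sup>2 \<partial>lborel)
      \<le> (\<Sum>Q\<in>?C. (\<integral>x. indicator Q x * w x \<partial>lborel)\<^sup>2 / measure lborel Q) + \<kappa>
      * (\<integral>x. (\<Sum>Q\<in>?C. indicator Q x * (norm (J x))\<^sup>2) \<partial>lborel)" .
  have 4: "(\<integral>x. (\<Sum>Q\<in>?C. indicator Q x * (norm (J x))\<^sup>2) \<partial>lborel) \<le> (\<integral>x. (norm (J x))\<^sup>2 \<partial>lborel)"
  proof (intro integral_mono)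
    show "integrable lborel (\<lambda>x. \<Sum>Q\<in>?C. indicator Q x * (norm (J x))\<^sup>2)" using iQ(2) by auto
    fix x
    have "(\<Sum>Q\<in>?C. indicator Q x :: real) \<le> 1"
    proof (cases "\<exists>Q\<in>?C. x \<in> Q")
      case True
      then obtain Q where Q: "Q \<in> ?C" "x \<in> Q" by blast
      have "(\<Sum>Q'\<in>?C. indicator Q' x :: real) = (\<Sum>Q'\<in>{Q}. indicator Q' x)"
      proof (rule sum.mono_neutral_right[OF fC])
        show "{Q} \<subseteq> ?C" using Q(1) by simp
        show "\<forall>Q'\<in>?C - {Q}. indicator Q' x = (0::real)"
          using grid_cells_disjoint[OF Q(1) _ Q(2)] by (force simp: indicator_def)
      qed
      then show ?thesis using Q by simp
    next
      case False
      then have "(\<Sum>Q'\<in>?C. indicator Q' x :: real) = 0" by (intro sum.neutral) auto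
      then show ?thesis by simp
    qed
    then have "(\<Sum>Q\<in>?C. indicator Q x) * (norm (J x))\<^sup>2 \<le> 1 * (norm (J x))\<^sup>2" by (rule mult_right_mono) simp
    then show "(\<Sum>Q\<in>?C. indicator Q x * (norm (J x))\<^sup>2) \<le> (norm (J x))\<^sup>2" by (simp add: sum_distrib_right)
  qed (rule iJ)
  have 2: "(\<Sum>Q\<in>?C. \<integral>x. indicator Q x * (w x)\<^sup>2 \<partial>lborel) \<le>
     (\<Sum>Q\<in>?C. (\<integral>x. indicator Q x * w x \<partial>lborel)\<^sup>2 / measure lborel Q) + \<kappa> * (\<integral>x. (norm (J x))\<^sup>2 \<partial>lborel)"
    using 3 mult_left_mono[OF 4 \<kappa>] by linarith
  have "(\<Sum>Q\<in>?C. \<integral>x. indicator Q x * (w x)\<^sup>2 \<partial>lborel) / \<eta> \<le>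
     ((\<Sum>Q\<in>?C. (\<integral>x. indicator Q x * w x \<partial>lborel)\<^sup>2 / measure lborel Q) + \<kappa> * (\<integral>x. (norm (J x))\<^sup>2 \<partial>lborel)) / \<eta>"
    using 2 \<eta> by (simp add: divide_right_mono)
  with 1 show ?thesis
    by (simp add: V_def \<kappa>_def add_divide_distrib distrib_left)
qed


lemma integrable_lebesgue_on_iff_lborel:
  fixes f :: "'a::euclidean_space \<Rightarrow> 'b::{banach, second_countable_topology}"
  assumes "open \<Omega>" "f \<in> borel_measurable borel" "\<And>x. x \<notin> \<Omega> \<Longrightarrow> f x = 0"
  shows "integrable (lebesgue_on \<Omega>) f \<longleftrightarrow> integrable lborel f"
proof -
  have "integrable (lebesgue_on \<Omega>) f \<longleftrightarrow> integrable lebesgue (\<lambda>x. indicator \<Omega> x *\<^sub>R f x)"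
    using assms(1) by (subst integrable_restrict_space) auto
  also have "(\<lambda>x. indicator \<Omega> x *\<^sub>R f x) = f" using assms(3) by (auto simp: indicator_def)
  finally show ?thesis using assms(2) by (simp add: integrable_completion)
qed

lemma has_weak_gradient_diff:
  assumes "open \<Omega>" "has_weak_gradient \<Omega> u G" "has_weak_gradient \<Omega> v H"
  shows "has_weak_gradient \<Omega> (\<lambda>x. u x - v x) (\<lambda>x. G x - H x)"
  using has_weak_gradient_linear_combination[of \<Omega> "UNIV :: bool set" "\<lambda>b. if b then u else v" "\<lambda>b.
      if b then G else H" "\<lambda>b. if b then 1 else - 1"] assms
  by (simp add: UNIV_bool)

lemma square_integral_borel_version:
  fixes f g :: "'a::euclidean_space \<Rightarrow> 'b::euclidean_space"
  assumes \<Omega>: "open \<Omega>" and f: "f \<in> borel_measurable (lebesgue_on \<Omega>)"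
    and g: "g \<in> borel_measurable borel" "\<And>x. x \<notin> \<Omega> \<Longrightarrow> g x = 0" "AE x in lebesgue_on \<Omega>. f x = g x"
    and int: "integrable (lebesgue_on \<Omega>) (\<lambda>x. (norm (f x))\<^sup>2)"
  shows "integrable lborel (\<lambda>x. (norm (g x))\<^sup>2)"
    and "(\<integral>x. (norm (g x))\<^sup>2 \<partial>lborel) = (\<integral>x. (norm (f x))\<^sup>2 \<partial>lebesgue_on \<Omega>)"
proof -
  have [measurable]: "g \<in> borel_measurable (lebesgue_on \<Omega>)" "f \<in> borel_measurable (lebesgue_on \<Omega>)"
    using f g(1) by (auto simp: measurable_restrict_space1 measurable_completion)
  have ae: "AE x in lebesgue_on \<Omega>. (norm (f x))\<^sup>2 = (norm (g x))\<^sup>2" using g(3) by eventually_elim simp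
  have "integrable (lebesgue_on \<Omega>) (\<lambda>x. (norm (g x))\<^sup>2)"
    using int integrable_cong_AE[OF _ _ ae] by simp
  then show "integrable lborel (\<lambda>x. (norm (g x))\<^sup>2)"
    using integrable_lebesgue_on_iff_lborel[OF \<Omega>, of "\<lambda>x. (norm (g x))\<^sup>2"] g(1,2) by simp
  have "(\<integral>x. (norm (g x))\<^sup>2 \<partial>lborel) = (\<integral>x. (norm (g x))\<^sup>2 \<partial>lebesgue_on \<Omega>)"
    using integral_lebesgue_on_eq_lborel[OF \<Omega>, of "\<lambda>x. (norm (g x))\<^sup>2"] g(1,2) by simp
  also have "\<dots> = (\<integral>x. (norm (f x))\<^sup>2 \<partial>lebesgue_on \<Omega>)"
    by (rule integral_cong_AE[symmetric, OF _ _ ae]) measurable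
  finally show "(\<integral>x. (norm (g x))\<^sup>2 \<partial>lborel) = (\<integral>x. (norm (f x))\<^sup>2 \<partial>lebesgue_on \<Omega>)" .
qed

text \<open>A diagonal subsequence makes the integrals over all cells of all grids converge. For a difference of
  two members the estimate on a grid has three error terms: choose first \<open>\<eta>\<close>, then the grid, then the
  index beyond which the finitely many integrals over cells of this grid are close.\<close>

theorem rellich:
  fixes \<Omega> :: "'a::euclidean_space set" and u :: "nat \<Rightarrow> 'a \<Rightarrow> real"
  assumes \<Omega>: "open \<Omega>" "bounded \<Omega>" and wg: "\<And>n. has_weak_gradient \<Omega> (u n) (G n)"
    and iu: "\<And>n. integrable (lebesgue_on \<Omega>) (\<lambda>x. (u n x)\<^sup>2)" and iG:
        "\<And>n. integrable (lebesgue_on \<Omega>) (\<lambda>x. (norm (G n x))\<^sup>2)"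
    and bu: "\<And>n. (\<integral>x. (u n x)\<^sup>2 \<partial>lebesgue_on \<Omega>) \<le> K" and bG: "\<And>n. (\<integral>x. (norm (G n x))\<^sup>2 \<partial>lebesgue_on \<Omega>) \<le> K"
  obtains r :: "nat \<Rightarrow> nat" where "strict_mono r"
    "\<And>e. e > 0 \<Longrightarrow> \<exists>N. \<forall>i\<ge>N. \<forall>j\<ge>N. (\<integral>x. norm (u (r i) x - u (r j) x) \<partial>lebesgue_on \<Omega>) < e"
proof -
  have \<Omega>m: "\<Omega> \<in> sets lebesgue" using \<Omega>(1) by simp
  have [measurable]: "\<Omega> \<in> sets borel" using \<Omega>(1) by simp
  have fin: "emeasure lborel \<Omega> < \<infinity>" using \<Omega>(2) by (rule emeasure_bounded_finite)
  have mu [measurable]: "u n \<in> borel_measurable (lebesgue_on \<Omega>)" and mG [measurable]: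
      "G n \<in> borel_measurable (lebesgue_on \<Omega>)" for n
    using wg[of n] by (auto simp: has_weak_gradient_def intro: locally_integrable_measurable[OF \<Omega>(1)])
  have "\<exists>U. U \<in> borel_measurable borel \<and> (\<forall>x. x \<notin> \<Omega> \<longrightarrow> U x = 0) \<and> (AE x in lebesgue_on \<Omega>. u n x = U x)" for n
    by (rule lebesgue_on_borel_version[OF \<Omega>(1) mu]) blast
  then obtain U where U: "\<And>n. U n \<in> borel_measurable borel" "\<And>n x. x \<notin> \<Omega> \<Longrightarrow> U n x = 0"
      "\<And>n. AE x in lebesgue_on \<Omega>. u n x = U n x"
    by metis
  have "\<exists>H. H \<in> borel_measurable borel \<and> (\<forall>x. x \<notin> \<Omega> \<longrightarrow> H x = 0) \<and> (AE x in lebesgue_on \<Omega>. G n x = H x)" for n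
    by (rule lebesgue_on_borel_version[OF \<Omega>(1) mG]) blast
  then obtain H where H: "\<And>n. H n \<in> borel_measurable borel" "\<And>n x. x \<notin> \<Omega> \<Longrightarrow> H n x = 0"
      "\<And>n. AE x in lebesgue_on \<Omega>. G n x = H n x"
    by metis
  note [measurable] = U(1) H(1)
  note U' = square_integral_borel_version[OF \<Omega>(1) mu U] and H' = square_integral_borel_version[OF \<Omega>(1) mG H iG]
  have iU: "integrable lborel (\<lambda>x. (U n x)\<^sup>2)" and bU: "(\<integral>x. (U n x)\<^sup>2 \<partial>lborel) \<le> K" for n
    using U'[of n] iu[of n] bu[of n] by simp_all
  have iH: "integrable lborel (\<lambda>x. (norm (H n x))\<^sup>2)" and bH: "(\<integral>x. (norm (H n x))\<^sup>2 \<partial>lborel) \<le> K" for n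
    using H'[of n] bG[of n] by simp_all
  have "0 \<le> (\<integral>x. (U 0 x)\<^sup>2 \<partial>lborel)" by simp
  with bU[of 0] have K0: "K \<ge> 0" by linarith
  define m where "m = measure lborel \<Omega>"
  have m0: "m \<ge> 0" by (simp add: m_def)
  define \<C> where "\<C> = (\<Union>n. grid_cells (real (Suc n)) \<Omega>)"
  define a where "a = (\<lambda>n Q. \<integral>x. indicator Q x * U n x \<partial>lborel)"
  have cC: "countable \<C>" unfolding \<C>_def by (rule countable_UN)
      (simp_all add: countable_finite finite_grid_cells[OF \<Omega>(2)])
  have bC: "Q \<in> sets borel" "Q \<subseteq> \<Omega>" if "Q \<in> \<C>" for Q using that grid_cell_borel by
      (auto simp: grid_cells_def \<C>_def)
  have i1: "integrable lborel (indicator \<Omega> :: 'a \<Rightarrow> real)" using fin by auto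
  have U_le: "\<bar>U n x\<bar> \<le> indicator \<Omega> x + (U n x)\<^sup>2" for n x
    using le_eta_plus_square_div[of "\<bar>U n x\<bar>" 1] U(2) by (cases "x \<in> \<Omega>") auto
  have iU1: "integrable lborel (U n)" for n
    by (rule Bochner_Integration.integrable_bound[OF Bochner_Integration.integrable_add[OF i1 iU]])
      (use U_le in \<open>auto intro!: AE_I2 order.trans[OF U_le abs_ge_self]\<close>)
  have iQU: "integrable lborel (\<lambda>x. indicator Q x * U n x)" if "Q \<in> \<C>" for Q n
    using integrable_mult_indicator[OF _ iU1, of Q n] bC[OF that] by simp
  have "norm (a n Q) \<le> m + K" if "Q \<in> \<C>" for n Q
  proof -
    have "norm (a n Q) \<le> (\<integral>x. norm (indicator Q x * U n x) \<partial>lborel)" unfolding a_def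
        by (rule integral_norm_bound)
    also have "\<dots> \<le> (\<integral>x. indicator \<Omega> x + (U n x)\<^sup>2 \<partial>lborel)"
    proof (rule integral_mono)
      show "integrable lborel (\<lambda>x. norm (indicator Q x * U n x))" using iQU[OF that] by (rule integrable_norm)
      show "integrable lborel (\<lambda>x. indicator \<Omega> x + (U n x)\<^sup>2)" using i1 iU
          by (rule Bochner_Integration.integrable_add)
      fix x
      have "norm (indicator Q x * U n x) \<le> \<bar>U n x\<bar>" by (simp add: indicator_def)
      then show "norm (indicator Q x * U n x) \<le> indicator \<Omega> x + (U n x)\<^sup>2" using U_le[of n x] by linarith
    qed
    also have "\<dots> = m + (\<integral>x. (U n x)\<^sup>2 \<partial>lborel)" using i1 iU by (simp add: m_def)
    finally show ?thesis using bU[of n] by simp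
  qed
  then obtain r where r: "strict_mono r" "\<And>Q. Q \<in> \<C> \<Longrightarrow> \<exists>l. (\<lambda>n. a (r n) Q) \<longlonglongrightarrow> l"
    using function_convergent_subsequence[OF cC, of a "m + K"] by metis
  have "\<exists>N. \<forall>i\<ge>N. \<forall>j\<ge>N. (\<integral>x. norm (u (r i) x - u (r j) x) \<partial>lebesgue_on \<Omega>) < e" if e: "e > 0" for e
  proof -
    \<comment> \<open>\<open>4 K\<close> bounds the squared $L^2$ norms of differences of two members; \<open>+ 1\<close> keeps the denominator positive.\<close>
    define \<eta> where "\<eta> = e / (4 * (m + 4 * K + 1))"
    have mK: "m + 4 * K + 1 > 0" using m0 K0 by linarith
    then have \<eta>: "\<eta> > 0" using e unfolding \<eta>_def by (intro divide_pos_pos mult_pos_pos) auto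
    have \<eta>e: "\<eta> * (m + 4 * K) \<le> e / 4"
    proof -
      have "\<eta> * (m + 4 * K) \<le> \<eta> * (m + 4 * K + 1)" using \<eta> by simp
      also have "\<dots> = e / 4" using mK unfolding \<eta>_def by (simp add: divide_simps)
      finally show ?thesis .
    qed
    define V where "V = (\<lambda>n. \<Union>(grid_cells (real (Suc n)) \<Omega>))"
    have [measurable]: "V n \<in> sets borel" for n
      unfolding V_def using bC finite_grid_cells[OF \<Omega>(2), of "real (Suc n)"]
      by (intro sets.finite_Union) (auto simp: \<C>_def)
    have "(\<lambda>n. \<integral>x. indicator (\<Omega> - V n) x \<partial>lborel) \<longlonglongrightarrow> (\<integral>x. 0 \<partial>(lborel :: 'a measure) :: real)"
    proof (rule integral_dominated_convergence[where w = "indicator \<Omega>"])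
      show "AE x in lborel. (\<lambda>n. indicator (\<Omega> - V n) x :: real) \<longlonglongrightarrow> 0"
      proof (rule AE_I2)
        fix x
        show "(\<lambda>n. indicator (\<Omega> - V n) x :: real) \<longlonglongrightarrow> 0"
        proof (cases "x \<in> \<Omega>")
          case True
          have "\<forall>\<^sub>F n in sequentially. 0 = (indicator (\<Omega> - V n) x :: real)"
            using grid_cells_cover_eventually[OF \<Omega>(1) True]
            by eventually_elim (simp add: V_def indicator_def)
          then show ?thesis by (rule Lim_transform_eventually[OF tendsto_const])
        qed simp
      qed
      show "AE x in lborel. norm (indicator (\<Omega> - V n) x :: real) \<le> indicator \<Omega> x" for n
        by (intro AE_I2) (auto simp: indicator_def)
    qed (use i1 in auto)
    then have V0: "(\<lambda>n. measure lborel (\<Omega> - V n)) \<longlonglongrightarrow> 0" by simp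
    have "(\<lambda>n. (2::real) ^ DIM('a) * (real DIM('a) * inverse (real (Suc n)))\<^sup>2 * (4 * K))
        \<longlonglongrightarrow> (2::real) ^ DIM('a) * (real DIM('a) * 0)\<^sup>2 * (4 * K)"
      by (intro tendsto_intros LIMSEQ_inverse_real_of_nat)
    from tendsto_add[OF V0 this]
    have "\<forall>\<^sub>F n in sequentially. measure lborel (\<Omega> - V n) + (2::real) ^ DIM('a)
        * (real DIM('a) * inverse (real (Suc n)))\<^sup>2 * (4 * K) < \<eta> * (e / 4)"
      by (rule order_tendstoD(2)) (use \<eta> e in simp)
    then obtain n where n: "measure lborel (\<Omega> - V n) + (2::real) ^ DIM('a)
        * (real DIM('a) * inverse (real (Suc n)))\<^sup>2 * (4 * K) < \<eta> * (e / 4)"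
      by (auto simp: eventually_sequentially)
    define c where "c = real (Suc n)"
    have c: "c > 0" by (simp add: c_def)
    let ?C = "grid_cells c \<Omega>"
    have fC: "finite ?C" by (rule finite_grid_cells[OF \<Omega>(2) c])
    have CC: "?C \<subseteq> \<C>" by (auto simp: \<C>_def c_def)
    define S where "S = (\<Sum>Q\<in>?C. 1 / measure lborel Q)"
    have S0: "S \<ge> 0" unfolding S_def by (intro sum_nonneg) auto
    define \<delta> where "\<delta> = min 1 (\<eta> * (e / 4) / (S + 1))"
    have \<delta>: "\<delta> > 0" using \<eta> e S0 by (simp add: \<delta>_def)
    have \<delta>S: "\<delta>\<^sup>2 * S \<le> \<eta> * (e / 4)"
    proof -
      have "\<delta>\<^sup>2 * S \<le> \<delta> * 1 * S" unfolding power2_eq_square using \<delta> S0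
        by (intro mult_right_mono mult_left_mono) (auto simp: \<delta>_def)
      also have "\<dots> \<le> \<delta> * (S + 1)" using \<delta> by simp
      also have "\<dots> \<le> \<eta> * (e / 4) / (S + 1) * (S + 1)" using S0 by (intro mult_right_mono) (auto simp: \<delta>_def)
      also have "\<dots> = \<eta> * (e / 4)"
      proof -
        have "S + 1 \<noteq> 0" using S0 by linarith
        then show ?thesis by (simp only: times_divide_eq_left nonzero_mult_div_cancel_right not_False_eq_True)
      qed
      finally show ?thesis .
    qed
    have "\<exists>N. \<forall>i\<ge>N. \<forall>j\<ge>N. \<bar>a (r i) Q - a (r j) Q\<bar> < \<delta>" if Q: "Q \<in> ?C" for Q
    proof -
      have "Q \<in> \<C>" using CC Q by (rule subsetD)
      from r(2)[OF this] obtain l where "(\<lambda>n. a (r n) Q) \<longlonglongrightarrow> l" ..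
      then have "Cauchy (\<lambda>n. a (r n) Q)" by (rule LIMSEQ_imp_Cauchy)
      then show ?thesis using \<delta> by (auto simp: Cauchy_def dist_real_def)
    qed
    then obtain N where N: "\<And>Q i j. Q \<in> ?C \<Longrightarrow> i \<ge> N Q \<Longrightarrow> j \<ge> N Q \<Longrightarrow> \<bar>a (r i) Q - a (r j) Q\<bar> < \<delta>" by metis
    define N' where "N' = Max (insert 0 (N ` ?C))"
    have N': "N Q \<le> N'" if "Q \<in> ?C" for Q unfolding N'_def using fC that by (intro Max_ge) auto
    have "(\<integral>x. norm (u (r i) x - u (r j) x) \<partial>lebesgue_on \<Omega>) < e" if ij: "i \<ge> N'" "j \<ge> N'" for i j
    proof -
      define w where "w = (\<lambda>x. U (r i) x - U (r j) x)"
      define J where "J = (\<lambda>x. H (r i) x - H (r j) x)"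
      have [measurable]: "w \<in> borel_measurable borel" "J \<in> borel_measurable borel" by
          (simp_all add: w_def J_def)
      have aeu: "AE x in lebesgue_on \<Omega>. u (r i) x - u (r j) x = w x"
        using U(3)[of "r i"] U(3)[of "r j"] by eventually_elim (simp add: w_def)
      have aeG: "AE x in lebesgue_on \<Omega>. G (r i) x - G (r j) x = J x"
        using H(3)[of "r i"] H(3)[of "r j"] by eventually_elim (simp add: J_def)
      have wg': "borel_weak_gradient \<Omega> w J"
        by (rule borel_weak_gradientI[OF \<Omega>(1) has_weak_gradient_diff[OF \<Omega>(1) wg wg] _ _ aeu _ _ aeG])
          (auto simp: w_def J_def U(2) H(2))
      have iw: "integrable lborel (\<lambda>x. (w x)\<^sup>2)" and bw: "(\<integral>x. (w x)\<^sup>2 \<partial>lborel) \<le> 4 * K"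
        using norm_diff_square_integral(1)[of "U (r i)" lborel "U (r j)"] norm_diff_square_integral(2)[of
            "U (r i)" lborel "U (r j)" K] iU bU by (simp_all add: w_def)
      have iJ: "integrable lborel (\<lambda>x. (norm (J x))\<^sup>2)" and bJ: "(\<integral>x. (norm (J x))\<^sup>2 \<partial>lborel) \<le> 4 * K"
        using norm_diff_square_integral(1)[of "H (r i)" lborel "H (r j)"] norm_diff_square_integral(2)[of
            "H (r i)" lborel "H (r j)" K] iH bH by (simp_all add: J_def)
      have "(\<Sum>Q\<in>?C. (\<integral>x. indicator Q x * w x \<partial>lborel)\<^sup>2 / measure lborel Q)
          \<le> (\<Sum>Q\<in>?C. \<delta>\<^sup>2 * (1 / measure lborel Q))"
      proof (rule sum_mono)
        fix Q assume Q: "Q \<in> ?C"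
        have "(\<integral>x. indicator Q x * w x \<partial>lborel) = a (r i) Q - a (r j) Q"
          using iQU CC Q by (simp add: a_def w_def right_diff_distrib subset_iff)
        moreover have "\<bar>a (r i) Q - a (r j) Q\<bar> < \<delta>" using N[OF Q] N'[OF Q] ij by simp
        ultimately have "(\<integral>x. indicator Q x * w x \<partial>lborel)\<^sup>2 \<le> \<delta>\<^sup>2"
          by (metis abs_ge_zero less_imp_le power2_abs power_mono)
        then show "(\<integral>x. indicator Q x * w x \<partial>lborel)\<^sup>2 / measure lborel Q \<le> \<delta>\<^sup>2 * (1 / measure lborel Q)"
          by (simp add: divide_right_mono)
      qed
      also have "\<dots> = \<delta>\<^sup>2 * S" by (simp add: S_def sum_distrib_left)
      also have "\<dots> \<le> \<eta> * (e / 4)" by (rule \<delta>S)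
      finally have 1: "(\<Sum>Q\<in>?C. (\<integral>x. indicator Q x * w x \<partial>lborel)\<^sup>2 / measure lborel Q) \<le> \<eta> * (e / 4)" .
      have 2: "2 ^ DIM('a) * (DIM('a) / c)\<^sup>2 * (\<integral>x. (norm (J x))\<^sup>2 \<partial>lborel)
          \<le> (2::real) ^ DIM('a) * (real DIM('a) * inverse (real (Suc n)))\<^sup>2 * (4 * K)"
        unfolding c_def divide_inverse by (rule mult_left_mono[OF bJ]) simp
      have half: "\<eta> * (e / 4) + \<eta> * (e / 4) = \<eta> * (e / 2)" by simp
      have "measure lborel (\<Omega> - \<Union>?C) = measure lborel (\<Omega> - V n)" by (simp add: V_def c_def)
      with 1 2 n have 3: "measure lborel (\<Omega> - \<Union>?C)
          + (\<Sum>Q\<in>?C. (\<integral>x. indicator Q x * w x \<partial>lborel)\<^sup>2 / measure lborel Q)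
         + 2 ^ DIM('a) * (DIM('a) / c)\<^sup>2 * (\<integral>x. (norm (J x))\<^sup>2 \<partial>lborel) < \<eta> * (e / 2)"
        using half by linarith
      have "(\<integral>x. norm (u (r i) x - u (r j) x) \<partial>lebesgue_on \<Omega>) = (\<integral>x. \<bar>w x\<bar> \<partial>lebesgue_on \<Omega>)"
      proof (rule integral_cong_AE)
        show "AE x in lebesgue_on \<Omega>. norm (u (r i) x - u (r j) x) = \<bar>w x\<bar>" using aeu by eventually_elim simp
        show "(\<lambda>x. \<bar>w x\<bar>) \<in> borel_measurable (lebesgue_on \<Omega>)"
          by (rule measurable_restrict_space1, rule measurable_completion) measurable
      qed measurable
      also have "\<dots> = (\<integral>x. \<bar>w x\<bar> \<partial>lborel)"
        by (rule integral_lebesgue_on_eq_lborel[OF \<Omega>(1)]) (auto simp: w_def U(2))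
      also have "\<dots> \<le> \<eta> * (m + (\<integral>x. (w x)\<^sup>2 \<partial>lborel)) +
        (measure lborel (\<Omega> - \<Union>?C) + (\<Sum>Q\<in>?C. (\<integral>x. indicator Q x * w x \<partial>lborel)\<^sup>2 / measure lborel Q)
         + 2 ^ DIM('a) * (DIM('a) / c)\<^sup>2 * (\<integral>x. (norm (J x))\<^sup>2 \<partial>lborel)) / \<eta>"
        unfolding m_def by (rule L1_grid_estimate[OF \<Omega> wg' c \<eta> iw iJ])
      also have "\<dots> < \<eta> * (m + 4 * K) + \<eta> * (e / 2) / \<eta>"
        using 3 bw \<eta> by (intro add_le_less_mono mult_left_mono divide_strict_right_mono) auto
      also have "\<eta> * (e / 2) / \<eta> = e / 2" using \<eta> by simp
      finally show ?thesis using \<eta>e e by simp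
    qed
    then show ?thesis by blast
  qed
  then show ?thesis using that[OF r(1)] by blast
qed

section \<open>Convex combinations of tails\<close>

lemma (in finite_measure) square_integrable_sum:
  fixes F :: "'i \<Rightarrow> 'a \<Rightarrow> 'b::euclidean_space"
  assumes "finite I" "\<And>i. i \<in> I \<Longrightarrow> F i \<in> borel_measurable M" "\<And>i. i \<in> I \<Longrightarrow> integrable M (\<lambda>x. (norm (F i x))\<^sup>2)"
  shows "integrable M (\<lambda>x. (norm (\<Sum>i\<in>I. c i *\<^sub>R F i x))\<^sup>2)"
  using assms
proof (induction I)
  case (insert j I)
  let ?S = "\<lambda>x. \<Sum>i\<in>I. c i *\<^sub>R F i x"
  have [measurable]: "F j \<in> borel_measurable M" "?S \<in> borel_measurable M" using insert by auto
  have i: "integrable M (\<lambda>x. 2 * (\<bar>c j\<bar> * norm (F j x))\<^sup>2 + 2 * (norm (?S x))\<^sup>2)"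
    using insert by (auto simp: power_mult_distrib)
  have "integrable M (\<lambda>x. (norm (c j *\<^sub>R F j x + ?S x))\<^sup>2)"
  proof (rule Bochner_Integration.integrable_bound[OF i])
    show "AE x in M. norm ((norm (c j *\<^sub>R F j x + ?S x))\<^sup>2)
        \<le> norm (2 * (\<bar>c j\<bar> * norm (F j x))\<^sup>2 + 2 * (norm (?S x))\<^sup>2)"
    proof (rule AE_I2)
      fix x
      show "norm ((norm (c j *\<^sub>R F j x + ?S x))\<^sup>2) \<le> norm (2 * (\<bar>c j\<bar> * norm (F j x))\<^sup>2 + 2 * (norm (?S x))\<^sup>2)"
        using norm_diff_square_le[of "c j *\<^sub>R F j x" "- ?S x"] by simp
    qed
  qed measurable
  then show ?case using insert by simp
qed simp

text \<open>Weights of the convex combinations of the members with index at least \<open>N\<close>; \<open>p\<close> bounds the support,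
  so that the combination is a finite sum.\<close>

definition tail_weights :: "nat \<Rightarrow> (nat \<times> (nat \<Rightarrow> real)) set" where
  "tail_weights N = {(p, c). (\<forall>k. 0 \<le> c k) \<and> (\<forall>k. k < N \<or> p \<le> k \<longrightarrow> c k = 0) \<and> (\<Sum>k<p. c k) = 1}"

lemma tail_weights_sum:
  fixes f :: "nat \<Rightarrow> 'b::real_vector"
  assumes "(p, c) \<in> tail_weights N" "p \<le> p'"
  shows "(\<Sum>k<p'. c k *\<^sub>R f k) = (\<Sum>k<p. c k *\<^sub>R f k)"
  using assms by (intro sum.mono_neutral_right) (auto simp: tail_weights_def)

lemma tail_weights_midpoint:
  assumes 1: "(p, c) \<in> tail_weights N" and 2: "(p', c') \<in> tail_weights N'" and N: "N \<le> N'"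
  shows "(max p p', \<lambda>k. (c k + c' k) / 2) \<in> tail_weights N"
proof -
  have "(\<Sum>k<max p p'. c k *\<^sub>R (1::real)) = 1" "(\<Sum>k<max p p'. c' k *\<^sub>R (1::real)) = 1"
    using tail_weights_sum[OF 1, of "max p p'" "\<lambda>_. 1 :: real"] tail_weights_sum[OF 2, of "max p p'"
        "\<lambda>_. 1 :: real"] 1 2
    by (auto simp: tail_weights_def)
  then have "(\<Sum>k<max p p'. (c k + c' k) / 2) = 1"
    by (simp add: sum.distrib flip: sum_divide_distrib)
  then show ?thesis using 1 2 N by (auto simp: tail_weights_def)
qed

text \<open>Let \<open>\<alpha> N\<close> be the infimum of the squared norms over convex combinations of the members from \<open>N\<close> on.
  It increases with \<open>N\<close> and stays below \<open>l\<close>, hence converges. Almost minimal combinations are close to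
  each other by the parallelogram law, because their midpoint does not beat the infimum.\<close>

lemma (in finite_measure) mazur_minimal_norm:
  fixes F :: "nat \<Rightarrow> 'a \<Rightarrow> 'b::euclidean_space"
  assumes meas [measurable]: "\<And>n. F n \<in> borel_measurable M" and int: "\<And>n. integrable M (\<lambda>x. (norm (F n x))\<^sup>2)"
    and lim: "(\<lambda>n. \<integral>x. (norm (F n x))\<^sup>2 \<partial>M) \<longlonglongrightarrow> l"
  obtains p c H where "\<And>N. (p N, c N) \<in> tail_weights N"
    "integrable M H" "(\<lambda>N. \<integral>x. norm ((\<Sum>k<p N. c N k *\<^sub>R F k x) - H x) \<partial>M) \<longlonglongrightarrow> 0"
    "integrable M (\<lambda>x. (norm (H x))\<^sup>2)" "(\<integral>x. (norm (H x))\<^sup>2 \<partial>M) \<le> l"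
proof -
  define S where "S = (\<lambda>(p, c) x. \<Sum>k<p. c k *\<^sub>R F k x)"
  define q where "q = (\<lambda>w. \<integral>x. (norm (S w x))\<^sup>2 \<partial>M)"
  have Sm [measurable]: "S w \<in> borel_measurable M" for w by (cases w) (simp add: S_def)
  have Si: "integrable M (\<lambda>x. (norm (S w x))\<^sup>2)" for w
    by (cases w) (auto simp: S_def intro: square_integrable_sum int)
  have q0: "0 \<le> q w" for w by (simp add: q_def)
  define e where "e = (\<lambda>n::nat. (Suc n, \<lambda>k. if k = n then 1 else 0 :: real))"
  have e: "e n \<in> tail_weights N" if "N \<le> n" for n N using that by (auto simp: e_def tail_weights_def)
  have qe: "q (e n) = (\<integral>x. (norm (F n x))\<^sup>2 \<partial>M)" for n by
      (simp add: q_def S_def e_def if_distrib[of "\<lambda>c. c *\<^sub>R _"] cong: if_cong)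
  define \<alpha> where "\<alpha> = (\<lambda>N. Inf (q ` tail_weights N))"
  have bb: "bdd_below (q ` tail_weights N)" for N using q0 by (auto intro!: bdd_belowI)
  have \<alpha>_le: "\<alpha> N \<le> q w" if "w \<in> tail_weights N" for w N
    unfolding \<alpha>_def using that bb by (intro cInf_lower) auto
  have ne: "q ` tail_weights N \<noteq> {}" for N using e[of N N] by auto
  have mono: "\<alpha> N \<le> \<alpha> N'" if "N \<le> N'" for N N'
    unfolding \<alpha>_def by (rule cInf_superset_mono[OF ne bb], rule image_mono) (use that in \<open>auto simp: tail_weights_def\<close>)
  have \<alpha>l: "\<alpha> N \<le> l" for N
    using lim by (rule LIMSEQ_le_const) (use \<alpha>_le[OF e] qe in \<open>auto intro!: exI[of _ N]\<close>)
  have "\<exists>L. \<alpha> \<longlonglongrightarrow> L \<and> (\<forall>i. \<alpha> i \<le> L)"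
    using incseq_convergent[of \<alpha> l] mono \<alpha>l by (metis incseq_def)
  then obtain L where L: "\<alpha> \<longlonglongrightarrow> L" "\<And>N. \<alpha> N \<le> L" by blast
  have Ll: "L \<le> l" using L(1) by (rule LIMSEQ_le_const2) (use \<alpha>l in auto)
  have "\<exists>w\<in>tail_weights N. q w < \<alpha> N + 1 / real (Suc N)" for N
    using cInf_lessD[OF ne, of N "\<alpha> N + 1 / real (Suc N)"] by (auto simp: \<alpha>_def)
  then obtain w where w: "\<And>N. w N \<in> tail_weights N" "\<And>N. q (w N) < \<alpha> N + 1 / real (Suc N)" by metis
  define d where "d = (\<lambda>N. 2 * (L - \<alpha> N) + 4 * inverse (real (Suc N)))"
  \<comment> \<open>The midpoint of two competitors is a competitor, so its squared norm is at least \<open>\<alpha> i\<close>.\<close>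
  have dist_le: "(\<integral>x. (norm (S (w i) x - S (w j) x))\<^sup>2 \<partial>M) \<le> d i" if ij: "i \<le> j" for i j
  proof -
    obtain p c p' c' where pc: "w i = (p, c)" "w j = (p', c')" by (metis surj_pair)
    define v where "v = (max p p', \<lambda>k. (c k + c' k) / 2)"
    have v: "v \<in> tail_weights i" unfolding v_def
        using tail_weights_midpoint[of p c i p' c' j] w(1)[of i] w(1)[of j] pc ij by simp
    have Sv: "S (w i) x + S (w j) x = 2 *\<^sub>R S v x" for x
    proof -
      have "S (w i) x = (\<Sum>k<max p p'. c k *\<^sub>R F k x)" "S (w j) x = (\<Sum>k<max p p'. c' k *\<^sub>R F k x)"
        using tail_weights_sum[of p c i "max p p'" "\<lambda>k. F k x"] tail_weights_sum[of p' c' j "max p p'"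
            "\<lambda>k. F k x"]
          w(1)[of i] w(1)[of j] by (simp_all add: pc S_def)
      moreover have "2 *\<^sub>R S v x = (\<Sum>k<max p p'. c k *\<^sub>R F k x + c' k *\<^sub>R F k x)"
        unfolding S_def v_def case_prod_conv scaleR_sum_right
      proof (rule sum.cong[OF refl])
        fix k
        have "2 * ((c k + c' k) / 2) = c k + c' k" by simp
        then show "2 *\<^sub>R ((c k + c' k) / 2) *\<^sub>R F k x = c k *\<^sub>R F k x + c' k *\<^sub>R F k x"
          by (simp only: scaleR_scaleR scaleR_add_left)
      qed
      ultimately show ?thesis by (simp add: sum.distrib)
    qed
    have pl: "(norm (S (w i) x - S (w j) x))\<^sup>2
        = 2 * (norm (S (w i) x))\<^sup>2 + 2 * (norm (S (w j) x))\<^sup>2 - 4 * (norm (S v x))\<^sup>2" for x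
      using parallelogram_law[of "S (w i) x" "S (w j) x"] by (simp add: Sv power_mult_distrib)
    have "(\<integral>x. (norm (S (w i) x - S (w j) x))\<^sup>2 \<partial>M) = 2 * q (w i) + 2 * q (w j) - 4 * q v"
      unfolding pl q_def using Si by simp
    moreover have "\<alpha> i \<le> q v" by (rule \<alpha>_le[OF v])
    moreover have "q (w j) < L + 1 / real (Suc i)"
    proof -
      have "1 / real (Suc j) \<le> 1 / real (Suc i)" using ij by (simp add: field_simps)
      then show ?thesis using w(2)[of j] L(2)[of j] by linarith
    qed
    ultimately show ?thesis using w(2)[of i] by (simp add: d_def inverse_eq_divide)
  qed
  have "(\<lambda>N. 2 * (L - \<alpha> N) + 4 * inverse (real (Suc N))) \<longlonglongrightarrow> 2 * (L - L) + 4 * 0"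
    by (intro tendsto_intros L(1) LIMSEQ_inverse_real_of_nat)
  then have d0: "d \<longlonglongrightarrow> 0" by (simp add: d_def)
  have cau: "\<exists>N. \<forall>i\<ge>N. \<forall>j\<ge>N. (\<integral>x. (norm (S (w i) x - S (w j) x))\<^sup>2 \<partial>M) < \<epsilon>" if "\<epsilon> > 0" for \<epsilon>
  proof -
    have "\<forall>\<^sub>F n in sequentially. d n < \<epsilon>" using d0 that by (rule order_tendstoD(2))
    then obtain N where N: "\<And>n. n \<ge> N \<Longrightarrow> d n < \<epsilon>" by (auto simp: eventually_sequentially)
    have "(\<integral>x. (norm (S (w i) x - S (w j) x))\<^sup>2 \<partial>M) < \<epsilon>" if "i \<ge> N" "j \<ge> N" for i j
    proof (cases "i \<le> j")
      case True
      then show ?thesis using dist_le[OF True] N[OF that(1)] by simp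
    next
      case False
      then have "(\<integral>x. (norm (S (w j) x - S (w i) x))\<^sup>2 \<partial>M) \<le> d j" by (intro dist_le) simp
      then show ?thesis using N[OF that(2)] by (simp add: norm_minus_commute)
    qed
    then show ?thesis by blast
  qed
  obtain r H where H: "strict_mono r" "AE x in M. (\<lambda>i. S (w (r i)) x) \<longlonglongrightarrow> H x" "integrable M H"
    "(\<lambda>n. \<integral>x. norm (S (w n) x - H x) \<partial>M) \<longlonglongrightarrow> 0"
    by (rule L2_complete[of "\<lambda>n. S (w n)", OF Sm Si cau]) (assumption, rule that)
  have [measurable]: "H \<in> borel_measurable M" using H(3) by auto
  have sq: "(\<integral>\<^sup>+x. ennreal ((norm (H x))\<^sup>2) \<partial>M) \<le> ennreal (L + \<epsilon>)" if "\<epsilon> > 0" for \<epsilon>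
  proof (rule nn_integral_AE_limit_le)
    show "AE x in M. (\<lambda>i. ennreal ((norm (S (w (r i)) x))\<^sup>2)) \<longlonglongrightarrow> ennreal ((norm (H x))\<^sup>2)"
      using H(2) by eventually_elim (intro tendsto_intros)
    have "\<forall>\<^sub>F i in sequentially. inverse (real (Suc i)) < \<epsilon>"
      using LIMSEQ_inverse_real_of_nat that by (rule order_tendstoD(2))
    then show "\<forall>\<^sub>F i in sequentially. (\<integral>\<^sup>+x. ennreal ((norm (S (w (r i)) x))\<^sup>2) \<partial>M) \<le> ennreal (L + \<epsilon>)"
    proof eventually_elim
      case (elim i)
      have "1 / real (Suc (r i)) \<le> 1 / real (Suc i)" using seq_suble[OF H(1), of i] by (simp add: field_simps)
      then have "q (w (r i)) \<le> L + \<epsilon>" using w(2)[of "r i"] L(2)[of "r i"] elim by (simp add: inverse_eq_divide)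
      moreover have "(\<integral>\<^sup>+x. ennreal ((norm (S (w (r i)) x))\<^sup>2) \<partial>M) = ennreal (q (w (r i)))"
        unfolding q_def by (rule nn_integral_eq_integral[OF Si]) simp
      ultimately show ?case by (simp add: ennreal_leI)
    qed
  qed measurable
  have iH: "integrable M (\<lambda>x. (norm (H x))\<^sup>2)"
    by (rule integrableI_nonneg) (use le_less_trans[OF sq[of 1]] in auto)
  have "0 \<le> \<alpha> 0" unfolding \<alpha>_def by (rule cInf_greatest[OF ne]) (use q0 in auto)
  then have L0: "0 \<le> L" using L(2)[of 0] by simp
  have "(\<integral>x. (norm (H x))\<^sup>2 \<partial>M) \<le> L + \<epsilon>" if "\<epsilon> > 0" for \<epsilon>
    using sq[OF that] nn_integral_eq_integral[OF iH] L0 that by (simp add: ennreal_le_iff del: ennreal_plus)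
  then have "(\<integral>x. (norm (H x))\<^sup>2 \<partial>M) \<le> L" by (rule field_le_epsilon)
  then have Hl: "(\<integral>x. (norm (H x))\<^sup>2 \<partial>M) \<le> l" using Ll by simp
  show ?thesis
  proof (rule that[of "\<lambda>N. fst (w N)" "\<lambda>N. snd (w N)" H])
    show "(fst (w N), snd (w N)) \<in> tail_weights N" for N using w(1) by simp
    show "(\<lambda>N. \<integral>x. norm ((\<Sum>k<fst (w N). snd (w N) k *\<^sub>R F k x) - H x) \<partial>M) \<longlonglongrightarrow> 0"
      using H(4) by (simp add: S_def case_prod_beta)
  qed (use H(3) iH Hl in auto)
qed

text \<open>Convergence survives because all members from \<open>N\<close> on are uniformly close to the limit.\<close>

lemma tail_combination_L1_limit:
  fixes s :: "nat \<Rightarrow> 'a \<Rightarrow> 'b::euclidean_space"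
  assumes w: "\<And>N. (p N, c N) \<in> tail_weights N"
    and int: "\<And>n. integrable M (s n)" "integrable M F"
    and lim: "(\<lambda>n. \<integral>x. norm (s n x - F x) \<partial>M) \<longlonglongrightarrow> 0"
  shows "(\<lambda>N. \<integral>x. norm ((\<Sum>k<p N. c N k *\<^sub>R s k x) - F x) \<partial>M) \<longlonglongrightarrow> 0"
proof (rule LIMSEQ_I)
  fix e :: real assume e: "e > 0"
  define I where "I = (\<lambda>n. \<integral>x. norm (s n x - F x) \<partial>M)"
  have "\<forall>\<^sub>F n in sequentially. I n < e / 2" unfolding I_def using lim
      by (rule order_tendstoD(2)) (use e in simp)
  then obtain N0 where N0: "\<And>n. n \<ge> N0 \<Longrightarrow> I n < e / 2" by (auto simp: eventually_sequentially)
  have "norm ((\<integral>x. norm ((\<Sum>k<p N. c N k *\<^sub>R s k x) - F x) \<partial>M) - 0) < e" if N: "N \<ge> N0" for N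
  proof -
    have c: "\<And>k. 0 \<le> c N k" "\<And>k. k < N \<Longrightarrow> c N k = 0" "(\<Sum>k<p N. c N k) = 1"
      using w[of N] by (auto simp: tail_weights_def)
    have eq: "(\<Sum>k<p N. c N k *\<^sub>R s k x) - F x = (\<Sum>k<p N. c N k *\<^sub>R (s k x - F x))" for x
      using c(3) by (simp add: scaleR_diff_right sum_subtractf flip: scaleR_sum_left)
    have "(\<integral>x. norm ((\<Sum>k<p N. c N k *\<^sub>R s k x) - F x) \<partial>M) \<le> (\<integral>x. (\<Sum>k<p N. c N k * norm (s k x - F x)) \<partial>M)"
      unfolding eq using int c(1)
      by (intro integral_mono) (auto intro!: order.trans[OF norm_sum] sum_mono)
    also have "\<dots> = (\<Sum>k<p N. c N k * I k)"
      using int by (subst Bochner_Integration.integral_sum) (auto simp: I_def)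
    also have "\<dots> \<le> (\<Sum>k<p N. c N k * (e / 2))"
    proof (rule sum_mono)
      fix k
      show "c N k * I k \<le> c N k * (e / 2)"
      proof (cases "k < N")
        case False
        then have "I k \<le> e / 2" using N0[of k] N by simp
        then show ?thesis using c(1) by (rule mult_left_mono)
      qed (use c(2) in simp)
    qed
    also have "\<dots> = (\<Sum>k<p N. c N k) * (e / 2)" by (simp only: sum_distrib_right)
    also have "\<dots> = e / 2" using c(3) by simp
    finally show ?thesis using e by simp
  qed
  then show "\<exists>N0. \<forall>N\<ge>N0. norm ((\<integral>x. norm ((\<Sum>k<p N. c N k *\<^sub>R s k x) - F x) \<partial>M) - 0) < e" by blast
qed

lemma finite_common_subsequence:
  assumes "finite I"
    and ex: "\<And>i r. i \<in> I \<Longrightarrow> strict_mono r \<Longrightarrow> \<exists>s::nat \<Rightarrow> nat. strict_mono s \<and> P i (r \<circ> s)"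
    and sub: "\<And>i r s. P i r \<Longrightarrow> strict_mono (s::nat \<Rightarrow> nat) \<Longrightarrow> P i (r \<circ> s)"
  shows "\<exists>r::nat \<Rightarrow> nat. strict_mono r \<and> (\<forall>i\<in>I. P i r)"
  using assms(1) ex
proof (induction I)
  case empty
  show ?case using strict_mono_id by blast
next
  case (insert j I)
  then obtain r where r: "strict_mono r" "\<forall>i\<in>I. P i r" by blast
  obtain s where s: "strict_mono s" "P j (r \<circ> s)" using insert.prems[OF _ r(1), of j] by blast
  have "P i (r \<circ> s)" if "i \<in> insert j I" for i
    using that s(2) sub[OF _ s(1), of i r] r(2) by (cases "i = j") blast+
  then show ?case using strict_mono_o[OF r(1) s(1)] by blast
qed

section \<open>Constant functions\<close>

text \<open>The integral of \<open>\<phi> (x + h) - \<phi> x\<close> vanishes by translation invariance, and by the fundamental theorem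
  of calculus and Fubini it equals the inner product of the integral of the gradient with \<open>h\<close>.\<close>

lemma integral_gradient_test_function:
  fixes \<phi> :: "'a::euclidean_space \<Rightarrow> real"
  assumes \<phi>: "\<phi> \<in> test_functions \<Omega>" "\<And>x. GDERIV \<phi> x :> g x"
  shows "(\<integral>x. g x \<partial>lborel) = 0"
proof -
  obtain g' K B where g': "\<And>x. GDERIV \<phi> x :> g' x" "continuous_on UNIV \<phi>" "continuous_on UNIV g'"
    "compact K" "\<And>x. x \<notin> K \<Longrightarrow> \<phi> x = 0" "\<And>x. x \<notin> K \<Longrightarrow> g' x = 0"
    using test_function_gradient[OF \<phi>(1)] by metis
  have "g' = g" using GDERIV_unique g'(1) \<phi>(2) by blast
  note g = g'[unfolded this]
  have [measurable]: "\<phi> \<in> borel_measurable borel" "g \<in> borel_measurable borel"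
    using g by (auto intro: borel_measurable_continuous_onI)
  obtain R where R: "\<And>x. x \<in> K \<Longrightarrow> norm x \<le> R" using compact_imp_bounded[OF g(4)] by (auto simp: bounded_iff)
  have supp: "integrable lborel f" if "continuous_on UNIV f" "\<And>x. x \<notin> K \<Longrightarrow> f x = 0" for f ::
      "'a \<Rightarrow> 'c::euclidean_space"
  proof -
    have "integrable lborel (\<lambda>x. indicator K x *\<^sub>R f x)"
      by (rule borel_integrable_compact[OF g(4) continuous_on_subset[OF that(1)]]) simp
    also have "(\<lambda>x. indicator K x *\<^sub>R f x) = f" using that(2) by (auto simp: indicator_def)
    finally show ?thesis .
  qed
  have ig: "integrable lborel g" by (rule supp[OF g(3,6)])
  have ip: "integrable lborel \<phi>" by (rule supp[OF g(2,5)])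
  have "(\<integral>x. g x \<partial>lborel) \<bullet> h = 0" for h
  proof -
    let ?S = "{0..1::real} \<times> cball (0::'a) (R + norm h)"
    have FTC: "(\<integral>t. (g (x + t *\<^sub>R h) \<bullet> h) * indicator {0..1} t \<partial>lborel) = \<phi> (x + h) - \<phi> x" for x
      by (rule test_function_FTC[OF g(1,3)])
    have "integrable lborel (\<lambda>z. indicator ?S z *\<^sub>R (g (snd z + fst z *\<^sub>R h) \<bullet> h))"
      by (rule borel_integrable_compact)
        (auto intro!: compact_Times continuous_intros continuous_on_compose2[OF g(3)])
    also have "(\<lambda>z. indicator ?S z *\<^sub>R (g (snd z + fst z *\<^sub>R h) \<bullet> h))
        = (\<lambda>(t::real, x). (g (x + t *\<^sub>R h) \<bullet> h) * indicator {0..1} t)"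
    proof (rule ext, unfold case_prod_beta)
      fix z :: "real \<times> 'a"
      obtain t x where z: "z = (t, x)" by (rule prod.exhaust)
      have "g (x + t *\<^sub>R h) = 0" if t: "0 \<le> t" "t \<le> 1" and x: "\<not> norm x \<le> R + norm h"
      proof -
        have "norm x \<le> norm (x + t *\<^sub>R h) + norm (t *\<^sub>R h)"
            using norm_triangle_ineq4[of "x + t *\<^sub>R h" "t *\<^sub>R h"] by simp
        moreover have "norm (t *\<^sub>R h) \<le> norm h" using t by (simp add: mult_left_le_one_le)
        ultimately have "\<not> norm (x + t *\<^sub>R h) \<le> R" using x by linarith
        then show ?thesis using R g(6) by blast
      qed
      then show "indicator ?S z *\<^sub>R (g (snd z + fst z *\<^sub>R h) \<bullet> h)
          = (g (snd z + fst z *\<^sub>R h) \<bullet> h) * indicator {0..1} (fst z)"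
        by (auto simp: z indicator_def)
    qed
    finally have J: "integrable (lborel \<Otimes>\<^sub>M lborel) (\<lambda>(t::real, x). (g (x + t *\<^sub>R h) \<bullet> h) * indicator {0..1} t)"
      by (simp add: lborel_prod)
    have "0 = (\<integral>x. \<phi> (x + h) - \<phi> x \<partial>lborel)"
      using ip integrable_lborel_translate[OF ip] integral_lborel_translate[of \<phi> h] by simp
    also have "\<dots> = (\<integral>x. \<integral>t. (g (x + t *\<^sub>R h) \<bullet> h) * indicator {0..1} t \<partial>lborel \<partial>lborel)" by (simp add: FTC)
    also have "\<dots> = (\<integral>t. \<integral>x. (g (x + t *\<^sub>R h) \<bullet> h) * indicator {0..1} t \<partial>lborel \<partial>lborel)"
      using lborel_pair.Fubini_integral[OF J] by simp
    also have "\<dots> = (\<integral>t. ((\<integral>x. g x \<partial>lborel) \<bullet> h) * indicator {0..1::real} t \<partial>lborel)"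
    proof (intro Bochner_Integration.integral_cong refl)
      fix t :: real
      have "(\<integral>x. g (x + t *\<^sub>R h) \<bullet> h \<partial>lborel) = (\<integral>x. g x \<bullet> h \<partial>lborel)"
        by (rule integral_lborel_translate[of "\<lambda>x. g x \<bullet> h"]) simp
      then show "(\<integral>x. (g (x + t *\<^sub>R h) \<bullet> h) * indicator {0..1} t \<partial>lborel)
          = ((\<integral>x. g x \<partial>lborel) \<bullet> h) * indicator {0..1} t"
        using ig by simp
    qed
    also have "\<dots> = (\<integral>x. g x \<partial>lborel) \<bullet> h" by simp
    finally show ?thesis by simp
  qed
  then show ?thesis by (metis inner_eq_zero_iff)
qed

lemma has_weak_gradient_const:
  fixes \<Omega> :: "'a::euclidean_space set"
  assumes "open \<Omega>" "bounded \<Omega>"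
  shows "has_weak_gradient \<Omega> (\<lambda>_. k) (\<lambda>_. 0)"
proof -
  interpret finite_measure "lebesgue_on \<Omega>"
    by (rule finite_measure_lebesgue_on_bounded) (use assms in auto)
  have "(\<integral>x. k *\<^sub>R g x \<partial>lebesgue_on \<Omega>) = 0"
    if \<phi>: "\<phi> \<in> test_functions \<Omega>" "\<And>x. GDERIV \<phi> x :> g x" for \<phi> g
  proof -
    obtain g' K where g': "\<And>x. GDERIV \<phi> x :> g' x" "continuous_on UNIV g'" "K \<subseteq> \<Omega>" "\<And>x. x \<notin> K \<Longrightarrow> g' x = 0"
      using test_function_gradient[OF \<phi>(1)] by metis
    have "g' = g" using GDERIV_unique g'(1) \<phi>(2) by blast
    note g = g'[unfolded this]
    have "(\<integral>x. g x \<partial>lebesgue_on \<Omega>) = (\<integral>x. g x \<partial>lborel)"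
      by (rule integral_lebesgue_on_eq_lborel[OF assms(1)]) (use g in \<open>auto intro: borel_measurable_continuous_onI\<close>)
    then show ?thesis using integral_gradient_test_function[OF \<phi>] by simp
  qed
  moreover have "locally_integrable \<Omega> (\<lambda>_. k)" "locally_integrable \<Omega> (\<lambda>_::'a. 0::'a)"
    by (auto intro!: integrable_imp_locally_integrable[OF assms(1)])
  ultimately show ?thesis by (auto simp: has_weak_gradient_def)
qed

section \<open>The two terms of the functional\<close>

lemma norm_vec_square: "(norm (v :: 'b::real_normed_vector ^ 'n))\<^sup>2 = (\<Sum>i\<in>UNIV. (norm (v $ i))\<^sup>2)"
  by (simp add: norm_vec_def L2_set_def sum_nonneg)

lemma borel_measurable_vec:
  fixes f :: "'a \<Rightarrow> 'b::euclidean_space ^ 'n"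
  assumes "\<And>i. (\<lambda>x. f x $ i) \<in> borel_measurable M" shows "f \<in> borel_measurable M"
  using assms by (subst borel_measurable_euclidean_space) (auto simp: Basis_vec_def inner_axis)

lemma borel_measurable_vec_component [measurable]:
  fixes f :: "'a \<Rightarrow> 'b::euclidean_space ^ 'n"
  assumes "f \<in> borel_measurable M" shows "(\<lambda>x. f x $ i) \<in> borel_measurable M"
proof -
  have "(\<lambda>v :: 'b ^ 'n. v $ i) \<in> borel_measurable borel"
    by (intro borel_measurable_continuous_onI continuous_intros)
  from measurable_compose[OF assms this] show ?thesis .
qed

text \<open>The setting of the theorem, with the probability distribution replaced by its density.\<close>

locale bounded_density =
  fixes \<Omega> :: "(real^'d) set" and \<rho> :: "real^'d \<Rightarrow> real" and a b :: real
  assumes bdd: "bounded \<Omega>" and con: "connected \<Omega>" and dom: "C1_domain \<Omega>" and ne: "\<Omega> \<noteq> {}"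
    and \<rho>_meas [measurable]: "\<rho> \<in> borel_measurable (lebesgue_on \<Omega>)"
    and a_pos: "0 < a" and \<rho>_bounds: "\<And>x. x \<in> \<Omega> \<Longrightarrow> a \<le> \<rho> x" "\<And>x. x \<in> \<Omega> \<Longrightarrow> \<rho> x \<le> b"
    and \<rho>_total: "(\<integral>x. \<rho> x \<partial>lebesgue_on \<Omega>) = 1"
begin

abbreviation "M \<equiv> lebesgue_on \<Omega>"

lemma open_domain: "open \<Omega>" using dom by (simp add: C1_domain_def)

sublocale finite_measure M
  by (rule finite_measure_lebesgue_on_bounded[OF bdd]) (use open_domain in simp)

lemma ab: "a \<le> b" using ne \<rho>_bounds order.trans by blast

lemma space_M [simp]: "space M = \<Omega>" by simp

lemma integrable_bounded_mult:
  fixes f :: "real^'d \<Rightarrow> real"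
  assumes "integrable M f" "h \<in> borel_measurable M" "\<And>x. x \<in> \<Omega> \<Longrightarrow> \<bar>h x\<bar> \<le> B"
  shows "integrable M (\<lambda>x. f x * h x)"
proof (rule Bochner_Integration.integrable_bound[OF integrable_mult_left[OF assms(1), of B]])
  show "AE x in M. norm (f x * h x) \<le> norm (f x * B)"
    using assms(3) by (intro AE_I2) (auto simp: abs_mult intro!: mult_left_mono order.trans[OF assms(3) abs_ge_self])
qed (use assms in auto)

lemma \<rho>_abs: "x \<in> \<Omega> \<Longrightarrow> \<bar>\<rho> x\<bar> \<le> b" using \<rho>_bounds[of x] a_pos by simp

lemma \<rho>_integrable: "integrable M \<rho>"
  using integrable_bounded_mult[of "\<lambda>_. 1" \<rho> b] \<rho>_abs by simp

abbreviation similarity_from :: "(real^'d \<Rightarrow> real^'m) \<Rightarrow> real^'d \<Rightarrow> real" where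
  "similarity_from T x \<equiv> \<integral>x'. 1 / (1 + (norm (T x - T x'))\<^sup>2) * \<rho> x * \<rho> x' \<partial>M"

text \<open>The argument of the logarithm, a similarity of the images of two independent points.\<close>

definition similarity :: "(real^'d \<Rightarrow> real^'m) \<Rightarrow> real" where
  "similarity T = (\<integral>x. similarity_from T x \<partial>M)"

lemma kernel_bounds: "0 \<le> 1 / (1 + (norm v)\<^sup>2)" "1 / (1 + (norm v)\<^sup>2) \<le> 1"
  by (simp_all add: divide_simps add_pos_nonneg)

lemma similarity_inner_integrable:
  fixes T :: "real^'d \<Rightarrow> real^'m"
  assumes [measurable]: "T \<in> borel_measurable M"
  shows "integrable M (\<lambda>x'. 1 / (1 + (norm (T x - T x'))\<^sup>2) * \<rho> x * \<rho> x')"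
proof -
  have "integrable M (\<lambda>x'. \<rho> x' * (1 / (1 + (norm (T x - T x'))\<^sup>2) * \<rho> x))"
  proof (rule integrable_bounded_mult[OF \<rho>_integrable, where B = "\<bar>\<rho> x\<bar>"])
    show "\<bar>1 / (1 + (norm (T x - T x'))\<^sup>2) * \<rho> x\<bar> \<le> \<bar>\<rho> x\<bar>" for x'
      using mult_right_mono[OF kernel_bounds(2)[of "T x - T x'"], of "\<bar>\<rho> x\<bar>"] kernel_bounds(1)[of "T x - T x'"]
      by (simp add: abs_mult)
  qed measurable
  then show ?thesis by (simp add: mult.commute)
qed

lemma similarity_inner_measurable:
  fixes T :: "real^'d \<Rightarrow> real^'m"
  assumes [measurable]: "T \<in> borel_measurable M"
  shows "similarity_from T \<in> borel_measurable M"
  by (rule borel_measurable_lebesgue_integral) measurable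

lemma similarity_inner_bounds:
  fixes T :: "real^'d \<Rightarrow> real^'m"
  assumes T: "T \<in> borel_measurable M" and x: "x \<in> \<Omega>"
  shows "0 \<le> (similarity_from T x)"
    "(similarity_from T x) \<le> \<rho> x"
proof -
  have pos: "0 \<le> \<rho> y" if "y \<in> \<Omega>" for y using \<rho>_bounds(1)[OF that] a_pos by simp
  show "0 \<le> (similarity_from T x)"
    using pos x kernel_bounds(1) by (intro integral_nonneg_AE AE_I2) (auto intro!: mult_nonneg_nonneg)
  have "(similarity_from T x) \<le> (\<integral>x'. \<rho> x * \<rho> x' \<partial>M)"
  proof (rule integral_mono[OF similarity_inner_integrable[OF T]])
    show "integrable M (\<lambda>x'. \<rho> x * \<rho> x')" using \<rho>_integrable by simp
    fix x' assume "x' \<in> space M"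
    then have "x' \<in> \<Omega>" by simp
    then have "1 / (1 + (norm (T x - T x'))\<^sup>2) * (\<rho> x * \<rho> x') \<le> 1 * (\<rho> x * \<rho> x')"
      by (intro mult_right_mono kernel_bounds mult_nonneg_nonneg pos x)
    then show "1 / (1 + (norm (T x - T x'))\<^sup>2) * \<rho> x * \<rho> x' \<le> \<rho> x * \<rho> x'" by simp
  qed
  then show "(similarity_from T x) \<le> \<rho> x"
    by (simp add: \<rho>_total)
qed

lemma similarity_outer_integrable:
  fixes T :: "real^'d \<Rightarrow> real^'m"
  assumes T: "T \<in> borel_measurable M"
  shows "integrable M (similarity_from T)"
proof (rule Bochner_Integration.integrable_bound[OF \<rho>_integrable similarity_inner_measurable[OF T]])
  show "AE x in M. norm (similarity_from T x) \<le> norm (\<rho> x)"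
  proof (rule AE_I2)
    fix x assume "x \<in> space M"
    then have x: "x \<in> \<Omega>" by simp
    have "0 \<le> \<rho> x" using \<rho>_bounds(1)[OF x] a_pos by simp
    with similarity_inner_bounds[OF T x]
    show "norm (similarity_from T x) \<le> norm (\<rho> x)" by simp
  qed
qed

lemma similarity_tendsto:
  fixes T :: "nat \<Rightarrow> real^'d \<Rightarrow> real^'m"
  assumes T: "\<And>n. T n \<in> borel_measurable M" and F: "F \<in> borel_measurable M"
    and lim: "AE x in M. (\<lambda>n. T n x) \<longlonglongrightarrow> F x"
  shows "(\<lambda>n. similarity (T n)) \<longlonglongrightarrow> similarity F"
  unfolding similarity_def
proof (rule integral_dominated_convergence[where w = \<rho>])
  note [measurable] = T F
  show "AE x in M. (\<lambda>n. similarity_from (T n) x)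
      \<longlonglongrightarrow> (similarity_from F x)"
    using lim
  proof eventually_elim
    case (elim x)
    show ?case
    proof (rule integral_dominated_convergence[where w = "\<lambda>x'. \<bar>\<rho> x\<bar> * \<bar>\<rho> x'\<bar>"])
      show "AE x' in M. (\<lambda>n. 1 / (1 + (norm (T n x - T n x'))\<^sup>2) * \<rho> x * \<rho> x')
          \<longlonglongrightarrow> 1 / (1 + (norm (F x - F x'))\<^sup>2) * \<rho> x * \<rho> x'"
        using lim
      proof eventually_elim
        case (elim x')
        have "1 + (norm (F x - F x'))\<^sup>2 \<noteq> 0" using zero_le_power2[of "norm (F x - F x')"] by linarith
        then show ?case using \<open>(\<lambda>n. T n x) \<longlonglongrightarrow> F x\<close> elim by (intro tendsto_intros)
      qed
      show "AE x' in M. norm (1 / (1 + (norm (T n x - T n x'))\<^sup>2) * \<rho> x * \<rho> x') \<le> \<bar>\<rho> x\<bar> * \<bar>\<rho> x'\<bar>" for n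
      proof (rule AE_I2)
        fix x'
        show "norm (1 / (1 + (norm (T n x - T n x'))\<^sup>2) * \<rho> x * \<rho> x') \<le> \<bar>\<rho> x\<bar> * \<bar>\<rho> x'\<bar>"
          using mult_right_mono[OF kernel_bounds(2)[of "T n x - T n x'"], of
              "\<bar>\<rho> x\<bar> * \<bar>\<rho> x'\<bar>"] kernel_bounds(1)[of "T n x - T n x'"]
          by (simp add: abs_mult)
      qed
      show "integrable M (\<lambda>x'. \<bar>\<rho> x\<bar> * \<bar>\<rho> x'\<bar>)" using \<rho>_integrable by simp
    qed measurable
  qed
  show "AE x in M. norm (similarity_from (T n) x) \<le> \<rho> x" for n
    using similarity_inner_bounds[OF T] by (intro AE_I2) auto
qed (use T F \<rho>_integrable similarity_inner_measurable in auto)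

text \<open>Jensen's inequality by hand: \<open>1 / (1 + r)\<close> lies above its tangent line at \<open>m\<close>, and replacing
  \<open>|T x - T x'|\<^sup>2\<close> by the larger \<open>2 |T x|\<^sup>2 + 2 |T x'|\<^sup>2\<close> separates the variables. Here \<open>m\<close> is the mean of
  this larger expression, so the linear terms cancel after integration.\<close>

lemma similarity_lower_bound:
  fixes T :: "real^'d \<Rightarrow> real^'m"
  assumes T: "T \<in> borel_measurable M" and sq: "integrable M (\<lambda>x. (norm (T x))\<^sup>2)"
  shows "1 / (1 + 4 * (\<integral>x. (norm (T x))\<^sup>2 * \<rho> x \<partial>M)) \<le> similarity T"
proof -
  define q where "q = (\<integral>x. (norm (T x))\<^sup>2 * \<rho> x \<partial>M)"
  have iq: "integrable M (\<lambda>x. (norm (T x))\<^sup>2 * \<rho> x)" by (rule integrable_bounded_mult[OF sq \<rho>_meas \<rho>_abs])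
  have pos: "0 \<le> \<rho> y" if "y \<in> \<Omega>" for y using \<rho>_bounds(1)[OF that] a_pos by simp
  have q0: "0 \<le> q" unfolding q_def using pos by (intro integral_nonneg_AE AE_I2) auto
  define m where "m = 4 * q"
  have m0: "1 + m > 0" using q0 by (simp add: m_def)
  define A where "A = 1 / (1 + m) + m / (1 + m)\<^sup>2"
  \<comment> \<open>\<open>A - B s - B t\<close> is the tangent line of \<open>r \<mapsto> 1 / (1 + r)\<close> at \<open>m\<close>, evaluated at \<open>2 s + 2 t\<close>.\<close>
  define B where "B = 2 / (1 + m)\<^sup>2"
  have AB: "A - B * q - B * q = 1 / (1 + m)"
    by (simp add: A_def B_def m_def)
  have tangent: "A - B * s - B * t \<le> 1 / (1 + r)" if "0 \<le> r" "r \<le> 2 * s + 2 * t" for r s t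
  proof -
    have "0 \<le> (r - m)\<^sup>2" by simp
    then have "(1 + m + m - r) * (1 + r) \<le> (1 + m)\<^sup>2" by (simp add: power2_eq_square algebra_simps)
    then have "(1 + m + m - r) / (1 + m)\<^sup>2 \<le> 1 / (1 + r)"
      using that(1) m0 by (simp add: divide_simps)
    moreover have "A - r / (1 + m)\<^sup>2 = (1 + m + m - r) / (1 + m)\<^sup>2"
      using m0 by (simp add: A_def power2_eq_square divide_simps)
    moreover have "r / (1 + m)\<^sup>2 \<le> B * s + B * t"
      using divide_right_mono[OF that(2), of "(1 + m)\<^sup>2"] by (simp add: B_def add_divide_distrib)
    ultimately show ?thesis by linarith
  qed
  have inner: "(A - B * q) * \<rho> x - B * ((norm (T x))\<^sup>2 * \<rho> x) \<le> (similarity_from T x)"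
    if x: "x \<in> \<Omega>" for x
  proof -
    have "(A - B * q) * \<rho> x - B * ((norm (T x))\<^sup>2 * \<rho> x)
        = \<rho> x * ((A - B * (norm (T x))\<^sup>2) * (\<integral>x'. \<rho> x' \<partial>M) - B * q)"
      by (simp add: \<rho>_total algebra_simps)
    also have "\<dots> = (\<integral>x'. \<rho> x * ((A - B * (norm (T x))\<^sup>2) * \<rho> x' - B * ((norm (T x'))\<^sup>2 * \<rho> x')) \<partial>M)"
      using iq \<rho>_integrable by (simp add: q_def)
    also have "\<dots> \<le> (similarity_from T x)"
    proof (rule integral_mono[OF _ similarity_inner_integrable[OF T]])
      show "integrable M (\<lambda>x'. \<rho> x * ((A - B * (norm (T x))\<^sup>2) * \<rho> x' - B * ((norm (T x'))\<^sup>2 * \<rho> x')))"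
        using iq \<rho>_integrable by simp
      fix x' assume "x' \<in> space M"
      then have x': "x' \<in> \<Omega>" by simp
      have "(A - B * (norm (T x))\<^sup>2 - B * (norm (T x'))\<^sup>2) * (\<rho> x * \<rho> x')
          \<le> 1 / (1 + (norm (T x - T x'))\<^sup>2) * (\<rho> x * \<rho> x')"
        using pos x x' norm_diff_square_le[of "T x" "T x'"] by (intro mult_right_mono tangent) auto
      then show "\<rho> x * ((A - B * (norm (T x))\<^sup>2) * \<rho> x' - B * ((norm (T x'))\<^sup>2 * \<rho> x'))
          \<le> 1 / (1 + (norm (T x - T x'))\<^sup>2) * \<rho> x * \<rho> x'"
        by (simp add: algebra_simps)
    qed
    finally show ?thesis .
  qed
  have "1 / (1 + m) = (\<integral>x. (A - B * q) * \<rho> x - B * ((norm (T x))\<^sup>2 * \<rho> x) \<partial>M)"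
    using iq \<rho>_integrable AB by (simp add: \<rho>_total q_def[symmetric])
  also have "\<dots> \<le> similarity T"
    unfolding similarity_def
    by (rule integral_mono[OF _ similarity_outer_integrable[OF T]]) (use iq \<rho>_integrable inner in auto)
  finally show ?thesis by (simp add: m_def q_def)
qed

definition gradient_fields :: "(real^'d \<Rightarrow> real^'m) \<Rightarrow> ('m \<Rightarrow> real^'d \<Rightarrow> real^'d) \<Rightarrow> bool" where
  "gradient_fields T G \<longleftrightarrow> (\<forall>i. has_weak_gradient \<Omega> (\<lambda>x. T x $ i) (G i) \<and> integrable M (\<lambda>x. (norm (G i x))\<^sup>2))"

definition weight :: "real^'d \<Rightarrow> real" where
  "weight x = \<rho> x powr (1 - 2 / real CARD('d))"

text \<open>The exponent is negative in dimension one and nonnegative otherwise, hence two cases.\<close>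

lemma weight_bounds: "\<exists>w0 w1. 0 < w0 \<and> (\<forall>x\<in>\<Omega>. w0 \<le> weight x \<and> weight x \<le> w1)"
proof -
  let ?e = "1 - 2 / real CARD('d)"
  have b: "0 < b" using a_pos ab by simp
  show ?thesis
  proof (cases "0 \<le> ?e")
    case True
    have "a powr ?e \<le> weight x \<and> weight x \<le> b powr ?e" if "x \<in> \<Omega>" for x
      using \<rho>_bounds[OF that] a_pos True unfolding weight_def by (auto intro!: powr_mono2)
    then show ?thesis using a_pos by (intro exI[of _ "a powr ?e"] exI[of _ "b powr ?e"]) auto
  next
    case False
    have "b powr ?e \<le> weight x \<and> weight x \<le> a powr ?e" if "x \<in> \<Omega>" for x
      using \<rho>_bounds[OF that] a_pos False unfolding weight_def by (auto intro!: powr_mono2')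
    then show ?thesis using b by (intro exI[of _ "b powr ?e"] exI[of _ "a powr ?e"]) auto
  qed
qed

lemma weight_measurable [measurable]: "weight \<in> borel_measurable M"
  unfolding weight_def[abs_def] by measurable

definition energy :: "('m::finite \<Rightarrow> real^'d \<Rightarrow> real^'d) \<Rightarrow> real" where
  "energy G = (\<integral>x. (\<Sum>i\<in>UNIV. (norm (G i x))\<^sup>2) * weight x \<partial>M)"

definition kl_constant :: "real \<Rightarrow> real" where
  "kl_constant \<kappa> = \<kappa> powr (2 / real CARD('d)) / (2 * pi * exp 1)"

lemma kl_constant_pos: "\<kappa> > 0 \<Longrightarrow> kl_constant \<kappa> > 0"
  by (simp add: kl_constant_def)

lemma gradient_fields_measurable:
  assumes "gradient_fields T G"
  shows "T \<in> borel_measurable M" "G i \<in> borel_measurable M"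
proof -
  have li: "locally_integrable \<Omega> (\<lambda>x. T x $ i)" "locally_integrable \<Omega> (G i)" for i
    using assms by (simp_all add: gradient_fields_def has_weak_gradient_def)
  show "T \<in> borel_measurable M"
    by (rule borel_measurable_vec) (rule locally_integrable_measurable[OF open_domain li(1)])
  show "G i \<in> borel_measurable M" by (rule locally_integrable_measurable[OF open_domain li(2)])
qed

lemma KL_gradient_fields:
  fixes T :: "real^'d \<Rightarrow> real^'m"
  assumes G: "gradient_fields T G"
  shows "KL \<Omega> \<rho> \<kappa> T = ereal (kl_constant \<kappa> * energy G + ln (similarity T))"
proof -
  let ?W = "\<lambda>i. weak_gradient \<Omega> (\<lambda>x. T x $ i)"
  have hG: "has_weak_gradient \<Omega> (\<lambda>x. T x $ i) (G i)" for i using G by (simp add: gradient_fields_def)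
  have hW: "has_weak_gradient \<Omega> (\<lambda>x. T x $ i) (?W i)" for i
    unfolding weak_gradient_def by (rule someI[of "has_weak_gradient \<Omega> (\<lambda>x. T x $ i)", OF hG])
  have [measurable]: "?W i \<in> borel_measurable M" "G i \<in> borel_measurable M" for i
    using hW[of i] hG[of i] by (auto simp: has_weak_gradient_def intro!: locally_integrable_measurable[OF open_domain])
  have ae: "AE x in M. ?W i x = G i x" for i by (rule weak_gradient_AE_unique[OF open_domain hW hG])
  have "AE x in M. \<forall>i\<in>UNIV. ?W i x = G i x" by (intro AE_finite_allI ae) simp
  then have "(\<integral>x. (\<Sum>i\<in>UNIV. (norm (?W i x))\<^sup>2) * \<rho> x powr (1 - 2 / real CARD('d)) \<partial>M) = energy G"
    unfolding energy_def weight_def[symmetric]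
    by (intro integral_cong_AE) (auto elim!: eventually_mono)
  moreover have "\<forall>i. \<exists>G. has_weak_gradient \<Omega> (\<lambda>x. T x $ i) G \<and> integrable M (\<lambda>x. (norm (G x))\<^sup>2)"
    using G by (auto simp: gradient_fields_def)
  ultimately show ?thesis
    unfolding KL_def similarity_def kl_constant_def by simp
qed

lemma KL_finite_gradient_fields:
  assumes "KL \<Omega> \<rho> \<kappa> T \<noteq> \<infinity>"
  obtains G where "gradient_fields T G"
proof -
  have "\<forall>i. \<exists>G. has_weak_gradient \<Omega> (\<lambda>x. T x $ i) G \<and> integrable M (\<lambda>x. (norm (G x))\<^sup>2)"
    using assms unfolding KL_def by (auto split: if_splits)
  then show ?thesis using that unfolding gradient_fields_def by metis
qed

lemma gradient_fields_translate:
  assumes "gradient_fields T G" shows "gradient_fields (\<lambda>x. T x - v) G" "similarity (\<lambda>x. T x - v)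
      = similarity T"
proof -
  have "has_weak_gradient \<Omega> (\<lambda>x. (T x - v) $ i) (G i)" for i
    using has_weak_gradient_diff[OF open_domain _ has_weak_gradient_const[OF open_domain bdd], of "\<lambda>x. T x $ i"
        "G i" "v $ i"] assms
    by (simp add: gradient_fields_def)
  then show "gradient_fields (\<lambda>x. T x - v) G" using assms by (simp add: gradient_fields_def)
qed (simp add: similarity_def)

lemma gradient_fields_const: "gradient_fields (\<lambda>_. v) (\<lambda>_ _. 0)"
  using has_weak_gradient_const[OF open_domain bdd] by (simp add: gradient_fields_def)

lemma measure_pos: "measure M \<Omega> > 0"
proof (rule ccontr)
  assume "\<not> measure M \<Omega> > 0"
  then have "measure M \<Omega> = 0" using measure_nonneg[of M \<Omega>] by linarith
  then have "emeasure M \<Omega> = 0" by (simp add: emeasure_eq_measure)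
  then have "AE x in M. False" by (intro AE_I[of _ _ \<Omega>]) (use open_domain in \<open>auto simp: sets_restrict_space\<close>)
  then have "(\<integral>x. \<rho> x \<partial>M) = (\<integral>x. 0 \<partial>M)" by (intro integral_cong_AE) auto
  then show False using \<rho>_total by simp
qed

section \<open>Coercivity\<close>

definition dirichlet :: "('m::finite \<Rightarrow> real^'d \<Rightarrow> real^'d) \<Rightarrow> real" where
  "dirichlet G = (\<Sum>i\<in>UNIV. \<integral>x. (norm (G i x))\<^sup>2 \<partial>M)"

lemma dirichlet_nonneg: "0 \<le> dirichlet G"
  by (simp add: dirichlet_def sum_nonneg)

lemma energy_integrable:
  assumes "gradient_fields T G"
  shows "integrable M (\<lambda>x. (\<Sum>i\<in>UNIV. (norm (G i x))\<^sup>2) * weight x)"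
proof -
  obtain w0 w1 where w: "0 < w0" "\<And>x. x \<in> \<Omega> \<Longrightarrow> w0 \<le> weight x" "\<And>x. x \<in> \<Omega> \<Longrightarrow> weight x \<le> w1"
    using weight_bounds by blast
  have "integrable M (\<lambda>x. \<Sum>i\<in>UNIV. (norm (G i x))\<^sup>2)" using assms by (auto simp: gradient_fields_def)
  then show ?thesis
    by (rule integrable_bounded_mult[where B = w1]) (use w in \<open>force+\<close>)
qed

lemma poincare_centred:
  obtains C where "C \<ge> 0"
    "\<And>u G. has_weak_gradient \<Omega> u G \<Longrightarrow> integrable M (\<lambda>x. (norm (G x))\<^sup>2) \<Longrightarrow> integrable M (\<lambda>x. (u x)\<^sup>2)"
    "\<And>u G. has_weak_gradient \<Omega> u G \<Longrightarrow> integrable M (\<lambda>x. (norm (G x))\<^sup>2) \<Longrightarrow> (\<integral>x. u x \<partial>M) = 0 \<Longrightarrow>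
       (\<integral>x. (u x)\<^sup>2 \<partial>M) \<le> C * (\<integral>x. (norm (G x))\<^sup>2 \<partial>M)"
proof -
  obtain C where C: "C \<ge> 0"
    "\<And>u G. has_weak_gradient \<Omega> u G \<Longrightarrow> integrable M (\<lambda>x. (norm (G x))\<^sup>2) \<Longrightarrow> integrable M (\<lambda>x. (u x)\<^sup>2)"
    "\<And>u G. has_weak_gradient \<Omega> u G \<Longrightarrow> integrable M (\<lambda>x. (norm (G x))\<^sup>2) \<Longrightarrow>
       measure M \<Omega> * (\<integral>x. (u x)\<^sup>2 \<partial>M) - (\<integral>x. u x \<partial>M)\<^sup>2 \<le> C * (\<integral>x. (norm (G x))\<^sup>2 \<partial>M)"
    by (rule poincare_inequality[OF dom bdd con ne]) (rule that)
  show ?thesis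
  proof (rule that[of "C / measure M \<Omega>"])
    fix u G assume "has_weak_gradient \<Omega> u G" "integrable M (\<lambda>x. (norm (G x))\<^sup>2)" "(\<integral>x. u x \<partial>M) = 0"
    with C(3)[of u G] show "(\<integral>x. (u x)\<^sup>2 \<partial>M) \<le> C / measure M \<Omega> * (\<integral>x. (norm (G x))\<^sup>2 \<partial>M)"
      using measure_pos by (simp add: field_simps)
  qed (use C measure_pos in auto)
qed

lemma exists_centred:
  fixes T :: "real^'d \<Rightarrow> real^'m"
  assumes G: "gradient_fields T G"
  shows "\<exists>T'. gradient_fields T' G \<and> (\<forall>i. (\<integral>x. T' x $ i \<partial>M) = 0) \<and> similarity T' = similarity T"
proof -
  obtain C where C: "\<And>u G. has_weak_gradient \<Omega> u G \<Longrightarrow> integrable M (\<lambda>x. (norm (G x))\<^sup>2)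
      \<Longrightarrow> integrable M (\<lambda>x. (u x)\<^sup>2)"
    by (rule poincare_centred) (rule that)
  have [measurable]: "T \<in> borel_measurable M" by (rule gradient_fields_measurable(1)[OF G])
  have iT: "integrable M (\<lambda>x. T x $ i)" for i
  proof (rule integrable_if_norm_square_integrable)
    have "integrable M (\<lambda>x. (T x $ i)\<^sup>2)"
      using C[of "\<lambda>x. T x $ i" "G i"] G[unfolded gradient_fields_def] by blast
    then show "integrable M (\<lambda>x. (norm (T x $ i))\<^sup>2)" by simp
  qed measurable
  define v where "v = (\<chi> i. (\<integral>x. T x $ i \<partial>M) / measure M \<Omega>)"
  have "(\<integral>x. (T x - v) $ i \<partial>M) = 0" for i
    using iT[of i] measure_pos by (simp add: v_def)
  then show ?thesis using gradient_fields_translate[OF G, of v] by blast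
qed

text \<open>With \<open>D\<close> the Dirichlet energy, the functional is at least \<open>k w0 D - ln (1 + \<beta> D)\<close>. The logarithm lies
  below each of its tangent lines, in particular \<open>ln z \<le> z / s + ln s\<close>, and \<open>s\<close> is chosen so large that \<open>\<beta> D / s\<close> uses up
  at most half of the quadratic term. The lower bound on the similarity itself is recorded as well: it
  keeps the logarithm continuous along a minimizing sequence.\<close>

lemma coercivity:
  assumes \<kappa>: "\<kappa> > 0"
  shows "\<exists>\<gamma>>0. \<exists>K. \<exists>C\<ge>0. \<forall>(T :: real^'d \<Rightarrow> real^'m) G. gradient_fields T G \<and> (\<forall>i. (\<integral>x. T x $ i \<partial>M) = 0) \<longrightarrow>
       \<gamma> * dirichlet G - K \<le> kl_constant \<kappa> * energy G + ln (similarity T) \<and>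
       1 / (1 + C * dirichlet G) \<le> similarity T"
proof -
  obtain C where C: "C \<ge> 0"
    "\<And>u G. has_weak_gradient \<Omega> u G \<Longrightarrow> integrable M (\<lambda>x. (norm (G x))\<^sup>2) \<Longrightarrow> integrable M (\<lambda>x. (u x)\<^sup>2)"
    "\<And>u G. has_weak_gradient \<Omega> u G \<Longrightarrow> integrable M (\<lambda>x. (norm (G x))\<^sup>2) \<Longrightarrow> (\<integral>x. u x \<partial>M) = 0 \<Longrightarrow>
       (\<integral>x. (u x)\<^sup>2 \<partial>M) \<le> C * (\<integral>x. (norm (G x))\<^sup>2 \<partial>M)"
    by (rule poincare_centred) (rule that)
  obtain w0 w1 where w: "0 < w0" "\<And>x. x \<in> \<Omega> \<Longrightarrow> w0 \<le> weight x" "\<And>x. x \<in> \<Omega> \<Longrightarrow> weight x \<le> w1"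
    using weight_bounds by blast
  define k where "k = kl_constant \<kappa>"
  have k: "k > 0" using kl_constant_pos[OF \<kappa>] by (simp add: k_def)
  have b0: "0 < b" using a_pos ab by simp
  define \<beta> where "\<beta> = 4 * b * C"
  have \<beta>: "\<beta> \<ge> 0" using b0 C(1) by (simp add: \<beta>_def)
  \<comment> \<open>\<open>+ 1\<close> keeps \<open>s\<close> positive if \<open>\<beta> = 0\<close>.\<close>
  define s where "s = 2 * \<beta> / (k * w0) + 1"
  have kw: "k * w0 > 0" using k w(1) by simp
  have s: "s > 0" using \<beta> kw by (simp add: s_def add_nonneg_pos)
  have sim: "1 / (1 + \<beta> * dirichlet G) \<le> similarity T"
    if G: "gradient_fields T G" and cen: "\<And>i. (\<integral>x. T x $ i \<partial>M) = 0" for T :: "real^'d \<Rightarrow> real^'m" and G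
  proof -
    note TG = G[unfolded gradient_fields_def, rule_format]
    have [measurable]: "T \<in> borel_measurable M" by (rule gradient_fields_measurable(1)[OF G])
    have iT: "integrable M (\<lambda>x. (T x $ i)\<^sup>2)" for i using C(2)[of "\<lambda>x. T x $ i" "G i"] TG by blast
    have nT: "(norm (T x))\<^sup>2 = (\<Sum>i\<in>UNIV. (T x $ i)\<^sup>2)" for x by (simp add: norm_vec_square)
    have inT: "integrable M (\<lambda>x. (norm (T x))\<^sup>2)" unfolding nT using iT by auto
    have "(\<integral>x. (norm (T x))\<^sup>2 * \<rho> x \<partial>M) \<le> (\<integral>x. (norm (T x))\<^sup>2 * b \<partial>M)"
    proof (rule integral_mono)
      show "integrable M (\<lambda>x. (norm (T x))\<^sup>2 * \<rho> x)" by (rule integrable_bounded_mult[OF inT \<rho>_meas \<rho>_abs])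
      show "(norm (T x))\<^sup>2 * \<rho> x \<le> (norm (T x))\<^sup>2 * b" if "x \<in> space M" for x
        using that \<rho>_bounds(2)[of x] by (intro mult_left_mono) auto
    qed (use inT in simp)
    also have "\<dots> = b * (\<Sum>i\<in>UNIV. \<integral>x. (T x $ i)\<^sup>2 \<partial>M)"
      unfolding nT using iT by (simp add: Bochner_Integration.integral_sum)
    also have "\<dots> \<le> b * (\<Sum>i\<in>UNIV. C * (\<integral>x. (norm (G i x))\<^sup>2 \<partial>M))"
      using b0 TG cen by (intro mult_left_mono sum_mono C(3)) auto
    also have "\<dots> = b * C * dirichlet G" by (simp add: dirichlet_def sum_distrib_left mult.assoc)
    finally have q: "1 + 4 * (\<integral>x. (norm (T x))\<^sup>2 * \<rho> x \<partial>M) \<le> 1 + \<beta> * dirichlet G" by (simp add: \<beta>_def)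
    have "0 \<le> (\<integral>x. (norm (T x))\<^sup>2 * \<rho> x \<partial>M)"
    proof (intro integral_nonneg_AE AE_I2 mult_nonneg_nonneg)
      show "0 \<le> \<rho> x" if "x \<in> space M" for x using that \<rho>_bounds(1)[of x] a_pos by simp
    qed simp
    then have "1 / (1 + \<beta> * dirichlet G) \<le> 1 / (1 + 4 * (\<integral>x. (norm (T x))\<^sup>2 * \<rho> x \<partial>M))"
      using q by (intro divide_left_mono mult_pos_pos) auto
    also have "\<dots> \<le> similarity T" by (rule similarity_lower_bound[OF _ inT]) measurable
    finally show ?thesis .
  qed
  have "k * w0 / 2 * dirichlet G - (1 / s + ln s) \<le> k * energy G + ln (similarity T)"
    if G: "gradient_fields T G" and cen: "\<And>i. (\<integral>x. T x $ i \<partial>M) = 0" for T :: "real^'d \<Rightarrow> real^'m" and G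
  proof -
    let ?D = "dirichlet G"
    have D0: "0 \<le> ?D" by (rule dirichlet_nonneg)
    have z: "1 + \<beta> * ?D > 0" using \<beta> D0 by (simp add: add_pos_nonneg)
    have iG: "integrable M (\<lambda>x. \<Sum>i\<in>UNIV. (norm (G i x))\<^sup>2)" using G by (auto simp: gradient_fields_def)
    have "w0 * ?D = (\<integral>x. (\<Sum>i\<in>UNIV. (norm (G i x))\<^sup>2) * w0 \<partial>M)"
      using G by (simp add: dirichlet_def Bochner_Integration.integral_sum gradient_fields_def mult.commute)
    also have "\<dots> \<le> energy G"
      unfolding energy_def
      by (rule integral_mono[OF _ energy_integrable[OF G]]) (use iG w in \<open>auto intro!: mult_left_mono sum_nonneg\<close>)
    finally have "k * (w0 * ?D) \<le> k * energy G" using k by (intro mult_left_mono) auto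
    moreover have "- ln (1 + \<beta> * ?D) \<le> ln (similarity T)"
    proof -
      have "- ln (1 + \<beta> * ?D) = ln (1 / (1 + \<beta> * ?D))" using z by (simp add: ln_div)
      also have "\<dots> \<le> ln (similarity T)"
        using sim[OF G cen] z by (intro ln_mono) auto
      finally show ?thesis .
    qed
    moreover have "ln (1 + \<beta> * ?D) \<le> (1 + \<beta> * ?D) / s + ln s"
    proof -
      have "ln (1 + \<beta> * ?D) = ln ((1 + \<beta> * ?D) / s) + ln s" using z s by (simp add: ln_div)
      also have "ln ((1 + \<beta> * ?D) / s) \<le> (1 + \<beta> * ?D) / s - 1" using z s by (intro ln_le_minus_one) simp
      finally show ?thesis by simp
    qed
    moreover have "\<beta> * ?D / s \<le> k * w0 / 2 * ?D"
    proof -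
      have "k * w0 * s = 2 * \<beta> + k * w0" using kw k w(1) unfolding s_def by (simp add: field_simps)
      then have "2 * \<beta> \<le> k * w0 * s" using kw by linarith
      then have "\<beta> / s \<le> k * w0 / 2" using s by (simp add: divide_simps mult.commute)
      from mult_right_mono[OF this D0] show ?thesis by simp
    qed
    moreover have "(1 + \<beta> * ?D) / s = 1 / s + \<beta> * ?D / s" by (rule add_divide_distrib)
    moreover have "k * (w0 * ?D) = k * w0 / 2 * ?D + k * w0 / 2 * ?D" by simp
    ultimately show ?thesis by linarith
  qed
  note main = this
  show ?thesis
    unfolding k_def[symmetric]
  proof (rule exI[of _ "k * w0 / 2"], rule conjI, use kw in simp,
      rule exI[of _ "1 / s + ln s"], rule exI[of _ \<beta>], intro conjI allI impI)
    show "0 \<le> \<beta>" by (rule \<beta>)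
  qed (use main sim in blast)+
qed

section \<open>Lower semicontinuity and compactness\<close>

text \<open>The gradients of all components, multiplied by the square root of the weight, form one
  vector-valued function whose squared $L^2$ norm is the energy. Almost minimal convex combinations of
  these functions converge, and since the weight is bounded below, so do the corresponding
  combinations of gradients.\<close>

lemma energy_lower_semicontinuous:
  fixes T :: "nat \<Rightarrow> real^'d \<Rightarrow> real^'m"
  assumes G: "\<And>n. gradient_fields (T n) (G n)"
    and iT: "\<And>n. integrable M (T n)" and iF: "integrable M F"
    and L1: "(\<lambda>n. \<integral>x. norm (T n x - F x) \<partial>M) \<longlonglongrightarrow> 0"
    and lim: "(\<lambda>n. energy (G n)) \<longlonglongrightarrow> l"
  shows "\<exists>H. gradient_fields F H \<and> energy H \<le> l"
proof -
  obtain w0 w1 where w: "0 < w0" "\<And>x. x \<in> \<Omega> \<Longrightarrow> w0 \<le> weight x" "\<And>x. x \<in> \<Omega> \<Longrightarrow> weight x \<le> w1"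
    using weight_bounds by blast
  have wp: "0 < weight x" if "x \<in> \<Omega>" for x using w(1) w(2)[OF that] by simp
  have Gm [measurable]: "G n i \<in> borel_measurable M" for n i by (rule gradient_fields_measurable(2)[OF G])
  have iG: "integrable M (G n i)" for n i
    by (rule integrable_if_norm_square_integrable) (use G in \<open>auto simp: gradient_fields_def\<close>)
  define \<Phi> :: "nat \<Rightarrow> real^'d \<Rightarrow> (real^'d)^'m" where "\<Phi> = (\<lambda>n x. \<chi> i. sqrt (weight x) *\<^sub>R G n i x)"
  have \<Phi>_nth: "\<Phi> n x $ i = sqrt (weight x) *\<^sub>R G n i x" for n x i by (simp add: \<Phi>_def)
  have \<Phi>m: "\<Phi> n \<in> borel_measurable M" for n
    by (rule borel_measurable_vec) (simp add: \<Phi>_nth)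
  have \<Phi>sq: "(norm (\<Phi> n x))\<^sup>2 = (\<Sum>i\<in>UNIV. (norm (G n i x))\<^sup>2) * weight x" if "x \<in> \<Omega>" for n x
    using wp[OF that] by (simp add: norm_vec_square \<Phi>_nth power_mult_distrib sum_distrib_left mult.commute)
  have \<Phi>i: "integrable M (\<lambda>x. (norm (\<Phi> n x))\<^sup>2)" for n
    by (subst Bochner_Integration.integrable_cong[OF refl \<Phi>sq]) (auto intro: energy_integrable[OF G])
  have \<Phi>e: "(\<integral>x. (norm (\<Phi> n x))\<^sup>2 \<partial>M) = energy (G n)" for n
    unfolding energy_def by (intro Bochner_Integration.integral_cong) (simp_all add: \<Phi>sq)
  have \<Phi>lim: "(\<lambda>n. \<integral>x. (norm (\<Phi> n x))\<^sup>2 \<partial>M) \<longlonglongrightarrow> l" using lim by (simp add: \<Phi>e)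
  obtain p c \<Psi> where \<Psi>: "\<And>N. (p N, c N) \<in> tail_weights N"
    "integrable M \<Psi>" "(\<lambda>N. \<integral>x. norm ((\<Sum>k<p N. c N k *\<^sub>R \<Phi> k x) - \<Psi> x) \<partial>M) \<longlonglongrightarrow> 0"
    "integrable M (\<lambda>x. (norm (\<Psi> x))\<^sup>2)" "(\<integral>x. (norm (\<Psi> x))\<^sup>2 \<partial>M) \<le> l"
    by (rule mazur_minimal_norm[OF \<Phi>m \<Phi>i \<Phi>lim]) (rule that)
  define H where "H = (\<lambda>i x. (1 / sqrt (weight x)) *\<^sub>R (\<Psi> x $ i))"
  have [measurable]: "\<Psi> \<in> borel_measurable M" using \<Psi>(2) by auto
  have [measurable]: "\<Phi> n \<in> borel_measurable M" for n by (rule \<Phi>m)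
  have i\<Phi>: "integrable M (\<Phi> n)" for n by (rule integrable_if_norm_square_integrable[OF \<Phi>m \<Phi>i])
  have Hm [measurable]: "H i \<in> borel_measurable M" for i unfolding H_def by measurable
  have inv: "1 / sqrt (weight x) \<le> 1 / sqrt w0" "0 \<le> 1 / sqrt (weight x)" if "x \<in> \<Omega>" for x
    using w(1) w(2)[OF that] by (auto intro!: divide_left_mono)
  have Hle: "norm ((1 / sqrt (weight x)) *\<^sub>R (v $ i)) \<le> 1 / sqrt w0 * norm v" if "x \<in> \<Omega>" for x i and v ::
      "(real^'d)^'m"
  proof -
    have "norm ((1 / sqrt (weight x)) *\<^sub>R (v $ i)) = 1 / sqrt (weight x) * norm (v $ i)" using inv(2)[OF that]
        by simp
    also have "\<dots> \<le> 1 / sqrt w0 * norm v"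
      using inv[OF that] w(1) by (intro mult_mono Finite_Cartesian_Product.norm_nth_le) auto
    finally show ?thesis .
  qed
  have Hsq: "integrable M (\<lambda>x. (norm (H i x))\<^sup>2)" for i
  proof (rule Bochner_Integration.integrable_bound[OF integrable_mult_right[OF \<Psi>(4), of "(1 / sqrt w0)\<^sup>2"]])
    show "AE x in M. norm ((norm (H i x))\<^sup>2) \<le> norm ((1 / sqrt w0)\<^sup>2 * (norm (\<Psi> x))\<^sup>2)"
    proof (rule AE_I2)
      fix x assume "x \<in> space M"
      then have "(norm (H i x))\<^sup>2 \<le> (1 / sqrt w0 * norm (\<Psi> x))\<^sup>2"
        unfolding H_def by (intro power_mono Hle) auto
      then show "norm ((norm (H i x))\<^sup>2) \<le> norm ((1 / sqrt w0)\<^sup>2 * (norm (\<Psi> x))\<^sup>2)"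
        using w(1) by (simp add: power_divide)
    qed
  qed measurable
  have iH: "integrable M (H i)" for i by (rule integrable_if_norm_square_integrable[OF Hm Hsq])
  have wgF: "has_weak_gradient \<Omega> (\<lambda>x. F x $ i) (H i)" for i
  proof (rule has_weak_gradient_L1_limit[OF open_domain,
        where v = "\<lambda>N x. \<Sum>k<p N. c N k * T k x $ i" and H = "\<lambda>N x. \<Sum>k<p N. c N k *\<^sub>R G k i x"])
    show "has_weak_gradient \<Omega> (\<lambda>x. \<Sum>k<p N. c N k * T k x $ i) (\<lambda>x. \<Sum>k<p N. c N k *\<^sub>R G k i x)" for N
      using G by (intro has_weak_gradient_linear_combination[OF open_domain]) (auto simp: gradient_fields_def)
    have iTi: "integrable M (\<lambda>x. T n x $ i)" for n
      by (rule integrable_bounded_linear[OF bounded_linear_vec_nth iT])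
    have iFi: "integrable M (\<lambda>x. F x $ i)"
      by (rule integrable_bounded_linear[OF bounded_linear_vec_nth iF])
    show "integrable M (\<lambda>x. \<Sum>k<p N. c N k * T k x $ i)" for N using iTi by auto
    show "integrable M (\<lambda>x. F x $ i)" by (rule iFi)
    show "integrable M (\<lambda>x. \<Sum>k<p N. c N k *\<^sub>R G k i x)" for N using iG by auto
    show "integrable M (H i)" by (rule iH)
    have "(\<lambda>n. \<integral>x. norm (T n x $ i - F x $ i) \<partial>M) \<longlonglongrightarrow> 0"
    proof (rule tendsto_sandwich[OF _ _ tendsto_const L1])
      show "\<forall>\<^sub>F n in sequentially. (\<integral>x. norm (T n x $ i - F x $ i) \<partial>M) \<le> (\<integral>x. norm (T n x - F x) \<partial>M)"
      proof (intro always_eventually allI integral_mono)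
        fix n x
        show "norm (T n x $ i - F x $ i) \<le> norm (T n x - F x)"
          using Finite_Cartesian_Product.norm_nth_le[of "T n x - F x" i] by simp
      qed (use iTi iFi iT iF in auto)
    qed auto
    from tail_combination_L1_limit[OF \<Psi>(1) iTi iFi this]
    show "(\<lambda>N. \<integral>x. norm ((\<Sum>k<p N. c N k * T k x $ i) - F x $ i) \<partial>M) \<longlonglongrightarrow> 0" by simp
    show "(\<lambda>N. \<integral>x. norm ((\<Sum>k<p N. c N k *\<^sub>R G k i x) - H i x) \<partial>M) \<longlonglongrightarrow> 0"
    proof (rule tendsto_sandwich[OF _ _ tendsto_const tendsto_mult_right_zero[OF \<Psi>(3), of "1 / sqrt w0"]])
      show "\<forall>\<^sub>F N in sequentially. (\<integral>x. norm ((\<Sum>k<p N. c N k *\<^sub>R G k i x) - H i x) \<partial>M)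
         \<le> 1 / sqrt w0 * (\<integral>x. norm ((\<Sum>k<p N. c N k *\<^sub>R \<Phi> k x) - \<Psi> x) \<partial>M)"
      proof (intro always_eventually allI)
        fix N
        have "(\<integral>x. norm ((\<Sum>k<p N. c N k *\<^sub>R G k i x) - H i x) \<partial>M)
          \<le> (\<integral>x. 1 / sqrt w0 * norm ((\<Sum>k<p N. c N k *\<^sub>R \<Phi> k x) - \<Psi> x) \<partial>M)"
        proof (rule integral_mono)
          fix x assume "x \<in> space M"
          then have x: "x \<in> \<Omega>" by simp
          have "G k i x = (1 / sqrt (weight x)) *\<^sub>R (\<Phi> k x $ i)" for k using wp[OF x] by (simp add: \<Phi>_nth)
          then have "(\<Sum>k<p N. c N k *\<^sub>R G k i x) - H i x
              = (1 / sqrt (weight x)) *\<^sub>R (((\<Sum>k<p N. c N k *\<^sub>R \<Phi> k x) - \<Psi> x) $ i)"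
            by (simp add: H_def scaleR_diff_right scaleR_sum_right mult.commute)
          then show "norm ((\<Sum>k<p N. c N k *\<^sub>R G k i x) - H i x)
              \<le> 1 / sqrt w0 * norm ((\<Sum>k<p N. c N k *\<^sub>R \<Phi> k x) - \<Psi> x)"
            using Hle[OF x, of "(\<Sum>k<p N. c N k *\<^sub>R \<Phi> k x) - \<Psi> x" i] by (simp only:)
        qed (use iG iH i\<Phi> \<Psi>(2) in auto)
        then show "(\<integral>x. norm ((\<Sum>k<p N. c N k *\<^sub>R G k i x) - H i x) \<partial>M)
          \<le> 1 / sqrt w0 * (\<integral>x. norm ((\<Sum>k<p N. c N k *\<^sub>R \<Phi> k x) - \<Psi> x) \<partial>M)" by simp
      qed
    qed auto
  qed
  have "energy H = (\<integral>x. (norm (\<Psi> x))\<^sup>2 \<partial>M)"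
    unfolding energy_def
  proof (intro Bochner_Integration.integral_cong refl)
    fix x assume "x \<in> space M"
    then have "0 < weight x" using wp by simp
    then have "(norm (H i x))\<^sup>2 * weight x = (norm (\<Psi> x $ i))\<^sup>2" for i
      by (simp add: H_def power_mult_distrib power_divide)
    then show "(\<Sum>i\<in>UNIV. (norm (H i x))\<^sup>2) * weight x = (norm (\<Psi> x))\<^sup>2"
      by (simp add: norm_vec_square[of "\<Psi> x"] sum_distrib_right)
  qed
  then show ?thesis using wgF Hsq \<Psi>(5) by (intro exI[of _ H]) (auto simp: gradient_fields_def)
qed

text \<open>Rellich's theorem for each of the finitely many components, on a common subsequence.\<close>

lemma L1_compactness:
  fixes T :: "nat \<Rightarrow> real^'d \<Rightarrow> real^'m"
  assumes G: "\<And>n. gradient_fields (T n) (G n)" and cen: "\<And>n i. (\<integral>x. T n x $ i \<partial>M) = 0"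
    and D: "\<And>n. dirichlet (G n) \<le> K"
  shows "\<exists>r F. strict_mono r \<and> (\<forall>n. integrable M (T n)) \<and> integrable M F \<and> (AE x in M. (\<lambda>n. T (r n) x) \<longlonglongrightarrow> F x) \<and>
    (\<lambda>n. \<integral>x. norm (T (r n) x - F x) \<partial>M) \<longlonglongrightarrow> 0"
proof -
  obtain C where C: "C \<ge> 0"
    "\<And>u G. has_weak_gradient \<Omega> u G \<Longrightarrow> integrable M (\<lambda>x. (norm (G x))\<^sup>2) \<Longrightarrow> integrable M (\<lambda>x. (u x)\<^sup>2)"
    "\<And>u G. has_weak_gradient \<Omega> u G \<Longrightarrow> integrable M (\<lambda>x. (norm (G x))\<^sup>2) \<Longrightarrow> (\<integral>x. u x \<partial>M) = 0 \<Longrightarrow>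
       (\<integral>x. (u x)\<^sup>2 \<partial>M) \<le> C * (\<integral>x. (norm (G x))\<^sup>2 \<partial>M)"
    by (rule poincare_centred) (rule that)
  note TG = G[unfolded gradient_fields_def, rule_format]
  have Tm [measurable]: "T n \<in> borel_measurable M" for n by (rule gradient_fields_measurable(1)[OF G])
  have sqT: "integrable M (\<lambda>x. (T n x $ i)\<^sup>2)" for n i using C(2)[of "\<lambda>x. T n x $ i" "G n i"] TG by blast
  have iTi: "integrable M (\<lambda>x. T n x $ i)" for n i
    by (rule integrable_if_norm_square_integrable) (use sqT in auto)
  have iT: "integrable M (T n)" for n
  proof (rule integrable_if_norm_square_integrable[OF Tm])
    show "integrable M (\<lambda>x. (norm (T n x))\<^sup>2)" using sqT by (simp add: norm_vec_square)
  qed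
  define K' where "K' = (1 + C) * K"
  have K0: "0 \<le> K" using D[of 0] dirichlet_nonneg[of "G 0"] by linarith
  have bG1: "(\<integral>x. (norm (G n i x))\<^sup>2 \<partial>M) \<le> K" for n i
  proof -
    have "(\<integral>x. (norm (G n i x))\<^sup>2 \<partial>M) \<le> dirichlet (G n)" unfolding dirichlet_def by (rule member_le_sum) auto
    then show ?thesis using D[of n] by simp
  qed
  have bG: "(\<integral>x. (norm (G n i x))\<^sup>2 \<partial>M) \<le> K'" for n i
    using bG1[of n i] mult_nonneg_nonneg[OF C(1) K0] unfolding K'_def distrib_right by linarith
  have bT: "(\<integral>x. (T n x $ i)\<^sup>2 \<partial>M) \<le> K'" for n i
  proof -
    have "(\<integral>x. (T n x $ i)\<^sup>2 \<partial>M) \<le> C * (\<integral>x. (norm (G n i x))\<^sup>2 \<partial>M)" by (rule C(3)) (use TG cen in auto)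
    also have "\<dots> \<le> C * K" using C(1) by (intro mult_left_mono bG1)
    finally show ?thesis using K0 by (simp add: K'_def distrib_right)
  qed
  define P where "P = (\<lambda>(i::'m) (r :: nat \<Rightarrow> nat). \<forall>e>0. \<exists>N. \<forall>j\<ge>N. \<forall>k\<ge>N. (\<integral>x. norm (T (r j) x $ i
      - T (r k) x $ i) \<partial>M) < e)"
  have "\<exists>r::nat \<Rightarrow> nat. strict_mono r \<and> (\<forall>i\<in>UNIV. P i r)"
  proof (rule finite_common_subsequence)
    fix i and r :: "nat \<Rightarrow> nat"
    obtain s :: "nat \<Rightarrow> nat" where "strict_mono s"
      "\<And>e. e > 0 \<Longrightarrow> \<exists>N. \<forall>j\<ge>N. \<forall>k\<ge>N. (\<integral>x. norm (T (r (s j)) x $ i - T (r (s k)) x $ i) \<partial>M) < e"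
      by (rule rellich[of \<Omega> "\<lambda>n x. T (r n) x $ i" "\<lambda>n. G (r n) i" K'])
        (use open_domain bdd TG sqT bT bG in \<open>auto intro: that\<close>)
    then show "\<exists>s::nat \<Rightarrow> nat. strict_mono s \<and> P i (r \<circ> s)" by (auto simp: P_def)
  next
    fix i and r s :: "nat \<Rightarrow> nat" assume P: "P i r" and s: "strict_mono s"
    show "P i (r \<circ> s)"
      unfolding P_def
    proof (intro allI impI)
      fix e :: real assume "e > 0"
      then obtain N where N: "\<forall>j\<ge>N. \<forall>k\<ge>N. (\<integral>x. norm (T (r j) x $ i - T (r k) x $ i) \<partial>M) < e"
        using P unfolding P_def by blast
      have "\<forall>j\<ge>N. \<forall>k\<ge>N. (\<integral>x. norm (T ((r \<circ> s) j) x $ i - T ((r \<circ> s) k) x $ i) \<partial>M) < e"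
      proof (intro allI impI)
        fix j k assume "j \<ge> N" "k \<ge> N"
        then have "s j \<ge> N" "s k \<ge> N" using seq_suble[OF s, of j] seq_suble[OF s, of k] by simp_all
        then show "(\<integral>x. norm (T ((r \<circ> s) j) x $ i - T ((r \<circ> s) k) x $ i) \<partial>M) < e" using N by simp
      qed
      then show "\<exists>N. \<forall>j\<ge>N. \<forall>k\<ge>N. (\<integral>x. norm (T ((r \<circ> s) j) x $ i - T ((r \<circ> s) k) x $ i) \<partial>M) < e" by blast
    qed
  qed simp
  then obtain r where r: "strict_mono r" "\<And>i. P i r" by blast
  have cau: "\<exists>N. \<forall>j\<ge>N. \<forall>k\<ge>N. (\<integral>x. norm (T (r j) x - T (r k) x) \<partial>M) < e" if e: "e > 0" for e
  proof -
    let ?m = "real CARD('m)"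
    have m: "?m > 0" by simp
    have em: "e / ?m > 0" using e m by (rule divide_pos_pos)
    have "\<exists>N. \<forall>j\<ge>N. \<forall>k\<ge>N. (\<integral>x. norm (T (r j) x $ i - T (r k) x $ i) \<partial>M) < e / ?m" for i
      by (rule r(2)[of i, unfolded P_def, rule_format, OF em])
    then have "\<exists>N. \<forall>i. \<forall>j\<ge>N i. \<forall>k\<ge>N i. (\<integral>x. norm (T (r j) x $ i - T (r k) x $ i) \<partial>M) < e / ?m"
      by (intro choice allI)
    then obtain N where N: "\<And>i j k. j \<ge> N i \<Longrightarrow> k \<ge> N i \<Longrightarrow> (\<integral>x. norm (T (r j) x $ i - T (r k) x $ i) \<partial>M) < e / ?m"
      by blast
    define N' where "N' = Max (range N)"
    have N': "N i \<le> N'" for i unfolding N'_def by (rule Max_ge) auto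
    have "(\<integral>x. norm (T (r j) x - T (r k) x) \<partial>M) < e" if jk: "j \<ge> N'" "k \<ge> N'" for j k
    proof -
      have "(\<integral>x. norm (T (r j) x - T (r k) x) \<partial>M) \<le> (\<integral>x. (\<Sum>i\<in>UNIV. norm (T (r j) x $ i - T (r k) x $ i)) \<partial>M)"
      proof (rule integral_mono)
        show "norm (T (r j) x - T (r k) x) \<le> (\<Sum>i\<in>UNIV. norm (T (r j) x $ i - T (r k) x $ i))" for x
          using norm_le_l1_cart[of "T (r j) x - T (r k) x"] by simp
      qed (use iT iTi in auto)
      also have "\<dots> = (\<Sum>i\<in>UNIV. \<integral>x. norm (T (r j) x $ i - T (r k) x $ i) \<partial>M)"
        using iTi by (intro Bochner_Integration.integral_sum) auto
      also have "\<dots> < of_nat (card (UNIV :: 'm set)) * (e / ?m)"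
        using N N' jk by (intro sum_bounded_above_strict) (meson order.trans, simp)
      also have "\<dots> = e" using m by simp
      finally show ?thesis .
    qed
    then show ?thesis by blast
  qed
  obtain r' F where F: "strict_mono r'" "AE x in M. (\<lambda>i. T (r (r' i)) x) \<longlonglongrightarrow> F x" "integrable M F"
    "(\<lambda>n. \<integral>x. norm (T (r n) x - F x) \<partial>M) \<longlonglongrightarrow> 0"
    by (rule L1_complete[of M "\<lambda>n. T (r n)", OF iT cau]) (assumption, rule that)
  have "(\<lambda>n. \<integral>x. norm (T ((r \<circ> r') n) x - F x) \<partial>M) \<longlonglongrightarrow> 0"
    using LIMSEQ_subseq_LIMSEQ[OF F(4) F(1)] by (simp add: o_def)
  then show ?thesis using strict_mono_o[OF r(1) F(1)] iT F(2,3) by (intro exI[of _ "r \<circ> r'"] exI[of _ F]) auto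
qed

section \<open>Existence of a minimizer\<close>

theorem minimizer_exists:
  assumes \<kappa>: "\<kappa> > 0"
  shows "\<exists>T :: real^'d \<Rightarrow> real^'m. T \<in> H1_weighted \<Omega> \<rho> \<and>
    KL \<Omega> \<rho> \<kappa> T = (INF S \<in> (borel_measurable M :: (real^'d \<Rightarrow> real^'m) set). KL \<Omega> \<rho> \<kappa> S)"
proof -
  define k where "k = kl_constant \<kappa>"
  have k: "k > 0" using kl_constant_pos[OF \<kappa>] by (simp add: k_def)
  obtain \<gamma> K C where co12: "\<gamma> > 0" "C \<ge> 0" and co': "\<forall>(T :: real^'d \<Rightarrow> real^'m) G.
      gradient_fields T G \<and> (\<forall>i. (\<integral>x. T x $ i \<partial>M) = 0) \<longrightarrow>
       \<gamma> * dirichlet G - K \<le> k * energy G + ln (similarity T) \<and> 1 / (1 + C * dirichlet G) \<le> similarity T"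
    using coercivity[where 'm = 'm, OF \<kappa>] unfolding k_def by blast
  have co34: "\<gamma> * dirichlet G - K \<le> k * energy G + ln (similarity T)" "1 / (1 + C * dirichlet G) \<le> similarity T"
    if "gradient_fields T G" "\<And>i. (\<integral>x. T x $ i \<partial>M) = 0" for T :: "real^'d \<Rightarrow> real^'m" and G
    using co' that by blast+
  note co = co12 co34
  define V :: "(real^'d \<Rightarrow> real^'m) \<Rightarrow> ereal" where "V = KL \<Omega> \<rho> \<kappa>"
  have VG: "V T = ereal (k * energy G + ln (similarity T))" if "gradient_fields T G" for T G
    unfolding V_def k_def by (rule KL_gradient_fields[OF that])
  define m where "m = (INF S \<in> borel_measurable M. V S)"
  have centre: "\<exists>T G. gradient_fields T G \<and> (\<forall>i. (\<integral>x. T x $ i \<partial>M) = 0) \<and> V T = V S" if fin: "V S \<noteq> \<infinity>" for S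
  proof -
    obtain G where G: "gradient_fields S G"
      by (rule KL_finite_gradient_fields[OF fin[unfolded V_def]]) (rule that)
    from exists_centred[OF G] obtain T where T: "gradient_fields T G" "\<forall>i. (\<integral>x. T x $ i \<partial>M) = 0" "similarity T
        = similarity S"
      by blast
    then have "V T = V S" using VG[OF T(1)] VG[OF G] by simp
    with T show ?thesis by blast
  qed
  have "ereal (- K) \<le> V S" for S
  proof (cases "V S = \<infinity>")
    case False
    then obtain T G where T: "gradient_fields T G" "\<forall>i. (\<integral>x. T x $ i \<partial>M) = 0" "V T = V S" using centre by blast
    have "- K \<le> \<gamma> * dirichlet G - K" using co(1) dirichlet_nonneg[of G] by simp
    also have "\<dots> \<le> k * energy G + ln (similarity T)" using T by (intro co(3)) auto
    finally show ?thesis using VG[OF T(1)] T(3) by simp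
  qed simp
  then have "ereal (- K) \<le> m" unfolding m_def by (intro INF_greatest)
  moreover have "m \<le> V (\<lambda>_. 0)" unfolding m_def by (rule INF_lower) simp
  ultimately obtain m' where m': "m = ereal m'"
    using VG[OF gradient_fields_const[of 0]] by (cases m) auto
  have "\<exists>T G. gradient_fields T G \<and> (\<forall>i. (\<integral>x. T x $ i \<partial>M) = 0) \<and> V T < ereal (m' + 1 / real (Suc n))" for n
  proof -
    have "m < ereal (m' + 1 / real (Suc n))" unfolding m' by simp
    then obtain S where S: "V S < ereal (m' + 1 / real (Suc n))" unfolding m_def by (auto simp: INF_less_iff)
    then have "V S \<noteq> \<infinity>" by auto
    with centre[of S] S show ?thesis by metis
  qed
  then obtain T G where T: "\<And>n. gradient_fields (T n) (G n)" "\<And>n i. (\<integral>x. T n x $ i \<partial>M) = 0"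
    "\<And>n. V (T n) < ereal (m' + 1 / real (Suc n))" by metis
  define val where "val = (\<lambda>n. k * energy (G n) + ln (similarity (T n)))"
  have Tm: "T n \<in> borel_measurable M" for n by (rule gradient_fields_measurable(1)[OF T(1)])
  have val_upper: "val n < m' + 1 / real (Suc n)" for n using T(3)[of n] VG[OF T(1)[of n]] by
      (simp add: val_def)
  have val_lower: "m' \<le> val n" for n
  proof -
    have "m \<le> V (T n)" unfolding m_def by (rule INF_lower[OF Tm])
    then show ?thesis using VG[OF T(1)[of n]] by (simp add: val_def m')
  qed
  have "val \<longlonglongrightarrow> m'"
  proof (rule tendsto_sandwich[OF _ _ tendsto_const])
    have "(\<lambda>n. m' + inverse (real (Suc n))) \<longlonglongrightarrow> m' + 0" by (intro tendsto_intros LIMSEQ_inverse_real_of_nat)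
    then show "(\<lambda>n. m' + inverse (real (Suc n))) \<longlonglongrightarrow> m'" by simp
  qed (use val_upper val_lower in \<open>auto simp: inverse_eq_divide intro!: always_eventually less_imp_le\<close>)
  note val_lim = this
  define D where "D = (m' + 1 + K) / \<gamma>"
  have dir: "dirichlet (G n) \<le> D" for n
  proof -
    have "\<gamma> * dirichlet (G n) - K \<le> val n" unfolding val_def by (rule co(3)[OF T(1,2)])
    also have "val n \<le> m' + 1"
    proof -
      have "1 / real (Suc n) \<le> 1" by simp
      then show ?thesis using val_upper[of n] by linarith
    qed
    finally show ?thesis using co(1) by (simp add: D_def field_simps)
  qed
  have D0: "0 \<le> D" using dir[of 0] dirichlet_nonneg[of "G 0"] by linarith
  obtain r F where F: "strict_mono r" "\<And>n. integrable M (T n)" "integrable M F" "AE x in M. (\<lambda>n. T (r n) x)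
      \<longlonglongrightarrow> F x"
    "(\<lambda>n. \<integral>x. norm (T (r n) x - F x) \<partial>M) \<longlonglongrightarrow> 0"
    using L1_compactness[of T G, OF T(1,2) dir] by blast
  have Fm: "F \<in> borel_measurable M" using F(3) by auto
  have sim_lim: "(\<lambda>n. similarity (T (r n))) \<longlonglongrightarrow> similarity F"
    by (rule similarity_tendsto[OF Tm Fm F(4)])
  have sim_pos: "0 < similarity F"
  proof -
    have CD: "0 < 1 + C * D" using co(2) D0 by (simp add: add_pos_nonneg)
    have "1 / (1 + C * D) \<le> similarity (T (r n))" for n
    proof -
      have "1 / (1 + C * D) \<le> 1 / (1 + C * dirichlet (G (r n)))"
        using co(2) dir[of "r n"] dirichlet_nonneg[of "G (r n)"] CD
        by (intro divide_left_mono) (auto intro!: mult_left_mono mult_pos_pos add_pos_nonneg)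
      also have "\<dots> \<le> similarity (T (r n))" by (rule co(4)[OF T(1,2)])
      finally show ?thesis .
    qed
    then have "1 / (1 + C * D) \<le> similarity F" by (intro LIMSEQ_le_const[OF sim_lim]) auto
    then show ?thesis using CD by (meson divide_pos_pos less_le_trans zero_less_one)
  qed
  have "(\<lambda>n. (val (r n) - ln (similarity (T (r n)))) / k) \<longlonglongrightarrow> (m' - ln (similarity F)) / k"
    using LIMSEQ_subseq_LIMSEQ[OF val_lim F(1)] sim_lim sim_pos k
    by (intro tendsto_intros) (auto simp: o_def)
  then have en_lim: "(\<lambda>n. energy (G (r n))) \<longlonglongrightarrow> (m' - ln (similarity F)) / k"
    using k by (simp add: val_def)
  obtain H where H: "gradient_fields F H" "energy H \<le> (m' - ln (similarity F)) / k"
    using energy_lower_semicontinuous[of "\<lambda>n. T (r n)" "\<lambda>n. G (r n)" F, OF T(1) F(2) F(3) F(5) en_lim] by blast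
  have "k * energy H + ln (similarity F) \<le> m'" using H(2) k by (simp add: field_simps)
  then have "V F \<le> m" using VG[OF H(1)] by (simp add: m')
  moreover have "m \<le> V F" unfolding m_def by (rule INF_lower[OF Fm])
  ultimately have VF: "V F = m" by simp
  have "F \<in> H1_weighted \<Omega> \<rho>"
  proof -
    obtain C where C: "\<And>u G. has_weak_gradient \<Omega> u G \<Longrightarrow> integrable M (\<lambda>x. (norm (G x))\<^sup>2)
        \<Longrightarrow> integrable M (\<lambda>x. (u x)\<^sup>2)"
      by (rule poincare_centred) (rule that)
    note HF = H(1)[unfolded gradient_fields_def, rule_format]
    let ?W = "\<lambda>i. weak_gradient \<Omega> (\<lambda>x. F x $ i)"
    have hW: "has_weak_gradient \<Omega> (\<lambda>x. F x $ i) (?W i)" for i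
      unfolding weak_gradient_def by (rule someI[of "has_weak_gradient \<Omega> (\<lambda>x. F x $ i)"]) (use HF in blast)
    have [measurable]: "?W i \<in> borel_measurable M" "H i \<in> borel_measurable M" for i
      using hW[of i] gradient_fields_measurable(2)[OF H(1)]
      by (auto simp: has_weak_gradient_def intro!: locally_integrable_measurable[OF open_domain])
    have iW: "integrable M (\<lambda>x. (norm (?W i x))\<^sup>2)" for i
    proof (subst integrable_cong_AE)
      show "AE x in M. (norm (?W i x))\<^sup>2 = (norm (H i x))\<^sup>2"
        using weak_gradient_AE_unique[OF open_domain hW[of i], of "H i"] HF[of i] by
            (auto elim: eventually_mono)
      show "integrable M (\<lambda>x. (norm (H i x))\<^sup>2)" using HF by blast
    qed measurable
    have iF2: "integrable M (\<lambda>x. (F x $ i)\<^sup>2)" for i using C[of "\<lambda>x. F x $ i" "H i"] HF by blast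
    have "integrable M (\<lambda>x. (norm (F x))\<^sup>2 + (\<Sum>i\<in>UNIV. (norm (?W i x))\<^sup>2))"
      using iF2 iW by (simp add: norm_vec_square)
    then have "integrable M (\<lambda>x. ((norm (F x))\<^sup>2 + (\<Sum>i\<in>UNIV. (norm (?W i x))\<^sup>2)) * \<rho> x)"
      by (rule integrable_bounded_mult[OF _ \<rho>_meas \<rho>_abs])
    then show ?thesis unfolding H1_weighted_def using Fm HF by blast
  qed
  then show ?thesis using VF unfolding V_def m_def by blast
qed

end

theorem theorem2p6:
  fixes \<mu> :: "(real^'d) measure"
    and \<Omega> :: "(real^'d) set"
    and \<rho> :: "real^'d \<Rightarrow> real"
    and \<kappa> :: real
  assumes "bounded \<Omega>" "connected \<Omega>" "C1_domain \<Omega>"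
    and "prob_space \<mu>"
    and "has_density_on \<mu> \<Omega> \<rho>"
    and "\<exists>a b. 0 < a \<and> (\<forall>x\<in>\<Omega>. a \<le> \<rho> x \<and> \<rho> x \<le> b)"
    and "\<kappa> > 0"
  shows "\<exists>T :: real^'d \<Rightarrow> real^'m. T \<in> H1_weighted \<Omega> \<rho> \<and>
           KL \<Omega> \<rho> \<kappa> T = (INF S \<in> (borel_measurable (lebesgue_on \<Omega>) :: (real^'d \<Rightarrow> real^'m) set). KL \<Omega> \<rho> \<kappa> S)"
proof -
  obtain a b where ab: "0 < a" "\<And>x. x \<in> \<Omega> \<Longrightarrow> a \<le> \<rho> x" "\<And>x. x \<in> \<Omega> \<Longrightarrow> \<rho> x \<le> b" using assms(6) by blast
  have dens: "sets \<mu> = sets borel" "\<rho> \<in> borel_measurable (lebesgue_on \<Omega>)"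
    "emeasure \<mu> UNIV = (\<integral>\<^sup>+x. ennreal (\<rho> x) * indicator UNIV x \<partial>lebesgue_on \<Omega>)"
    using assms(5) by (auto simp: has_density_on_def)
  have "space \<mu> = UNIV" using sets_eq_imp_space_eq[OF dens(1)] by simp
  then have "emeasure \<mu> UNIV = 1" using prob_space.emeasure_space_1[OF assms(4)] by simp
  then have one: "(\<integral>\<^sup>+x. ennreal (\<rho> x) \<partial>lebesgue_on \<Omega>) = 1" using dens(3) by simp
  have nn: "AE x in lebesgue_on \<Omega>. 0 \<le> \<rho> x" using ab(1,2) by (intro AE_I2) (force intro: order.trans[of 0 a])
  have "(\<integral>x. \<rho> x \<partial>lebesgue_on \<Omega>) = 1"
    using integral_eq_nn_integral[OF dens(2) nn] one by simp
  moreover have "\<Omega> \<noteq> {}" using one nn_integral_empty[of "lebesgue_on \<Omega>"] by auto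
  ultimately interpret bounded_density \<Omega> \<rho> a b
    using assms ab dens by unfold_locales auto
  show ?thesis by (rule minimizer_exists[OF assms(7)])
qed

end
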